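(* Let $M$ be a compact simply-connected four-manifold with a $T^2$-invariant metric $g$ given on the open union of principal orbits by $g=\Omega^2(dx^2+dy^2)+h$ (notation in the context), and let $\lambda$ be a constant. Suppose that the equations $$\partial\bar\partial\rho=-\tfrac12\lambda\rho\,\Omega^2,$$ $$\partial(\rho K^{-1}\bar\partial K)+\bar\partial(\rho K^{-1}\partial K)=0,$$ $$\partial\bar\partial\log\Omega=\tfrac14\frac{\partial\rho\,\bar\partial\rho}{\rho^2}-\tfrac18\mathrm{tr}\,[K^{-1}\partial K\,K^{-1}\bar\partial K]$$ hold. Then the remaining equation $$8\frac{\partial\log\Omega\,\partial\rho}{\rho}-4\frac{\partial\partial\rho}{\rho}+2\frac{\partial\rho\,\partial\rho}{\rho^2}-\mathrm{tr}\,[K^{-1}\partial K\,K^{-1}\partial K]=0$$ need only hold at the boundary of $M/T^2$ for the metric $g$ to be Einstein (with Einstein constant $\lambda$) everywhere.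
   Context: $T^2$ acts effectively by isometries on the compact four-manifold $M$, and the action is orthogonally transitive (the distribution orthogonal to the orbits is integrable). The quotient $M/T^2$ is a compact, simply-connected two-dimensional space with piecewise smooth polygonal boundary; over its interior the orbits are two-tori. On the union of principal orbits $g=\check g+h$, where $\check g$ is the induced metric on the interior of $M/T^2$ and $h=(h_{ij})=(g(X_i,X_j))$ is the $2\times2$ positive definite matrix of inner products of two independent commuting Killing fields $X_1,X_2$ generating the action; $h$ depends only on the point of $M/T^2$, and $\det h=0$ exactly on $\partial(M/T^2)$. In isothermal coordinates $\check g=\Omega^2(dx^2+dy^2)$ with $\Omega=\Omega(x,y)$. Set $z=x+iy$, $\partial=\frac12(\frac{\partial}{\partial x}-i\frac{\partial}{\partial y})$, $\bar\partial=\frac12(\frac{\partial}{\partial x}+i\frac{\partial}{\partial y})$, $\rho=\sqrt{\det h}$, and define the matrix $K$ by $h=\rho K$ (so $\det K=1$). The metric $g$ is Einstein with constant $\lambda$ (Ricci tensor $=\lambda g$) if and only if all four displayed equations hold on the interior of $M/T^2$ together with the smoothness conditions of the metric at the boundary. *)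

theory Defs
  imports "HOL-Analysis.Analysis"
begin

section \<open>Smooth maps\<close>

text \<open>Meaningful for open \<open>S\<close>; \<open>Ck_on k S f\<close> says that \<open>f\<close> is of class C^k on \<open>S\<close>.\<close>

primrec Ck_on ::
  "nat \<Rightarrow> 'a::real_normed_vector set \<Rightarrow> ('a \<Rightarrow> 'b::real_normed_vector) \<Rightarrow> bool" where
  "Ck_on 0 S f \<longleftrightarrow> continuous_on S f"
| "Ck_on (Suc k) S f \<longleftrightarrow>
     (\<forall>x\<in>S. f differentiable (at x)) \<and> (\<forall>v. Ck_on k S (\<lambda>x. frechet_derivative f (at x) v))"

definition smooth_on ::
  "'a::real_normed_vector set \<Rightarrow> ('a \<Rightarrow> 'b::real_normed_vector) \<Rightarrow> bool" where
  "smooth_on S f \<longleftrightarrow> (\<forall>k. Ck_on k S f)"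


section \<open>Smooth four-manifolds\<close>

text \<open>The underlying space of the manifold is a whole type \<open>'m\<close>, whose sort supplies the Hausdorff
  and second countability axioms. A chart is a pair of its domain and its coordinate map.\<close>

type_synonym 'm chart = "'m set \<times> ('m \<Rightarrow> real^4)"

definition chart_inv :: "'m chart \<Rightarrow> real^4 \<Rightarrow> 'm" where
  "chart_inv c = inv_into (fst c) (snd c)"

definition smooth_atlas :: "'m::topological_space chart set \<Rightarrow> bool" where
  "smooth_atlas A \<longleftrightarrow>
     (\<Union>c\<in>A. fst c) = UNIV \<and>
     (\<forall>c\<in>A. open (fst c) \<and> open (snd c ` fst c) \<and>
        homeomorphism (fst c) (snd c ` fst c) (snd c) (chart_inv c)) \<and>
     (\<forall>c\<in>A. \<forall>c'\<in>A. smooth_on (snd c ` (fst c \<inter> fst c')) (snd c' \<circ> chart_inv c))"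

definition smooth_fun_on ::
  "'m chart set \<Rightarrow> 'm set \<Rightarrow> ('m \<Rightarrow> 'b::real_normed_vector) \<Rightarrow> bool" where
  "smooth_fun_on A W f \<longleftrightarrow> (\<forall>c\<in>A. smooth_on (snd c ` (fst c \<inter> W)) (f \<circ> chart_inv c))"


section \<open>Riemannian metrics and the Einstein condition\<close>

text \<open>A tensor field is given by its components in each chart, subject to the transformation law.\<close>

type_synonym 'm metric = "'m chart \<Rightarrow> real^4 \<Rightarrow> real^4^4"

definition ip :: "'m metric \<Rightarrow> 'm chart \<Rightarrow> 'm \<Rightarrow> real^4 \<Rightarrow> real^4 \<Rightarrow> real" where
  "ip g c p v w = (\<Sum>i\<in>UNIV. \<Sum>j\<in>UNIV. g c (snd c p) $ i $ j * v $ i * w $ j)"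

definition preserves_metric :: "'m chart set \<Rightarrow> 'm metric \<Rightarrow> ('m \<Rightarrow> 'm) \<Rightarrow> bool" where
  "preserves_metric A g f \<longleftrightarrow>
     (\<forall>c\<in>A. \<forall>c'\<in>A. \<forall>p\<in>fst c. f p \<in> fst c' \<longrightarrow>
        (let d = frechet_derivative (snd c' \<circ> f \<circ> chart_inv c) (at (snd c p))
         in \<forall>v w. ip g c p v w = ip g c' (f p) (d v) (d w)))"

text \<open>\<open>preserves_metric A g id\<close> is the tensor transformation law under change of chart.\<close>

definition riemannian_metric :: "'m chart set \<Rightarrow> 'm metric \<Rightarrow> bool" where
  "riemannian_metric A g \<longleftrightarrow>
     (\<forall>c\<in>A. smooth_on (snd c ` fst c) (g c)) \<and>
     (\<forall>c\<in>A. \<forall>p\<in>fst c. (\<forall>v w. ip g c p v w = ip g c p w v) \<and> (\<forall>v. v \<noteq> 0 \<longrightarrow> ip g c p v v > 0)) \<and>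
     preserves_metric A g id"

definition pd :: "4 \<Rightarrow> (real^4 \<Rightarrow> real) \<Rightarrow> real^4 \<Rightarrow> real" where
  "pd i f u = frechet_derivative f (at u) (axis i 1)"

definition christoffel :: "(real^4 \<Rightarrow> real^4^4) \<Rightarrow> 4 \<Rightarrow> 4 \<Rightarrow> 4 \<Rightarrow> real^4 \<Rightarrow> real" where
  "christoffel G k i j u =
     (\<Sum>l\<in>UNIV. matrix_inv (G u) $ k $ l *
        (pd i (\<lambda>x. G x $ l $ j) u + pd j (\<lambda>x. G x $ i $ l) u - pd l (\<lambda>x. G x $ i $ j) u)) / 2"

text \<open>Sign convention: round spheres have positive Ricci curvature.\<close>

definition ricci :: "(real^4 \<Rightarrow> real^4^4) \<Rightarrow> 4 \<Rightarrow> 4 \<Rightarrow> real^4 \<Rightarrow> real" where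
  "ricci G i j u =
     (\<Sum>k\<in>UNIV. pd k (christoffel G k i j) u - pd j (christoffel G k i k) u) +
     (\<Sum>k\<in>UNIV. \<Sum>l\<in>UNIV. christoffel G k k l u * christoffel G l i j u
                           - christoffel G k j l u * christoffel G l i k u)"

definition einstein_metric :: "'m chart set \<Rightarrow> 'm metric \<Rightarrow> real \<Rightarrow> bool" where
  "einstein_metric A g lam \<longleftrightarrow>
     (\<forall>c\<in>A. \<forall>u\<in>snd c ` fst c. \<forall>i j. ricci (g c) i j u = lam * g c u $ i $ j)"


section \<open>Torus actions\<close>

definition torus :: "(complex \<times> complex) set" where
  "torus = sphere 0 1 \<times> sphere 0 1"

definition torus_exp :: "real^2 \<Rightarrow> complex \<times> complex" where
  "torus_exp v = (cis (v $ 1), cis (v $ 2))"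

type_synonym 'm action = "complex \<times> complex \<Rightarrow> 'm \<Rightarrow> 'm"

definition smooth_torus_action :: "'m::topological_space chart set \<Rightarrow> 'm action \<Rightarrow> bool" where
  "smooth_torus_action A act \<longleftrightarrow>
     (\<forall>p. act (1, 1) p = p) \<and>
     (\<forall>s\<in>torus. \<forall>t\<in>torus. \<forall>p. act (fst s * fst t, snd s * snd t) p = act s (act t p)) \<and>
     continuous_on (torus \<times> UNIV) (\<lambda>(t, p). act t p) \<and>
     (\<forall>c\<in>A. \<forall>c'\<in>A.
        smooth_on {(v, u). u \<in> snd c ` fst c \<and> act (torus_exp v) (chart_inv c u) \<in> fst c'}
          (\<lambda>(v, u). snd c' (act (torus_exp v) (chart_inv c u))))"

definition effective_action :: "'m action \<Rightarrow> bool" where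
  "effective_action act \<longleftrightarrow> (\<forall>t\<in>torus. (\<forall>p. act t p = p) \<longrightarrow> t = (1, 1))"

definition isotropy :: "'m action \<Rightarrow> 'm \<Rightarrow> (complex \<times> complex) set" where
  "isotropy act p = {t \<in> torus. act t p = p}"

text \<open>Points on principal orbits, i.e. those with smallest isotropy group; since the torus is
  abelian, no conjugation is needed.\<close>

definition principal_points :: "'m action \<Rightarrow> 'm set" where
  "principal_points act = {p. \<forall>q. isotropy act p \<subseteq> isotropy act q}"

definition orbit :: "'m action \<Rightarrow> 'm \<Rightarrow> 'm set" where
  "orbit act p = (\<lambda>t. act t p) ` torus"

text \<open>Components in the chart \<open>c\<close>, at \<open>p\<close>, of the vector field on the manifold generated by the
  Lie algebra element \<open>v\<close>.\<close>

definition generator :: "'m action \<Rightarrow> real^2 \<Rightarrow> 'm chart \<Rightarrow> 'm \<Rightarrow> real^4" where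
  "generator act v c p = vector_derivative (\<lambda>s. snd c (act (torus_exp (s *\<^sub>R v)) p)) (at 0)"

text \<open>The rows of \<open>b\<close> are the elements of the Lie algebra that generate the Killing fields X_1, X_2;
  \<open>gram\<close> is the matrix of their inner products.\<close>

definition gram :: "'m metric \<Rightarrow> 'm action \<Rightarrow> real^2^2 \<Rightarrow> 'm chart \<Rightarrow> 'm \<Rightarrow> real^2^2" where
  "gram g act b c p = (\<chi> i j. ip g c p (generator act (b $ i) c p) (generator act (b $ j) c p))"

definition horizontal :: "'m metric \<Rightarrow> 'm action \<Rightarrow> 'm chart \<Rightarrow> 'm \<Rightarrow> (real^4) set" where
  "horizontal g act c p = {v. \<forall>a. ip g c p v (generator act a c p) = 0}"

text \<open>Integrability of the distribution orthogonal to the principal orbits: an integral surface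
  passes through each point. The parameter domain is a subset of \<open>complex\<close>, viewed as the
  real plane.\<close>

definition orthogonally_transitive ::
  "'m::topological_space chart set \<Rightarrow> 'm metric \<Rightarrow> 'm action \<Rightarrow> bool" where
  "orthogonally_transitive A g act \<longleftrightarrow>
     (\<forall>p\<in>principal_points act. \<exists>W (\<sigma> :: complex \<Rightarrow> 'm).
        open W \<and> 0 \<in> W \<and> \<sigma> 0 = p \<and> continuous_on W \<sigma> \<and> \<sigma> ` W \<subseteq> principal_points act \<and>
        (\<forall>c\<in>A. smooth_on {w\<in>W. \<sigma> w \<in> fst c} (snd c \<circ> \<sigma>) \<and>
           (\<forall>w\<in>W. \<sigma> w \<in> fst c \<longrightarrow>
              range (frechet_derivative (snd c \<circ> \<sigma>) (at w)) = horizontal g act c (\<sigma> w))))"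


section \<open>The orbit space\<close>

definition orbit_space :: "'m::topological_space action \<Rightarrow> 'm set topology" where
  "orbit_space act =
     topology (\<lambda>V. V \<subseteq> range (orbit act) \<and> open (orbit act -` V))"

lemma openin_orbit_space:
  "openin (orbit_space act) V \<longleftrightarrow> V \<subseteq> range (orbit act) \<and> open (orbit act -` V)"
proof -
  have "istopology (\<lambda>V. V \<subseteq> range (orbit act) \<and> open (orbit act -` V))"
    unfolding istopology_def by (auto simp: vimage_Union)
  then show ?thesis
    by (simp add: orbit_space_def)
qed

definition simply_connected_space :: "'a topology \<Rightarrow> bool" where
  "simply_connected_space X \<longleftrightarrow>
     path_connected_space X \<and>
     (\<forall>f. continuous_map (top_of_set (sphere (0::complex) 1)) X f \<longrightarrow>
        (\<exists>a. homotopic_with (\<lambda>_. True) (top_of_set (sphere (0::complex) 1)) X f (\<lambda>_. a)))"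

definition quadrant :: "complex set" where
  "quadrant = {w. 0 \<le> Re w \<and> 0 \<le> Im w}"

text \<open>The orbit space is a compact simply connected surface with piecewise smooth polygonal
  boundary, i.e. a smooth surface with corners modelled on the closed quadrant. The charts send
  exactly the principal orbits (the two-tori) to the interior of the quadrant, and there the
  smooth structure is the quotient one. Smoothness of a transition map at boundary points means
  local smooth extendability.\<close>

definition polygonal_orbit_space :: "'m::topological_space chart set \<Rightarrow> 'm action \<Rightarrow> bool" where
  "polygonal_orbit_space A act \<longleftrightarrow>
     compact_space (orbit_space act) \<and> simply_connected_space (orbit_space act) \<and>
     (\<exists>B :: ('m set set \<times> ('m set \<Rightarrow> complex)) set.
        (\<Union>(V, \<psi>)\<in>B. V) = topspace (orbit_space act) \<and>
        (\<forall>(V, \<psi>)\<in>B.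
           openin (orbit_space act) V \<and> openin (top_of_set quadrant) (\<psi> ` V) \<and>
           homeomorphic_map (subtopology (orbit_space act) V) (top_of_set (\<psi> ` V)) \<psi> \<and>
           (\<forall>p. orbit act p \<in> V \<longrightarrow>
              (p \<in> principal_points act \<longleftrightarrow> \<psi> (orbit act p) \<in> interior quadrant)) \<and>
           smooth_fun_on A {p\<in>principal_points act. orbit act p \<in> V} (\<psi> \<circ> orbit act) \<and>
           (\<forall>c\<in>A. \<forall>p\<in>fst c \<inter> principal_points act. orbit act p \<in> V \<longrightarrow>
              surj (frechet_derivative (\<psi> \<circ> orbit act \<circ> chart_inv c) (at (snd c p))))) \<and>
        (\<forall>(V, \<psi>)\<in>B. \<forall>(V', \<psi>')\<in>B. \<forall>w\<in>\<psi> ` (V \<inter> V').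
           \<exists>W F. open W \<and> w \<in> W \<and> smooth_on W F \<and>
             (\<forall>w'\<in>W \<inter> \<psi> ` (V \<inter> V'). F w' = \<psi>' (inv_into V \<psi> w'))))"

text \<open>Isothermal coordinates \<open>z = x + iy\<close> on the interior of the orbit space, as a function on the
  union of the principal orbits. The last clause says that the metric induced on the orbit space
  is \<open>\<Omega>\<^sup>2(dx\<^sup>2 + dy\<^sup>2)\<close>, the inner product of \<open>complex\<close> being that of the real plane.\<close>

definition isothermal_coordinates ::
  "'m::topological_space chart set \<Rightarrow> 'm metric \<Rightarrow> 'm action \<Rightarrow> ('m \<Rightarrow> complex) \<Rightarrow> (complex \<Rightarrow> real) \<Rightarrow> bool" where
  "isothermal_coordinates A g act z \<Omega> \<longleftrightarrow>
     smooth_fun_on A (principal_points act) z \<and>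
     open (z ` principal_points act) \<and>
     (\<forall>p\<in>principal_points act. \<forall>q\<in>principal_points act. z p = z q \<longleftrightarrow> orbit act p = orbit act q) \<and>
     smooth_on (z ` principal_points act) \<Omega> \<and> (\<forall>w\<in>z ` principal_points act. \<Omega> w > 0) \<and>
     (\<forall>c\<in>A. \<forall>p\<in>fst c \<inter> principal_points act.
        \<forall>v\<in>horizontal g act c p. \<forall>w\<in>horizontal g act c p.
          (let d = frechet_derivative (z \<circ> chart_inv c) (at (snd c p))
           in ip g c p v w = (\<Omega> (z p))\<^sup>2 * (d v \<bullet> d w)))"


section \<open>The reduced equations\<close>

definition dz :: "(complex \<Rightarrow> complex) \<Rightarrow> complex \<Rightarrow> complex" where
  "dz f w = (frechet_derivative f (at w) 1 - \<i> * frechet_derivative f (at w) \<i>) / 2"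

definition dzbar :: "(complex \<Rightarrow> complex) \<Rightarrow> complex \<Rightarrow> complex" where
  "dzbar f w = (frechet_derivative f (at w) 1 + \<i> * frechet_derivative f (at w) \<i>) / 2"

definition mdz :: "(complex \<Rightarrow> complex^2^2) \<Rightarrow> complex \<Rightarrow> complex^2^2" where
  "mdz F w = (\<chi> i j. dz (\<lambda>\<zeta>. F \<zeta> $ i $ j) w)"

definition mdzbar :: "(complex \<Rightarrow> complex^2^2) \<Rightarrow> complex \<Rightarrow> complex^2^2" where
  "mdzbar F w = (\<chi> i j. dzbar (\<lambda>\<zeta>. F \<zeta> $ i $ j) w)"

definition rho :: "(complex \<Rightarrow> real^2^2) \<Rightarrow> complex \<Rightarrow> real" where
  "rho h w = sqrt (det (h w))"

text \<open>Real-valued functions are complexified before Wirtinger derivatives are taken.\<close>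

definition crho :: "(complex \<Rightarrow> real^2^2) \<Rightarrow> complex \<Rightarrow> complex" where
  "crho h w = complex_of_real (rho h w)"

definition Kmat :: "(complex \<Rightarrow> real^2^2) \<Rightarrow> complex \<Rightarrow> complex^2^2" where
  "Kmat h w = (\<chi> i j. complex_of_real (h w $ i $ j / rho h w))"

definition clog :: "(complex \<Rightarrow> real) \<Rightarrow> complex \<Rightarrow> complex" where
  "clog \<Omega> w = complex_of_real (ln (\<Omega> w))"

definition Jz :: "(complex \<Rightarrow> real^2^2) \<Rightarrow> complex \<Rightarrow> complex^2^2" where
  "Jz h w = matrix_inv (Kmat h w) ** mdz (Kmat h) w"

definition Jzbar :: "(complex \<Rightarrow> real^2^2) \<Rightarrow> complex \<Rightarrow> complex^2^2" where
  "Jzbar h w = matrix_inv (Kmat h w) ** mdzbar (Kmat h) w"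

definition rho_equation :: "(complex \<Rightarrow> real^2^2) \<Rightarrow> (complex \<Rightarrow> real) \<Rightarrow> real \<Rightarrow> complex \<Rightarrow> bool" where
  "rho_equation h \<Omega> lam w \<longleftrightarrow>
     dz (dzbar (crho h)) w = complex_of_real (- (1/2) * lam * rho h w * (\<Omega> w)\<^sup>2)"

definition K_equation :: "(complex \<Rightarrow> real^2^2) \<Rightarrow> complex \<Rightarrow> bool" where
  "K_equation h w \<longleftrightarrow>
     mdz (\<lambda>\<zeta>. rho h \<zeta> *\<^sub>R Jzbar h \<zeta>) w + mdzbar (\<lambda>\<zeta>. rho h \<zeta> *\<^sub>R Jz h \<zeta>) w = 0"

definition Omega_equation :: "(complex \<Rightarrow> real^2^2) \<Rightarrow> (complex \<Rightarrow> real) \<Rightarrow> complex \<Rightarrow> bool" where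
  "Omega_equation h \<Omega> w \<longleftrightarrow>
     dz (dzbar (clog \<Omega>)) w =
       1/4 * (dz (crho h) w * dzbar (crho h) w / (crho h w)\<^sup>2) - 1/8 * trace (Jz h w ** Jzbar h w)"

definition remaining_lhs :: "(complex \<Rightarrow> real^2^2) \<Rightarrow> (complex \<Rightarrow> real) \<Rightarrow> complex \<Rightarrow> complex" where
  "remaining_lhs h \<Omega> w =
     8 * (dz (clog \<Omega>) w * dz (crho h) w / crho h w)
     - 4 * (dz (dz (crho h)) w / crho h w)
     + 2 * (dz (crho h) w * dz (crho h) w / (crho h w)\<^sup>2)
     - trace (Jz h w ** Jz h w)"

text \<open>The terms of \<open>remaining_lhs\<close> are singular on the boundary of the orbit space, where \<open>\<rho> = 0\<close>;
  that the equation holds there means that its left-hand side tends to zero. Since the orbit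
  projection is continuous and open, the limit may be taken along principal points of the manifold
  that approach a non-principal point.\<close>

definition remaining_at_boundary ::
  "'m::topological_space action \<Rightarrow> ('m \<Rightarrow> complex) \<Rightarrow> (complex \<Rightarrow> real^2^2) \<Rightarrow> (complex \<Rightarrow> real) \<Rightarrow> bool" where
  "remaining_at_boundary act z h \<Omega> \<longleftrightarrow>
     (\<forall>p. p \<notin> principal_points act \<longrightarrow>
        ((\<lambda>q. remaining_lhs h \<Omega> (z q)) \<longlongrightarrow> 0) (at p within principal_points act))"

end

theory Submission
  imports Defs "HOL-Complex_Analysis.Conformal_Mappings"
begin

text \<open>
  Write \<open>E\<close> for the left-hand side of the remaining equation. The three equations imply
  \<open>dzbar (\<rho> E) = 0\<close>, so \<open>\<rho> E\<close> is holomorphic on the interior of the orbit space. Pulled back to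
  the manifold and extended by \<open>0\<close> over the non-principal points it is continuous, so its modulus has
  a maximum; if that were positive, the set where it is attained would have an image in the plane that
  is compact, nonempty, and open by the maximum principle. Hence \<open>E = 0\<close>.

  Near a principal point, moving a section of the orbit projection by the torus gives coordinates in
  which the metric is \<open>\<Omega>\<^sup>2(dx\<^sup>2 + dy\<^sup>2) + h\<close>, and the four equations are the Einstein equation of this
  metric. The principal points are dense, and both sides of the Einstein equation are continuous.
\<close>

section \<open>Calculus of smooth maps\<close>

text \<open>The factor \<rho> is an integrating factor: the three equations amount to
  \<open>dzbar E = - (dzbar \<rho> / \<rho>) E\<close>, so \<open>E\<close> alone is not
  holomorphic. The maximum principle cannot simply be combined with boundary values in the plane,
  because \<open>z\<close> is given on principal points only: nothing ties the frontier of its image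
  to the boundary of the orbit space, and no boundedness of the image is given. Compactness is
  therefore used on the manifold, where the boundary hypothesis is also stated. A second obstacle is
  that Ricci curvature is defined by components in the charts of the given atlas, while the reduced
  equations speak of adapted coordinates. The Ricci tensor must be shown to be natural under smooth
  maps that pull one nondegenerate metric back to another. Christoffel symbols are identified
  through uniqueness of the torsion-free compatible connection, both for the change of coordinates
  and for the block metric, so inverse metrics are never computed. Smoothness of \<open>h\<close> as
  a function on the plane is derived as well, from local sections of the orbit projection.\<close>

definition dder :: "'a::real_normed_vector \<Rightarrow> ('a \<Rightarrow> 'b::real_normed_vector) \<Rightarrow> 'a \<Rightarrow> 'b" where
  "dder v f x = frechet_derivative f (at x) v"

lemma dder_eq: "(f has_derivative f') (at x) \<Longrightarrow> dder v f x = f' v"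
  unfolding dder_def using frechet_derivative_at by metis

lemma has_derivative_dder:
  "f differentiable (at x) \<Longrightarrow> (f has_derivative (\<lambda>v. dder v f x)) (at x)"
  unfolding dder_def by (simp add: frechet_derivative_works)

lemma dder_cong_open:
  assumes "open S" "x \<in> S" "\<And>y. y \<in> S \<Longrightarrow> f y = g y"
  shows "dder v f x = dder v g x"
proof (cases "f differentiable (at x)")
  case True
  then have "(f has_derivative (\<lambda>v. dder v f x)) (at x)"
    by (rule has_derivative_dder)
  then have "(g has_derivative (\<lambda>v. dder v f x)) (at x)"
    by (rule has_derivative_transform_within_open[OF _ assms(1,2)]) (use assms in auto)
  then show ?thesis by (simp add: dder_eq)
next
  \<comment> \<open>Without a derivative, \<open>frechet_derivative\<close> is an arbitrary choice
    among the witnesses of \<open>has_derivative\<close>. The two predicates coincide, so the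
    choices do too.\<close>
  case False
  have "(f has_derivative D) (at x) = (g has_derivative D) (at x)" for D
    using assms by (auto intro: has_derivative_transform_within_open[OF _ assms(1,2)])
  then show ?thesis unfolding dder_def frechet_derivative_def by simp
qed

lemma differentiable_cong_open:
  assumes "open S" "x \<in> S" "\<And>y. y \<in> S \<Longrightarrow> f y = g y" "f differentiable (at x)"
  shows "g differentiable (at x)"
  using assms unfolding differentiable_def
  by (meson has_derivative_transform_within_open)

section \<open>Closure properties of C^k and smooth maps\<close>

lemma Ck_on_subset: "Ck_on k S f \<Longrightarrow> T \<subseteq> S \<Longrightarrow> Ck_on k T f"
  by (induction k arbitrary: f) (auto intro: continuous_on_subset)

lemma Ck_on_Suc_dder:
  "Ck_on (Suc k) S f \<longleftrightarrow> (\<forall>x\<in>S. f differentiable (at x)) \<and> (\<forall>v. Ck_on k S (dder v f))"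
  by (simp add: dder_def[abs_def])

declare Ck_on.simps(2)[simp del]

lemma Ck_on_SucD: "Ck_on (Suc k) S f \<Longrightarrow> Ck_on k S f"
proof (induction k arbitrary: f)
  case 0
  then show ?case
    by (auto simp: Ck_on_Suc_dder intro!: continuous_at_imp_continuous_on differentiable_imp_continuous_within)
next
  case (Suc k)
  from Suc.prems have "\<forall>x\<in>S. f differentiable (at x)" "\<forall>v. Ck_on (Suc k) S (dder v f)"
    by (auto simp: Ck_on_Suc_dder[of "Suc k"])
  with Suc.IH show ?case by (simp add: Ck_on_Suc_dder[of k S f])
qed

lemma Ck_on_cong:
  assumes "open S" "\<And>x. x \<in> S \<Longrightarrow> f x = g x" "Ck_on k S f"
  shows "Ck_on k S g"
  using assms(2,3)
proof (induction k arbitrary: f g)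
  case 0
  then show ?case by (auto intro: continuous_on_eq)
next
  case (Suc k)
  have "dder v f x = dder v g x" if "x \<in> S" for v x
    using dder_cong_open[OF assms(1) that] Suc.prems by blast
  then have "Ck_on k S (dder v g)" for v
    using Suc.IH[of "dder v f" "dder v g"] Suc.prems by (auto simp: Ck_on_Suc_dder)
  moreover have "g differentiable (at x)" if "x \<in> S" for x
    using differentiable_cong_open[OF assms(1) that] Suc.prems that by (auto simp: Ck_on_Suc_dder)
  ultimately show ?case by (simp add: Ck_on_Suc_dder)
qed

lemma Ck_on_const: "Ck_on k S (\<lambda>x. c)"
  by (induction k arbitrary: c) (auto simp: Ck_on_Suc_dder dder_def[abs_def])

lemma Ck_on_bounded_linear:
  assumes "bounded_linear f"
  shows "Ck_on k S f"
proof (cases k)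
  case 0
  then show ?thesis using assms by (simp add: linear_continuous_on)
next
  case (Suc n)
  have "dder v f = (\<lambda>x. f v)" for v
    using dder_eq[OF bounded_linear_imp_has_derivative[OF assms]] by auto
  then show ?thesis
    using Suc assms bounded_linear_imp_differentiable by (auto simp: Ck_on_Suc_dder Ck_on_const)
qed

lemma Ck_on_differentiable: "Ck_on (Suc k) S f \<Longrightarrow> x \<in> S \<Longrightarrow> f differentiable (at x)"
  by (simp add: Ck_on_Suc_dder)

lemma Ck_on_linear_compose:
  assumes "bounded_linear l" "open S" "Ck_on k S f"
  shows "Ck_on k S (\<lambda>x. l (f x))"
  using assms(3)
proof (induction k arbitrary: f)
  case 0
  then show ?case by (auto intro: bounded_linear.continuous_on[OF assms(1)])
next
  case (Suc k)
  have der: "((\<lambda>x. l (f x)) has_derivative (\<lambda>v. l (dder v f x))) (at x)" if "x \<in> S" for x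
    using Suc.prems that
    by (auto simp: Ck_on_Suc_dder intro!: bounded_linear.has_derivative[OF assms(1)] has_derivative_dder)
  have "Ck_on k S (dder v (\<lambda>x. l (f x)))" for v
    by (rule Ck_on_cong[OF assms(2) _ Suc.IH[of "dder v f"]])
      (use Suc.prems in \<open>auto simp: Ck_on_Suc_dder dder_eq[OF der]\<close>)
  with der show ?case by (auto simp: Ck_on_Suc_dder differentiable_def)
qed

lemma Ck_on_add:
  assumes "open S" "Ck_on k S f" "Ck_on k S g"
  shows "Ck_on k S (\<lambda>x. f x + g x)"
  using assms(2,3)
proof (induction k arbitrary: f g)
  case 0
  then show ?case by (auto intro: continuous_intros)
next
  case (Suc k)
  have der: "((\<lambda>x. f x + g x) has_derivative (\<lambda>v. dder v f x + dder v g x)) (at x)" if "x \<in> S" for x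
    using Suc.prems that by (auto simp: Ck_on_Suc_dder intro!: has_derivative_add has_derivative_dder)
  have "Ck_on k S (dder v (\<lambda>x. f x + g x))" for v
    by (rule Ck_on_cong[OF assms(1) _ Suc.IH[of "dder v f" "dder v g"]])
      (use Suc.prems in \<open>auto simp: Ck_on_Suc_dder dder_eq[OF der]\<close>)
  with der show ?case by (auto simp: Ck_on_Suc_dder differentiable_def)
qed

lemma Ck_on_bilinear:
  assumes "bounded_bilinear B" "open S" "Ck_on k S f" "Ck_on k S g"
  shows "Ck_on k S (\<lambda>x. B (f x) (g x))"
  using assms(3,4)
proof (induction k arbitrary: f g)
  case 0
  then show ?case by (auto intro: bounded_bilinear.continuous_on[OF assms(1)])
next
  case (Suc k)
  have der: "((\<lambda>x. B (f x) (g x)) has_derivative (\<lambda>v. B (f x) (dder v g x) + B (dder v f x) (g x))) (at x)"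
    if "x \<in> S" for x
    using Suc.prems that
    by (auto simp: Ck_on_Suc_dder intro!: bounded_bilinear.FDERIV[OF assms(1)] has_derivative_dder)
  have "Ck_on k S f" "Ck_on k S g" using Suc.prems Ck_on_SucD by blast+
  then have "Ck_on k S (dder v (\<lambda>x. B (f x) (g x)))" for v
    by (intro Ck_on_cong[OF assms(2) _ Ck_on_add[OF assms(2) Suc.IH[of f "dder v g"] Suc.IH[of "dder v f" g]]])
      (use Suc.prems in \<open>auto simp: Ck_on_Suc_dder dder_eq[OF der]\<close>)
  with der show ?case by (auto simp: Ck_on_Suc_dder differentiable_def)
qed

lemma Ck_on_sum:
  assumes "open S" "\<And>i. i \<in> I \<Longrightarrow> Ck_on k S (f i)"
  shows "Ck_on k S (\<lambda>x. \<Sum>i\<in>I. f i x)"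
  using assms(2) by (induction I rule: infinite_finite_induct) (auto simp: Ck_on_const Ck_on_add[OF assms(1)])

lemma dder_compose:
  assumes "g differentiable (at x)" "f differentiable (at (g x))"
  shows "dder v (\<lambda>x. f (g x)) x = dder (dder v g x) f (g x)"
proof -
  have "((\<lambda>x. f (g x)) has_derivative (\<lambda>v. dder (dder v g x) f (g x))) (at x)"
    using has_derivative_compose[OF has_derivative_dder[OF assms(1)] has_derivative_dder[OF assms(2)]] .
  then show ?thesis by (simp add: dder_eq)
qed

lemma linear_dder: "f differentiable (at x) \<Longrightarrow> linear (\<lambda>v. dder v f x)"
  unfolding dder_def using linear_frechet_derivative by (metis eta_contract_eq)

lemma dder_euclidean_expand:
  fixes f :: "'a::euclidean_space \<Rightarrow> 'b::real_normed_vector"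
  assumes "f differentiable (at x)"
  shows "dder v f x = (\<Sum>b\<in>Basis. (v \<bullet> b) *\<^sub>R dder b f x)"
proof -
  interpret linear "\<lambda>v. dder v f x" by (rule linear_dder[OF assms])
  show ?thesis
    by (subst euclidean_representation[of v, symmetric]) (simp only: sum scaleR)
qed

text \<open>The direction \<open>dder v g x\<close> of the outer derivative moves with x, so the
  derivative of the composite is not some \<open>dder w f\<close> with w fixed. Expanding that
  direction in the basis of the middle space gives a finite sum of fixed directional derivatives, to
  which the induction hypothesis applies; this is why the middle space is Euclidean.\<close>

lemma Ck_on_compose:
  fixes g :: "'a::real_normed_vector \<Rightarrow> 'b::euclidean_space"
  assumes "open S" "g ` S \<subseteq> T" "Ck_on k T f" "Ck_on k S g"
  shows "Ck_on k S (\<lambda>x. f (g x))"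
  using assms(3,4)
proof (induction k arbitrary: f)
  case 0
  then show ?case using assms(2) by (auto intro: continuous_on_compose2)
next
  case (Suc k)
  have dg: "g differentiable (at x)" "f differentiable (at (g x))" if "x \<in> S" for x
    using Suc.prems assms(2) that by (auto simp: Ck_on_Suc_dder)
  have der: "((\<lambda>x. f (g x)) has_derivative (\<lambda>v. dder (dder v g x) f (g x))) (at x)" if "x \<in> S" for x
    using has_derivative_compose[OF has_derivative_dder[OF dg(1)[OF that]] has_derivative_dder[OF dg(2)[OF that]]] .
  have Ckg: "Ck_on k S g" using Suc.prems Ck_on_SucD by blast
  have "Ck_on k S (\<lambda>x. \<Sum>b\<in>Basis. (dder v g x \<bullet> b) *\<^sub>R dder b f (g x))" for v
    using Suc.prems Ckg
    by (intro Ck_on_sum Ck_on_bilinear[OF bounded_bilinear_scaleR] assms Suc.IH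
         Ck_on_linear_compose[OF bounded_linear_inner_left])
       (auto simp: Ck_on_Suc_dder)
  then have "Ck_on k S (dder v (\<lambda>x. f (g x)))" for v
    by (rule Ck_on_cong[OF assms(1), rotated])
      (use dg in \<open>auto simp: dder_compose dder_euclidean_expand[symmetric]\<close>)
  with der show ?case by (auto simp: Ck_on_Suc_dder differentiable_def)
qed

lemma smooth_on_subset: "smooth_on S f \<Longrightarrow> T \<subseteq> S \<Longrightarrow> smooth_on T f"
  by (auto simp: smooth_on_def intro: Ck_on_subset)

lemma smooth_on_cong: "open S \<Longrightarrow> (\<And>x. x \<in> S \<Longrightarrow> f x = g x) \<Longrightarrow> smooth_on S f \<Longrightarrow> smooth_on S g"
  by (auto simp: smooth_on_def intro: Ck_on_cong)

lemma smooth_on_const: "smooth_on S (\<lambda>x. c)"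
  by (simp add: smooth_on_def Ck_on_const)

lemma smooth_on_bounded_linear: "bounded_linear f \<Longrightarrow> smooth_on S f"
  by (simp add: smooth_on_def Ck_on_bounded_linear)

lemma smooth_on_id: "smooth_on S (\<lambda>x. x)"
  by (rule smooth_on_bounded_linear) (rule bounded_linear_ident)

lemma smooth_on_linear_compose:
  "bounded_linear l \<Longrightarrow> open S \<Longrightarrow> smooth_on S f \<Longrightarrow> smooth_on S (\<lambda>x. l (f x))"
  by (simp add: smooth_on_def Ck_on_linear_compose)

lemma smooth_on_add: "open S \<Longrightarrow> smooth_on S f \<Longrightarrow> smooth_on S g \<Longrightarrow> smooth_on S (\<lambda>x. f x + g x)"
  by (simp add: smooth_on_def Ck_on_add)

lemma smooth_on_uminus: "open S \<Longrightarrow> smooth_on S f \<Longrightarrow> smooth_on S (\<lambda>x. - f x)"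
  using smooth_on_linear_compose[OF bounded_linear_minus[OF bounded_linear_ident]] .

lemma smooth_on_diff: "open S \<Longrightarrow> smooth_on S f \<Longrightarrow> smooth_on S g \<Longrightarrow> smooth_on S (\<lambda>x. f x - g x)"
  using smooth_on_add[of S f "\<lambda>x. - g x"] smooth_on_uminus[of S g] by simp

lemma smooth_on_bilinear:
  "bounded_bilinear B \<Longrightarrow> open S \<Longrightarrow> smooth_on S f \<Longrightarrow> smooth_on S g \<Longrightarrow> smooth_on S (\<lambda>x. B (f x) (g x))"
  by (simp add: smooth_on_def Ck_on_bilinear)

lemma smooth_on_mult:
  fixes f g :: "'a::real_normed_vector \<Rightarrow> 'b::real_normed_algebra"
  shows "open S \<Longrightarrow> smooth_on S f \<Longrightarrow> smooth_on S g \<Longrightarrow> smooth_on S (\<lambda>x. f x * g x)"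
  by (rule smooth_on_bilinear[OF bounded_bilinear_mult])

lemma smooth_on_power:
  fixes f :: "'a::real_normed_vector \<Rightarrow> 'b::real_normed_algebra_1"
  shows "open S \<Longrightarrow> smooth_on S f \<Longrightarrow> smooth_on S (\<lambda>x. f x ^ n)"
  by (induction n) (auto simp: smooth_on_const smooth_on_mult)

lemma smooth_on_sum:
  "open S \<Longrightarrow> (\<And>i. i \<in> I \<Longrightarrow> smooth_on S (f i)) \<Longrightarrow> smooth_on S (\<lambda>x. \<Sum>i\<in>I. f i x)"
  by (simp add: smooth_on_def Ck_on_sum)

lemma smooth_on_prod:
  fixes f :: "'i \<Rightarrow> 'a::real_normed_vector \<Rightarrow> real"
  assumes "open S" "\<And>i. i \<in> I \<Longrightarrow> smooth_on S (f i)" 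
  shows "smooth_on S (\<lambda>x. \<Prod>i\<in>I. f i x)"
  using assms(2) by (induction I rule: infinite_finite_induct)
    (auto simp: smooth_on_const smooth_on_mult[OF assms(1)])

lemma smooth_on_compose:
  fixes g :: "'a::real_normed_vector \<Rightarrow> 'b::euclidean_space"
  shows "open S \<Longrightarrow> g ` S \<subseteq> T \<Longrightarrow> smooth_on T f \<Longrightarrow> smooth_on S g \<Longrightarrow> smooth_on S (\<lambda>x. f (g x))"
  unfolding smooth_on_def using Ck_on_compose by blast

lemma smooth_on_dder: "smooth_on S f \<Longrightarrow> smooth_on S (dder v f)"
  unfolding smooth_on_def using Ck_on_Suc_dder by blast

lemma smooth_on_differentiable: "smooth_on S f \<Longrightarrow> x \<in> S \<Longrightarrow> f differentiable (at x)"
  unfolding smooth_on_def using Ck_on_differentiable by blast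

lemma smooth_on_continuous_on: "smooth_on S f \<Longrightarrow> continuous_on S f"
  unfolding smooth_on_def using Ck_on.simps(1) by blast

lemma smooth_on_Suc_iff:
  "smooth_on S f \<longleftrightarrow> (\<forall>x\<in>S. f differentiable (at x)) \<and> (\<forall>v. smooth_on S (dder v f))"
  unfolding smooth_on_def using Ck_on_SucD Ck_on_Suc_dder by metis

lemma smooth_on_vec_lambda:
  fixes f :: "'i::finite \<Rightarrow> 'a::real_normed_vector \<Rightarrow> 'b::euclidean_space"
  assumes "open S" "\<And>i. smooth_on S (f i)"
  shows "smooth_on S (\<lambda>x. \<chi> i. f i x)"
proof -
  have "smooth_on S (\<lambda>x. \<Sum>i\<in>UNIV. (axis i (f i x)))"
  proof (intro smooth_on_sum assms smooth_on_linear_compose[where l="axis i" for i])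
    show "bounded_linear (axis i :: 'b \<Rightarrow> 'b^'i)" for i
      by (rule linear_conv_bounded_linear[THEN iffD1], unfold_locales)
         (auto simp: axis_def vec_eq_iff)
  qed
  moreover have "(\<Sum>i\<in>UNIV. (axis i (f i x))) = (\<chi> i. f i x)" for x
    by (auto simp: axis_def vec_eq_iff if_distrib sum.delta cong: if_cong)
  ultimately show ?thesis by simp
qed

lemma smooth_on_vec_nth:
  "open S \<Longrightarrow> smooth_on S f \<Longrightarrow> smooth_on S (\<lambda>x. f x $ i)"
  by (rule smooth_on_linear_compose[OF bounded_linear_vec_nth])

lemma smooth_on_Pair:
  assumes "open S" "smooth_on S f" "smooth_on S g"
  shows "smooth_on S (\<lambda>x. (f x, g x))"
proof -
  have "smooth_on S (\<lambda>x. (f x, 0) + (0, g x))"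
    by (intro smooth_on_add assms smooth_on_linear_compose[of "\<lambda>a. (a, 0)"]
        smooth_on_linear_compose[of "\<lambda>a. (0, a)"]
        bounded_linear_Pair bounded_linear_ident bounded_linear_zero)
  then show ?thesis by simp
qed

text \<open>The derivative contains the inverse itself, so the induction is on the order: C^k of the
  inverse makes its derivative C^k, which is order k + 1.\<close>

lemma smooth_on_inverse:
  assumes "open S" "smooth_on S f" "\<And>x. x \<in> S \<Longrightarrow> f x \<noteq> (0::'b::real_normed_field)"
  shows "smooth_on S (\<lambda>x. inverse (f x))"
  unfolding smooth_on_def
proof
  fix k
  show "Ck_on k S (\<lambda>x. inverse (f x))"
  proof (induction k)
    case 0
    then show ?case using assms smooth_on_continuous_on[OF assms(2)] by (auto intro!: continuous_intros)
  next
    case (Suc k)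
    have der: "((\<lambda>x. inverse (f x)) has_derivative (\<lambda>v. - (inverse (f x) * dder v f x * inverse (f x)))) (at x)"
      if "x \<in> S" for x
      using Deriv.has_derivative_inverse[OF assms(3)[OF that] has_derivative_dder[OF smooth_on_differentiable[OF assms(2) that]]] .
    have "Ck_on k S (\<lambda>x. - (inverse (f x) * dder v f x * inverse (f x)))" for v
      using smooth_on_dder[OF assms(2)] 
      by (intro Ck_on_linear_compose[OF bounded_linear_minus[OF bounded_linear_ident]]
          Ck_on_bilinear[OF bounded_bilinear_mult] assms(1) Suc) (simp_all add: smooth_on_def)
    then have "Ck_on k S (dder v (\<lambda>x. inverse (f x)))" for v
      by (rule Ck_on_cong[OF assms(1), rotated]) (auto simp: dder_eq[OF der])
    with der show ?case by (auto simp: Ck_on_Suc_dder differentiable_def)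
  qed
qed

lemma smooth_on_divide:
  fixes f g :: "'a::real_normed_vector \<Rightarrow> 'b::real_normed_field"
  assumes "open S" "smooth_on S f" "smooth_on S g" "\<And>x. x \<in> S \<Longrightarrow> g x \<noteq> 0"
  shows "smooth_on S (\<lambda>x. f x / g x)"
  unfolding divide_inverse using assms by (intro smooth_on_mult smooth_on_inverse)

lemma smooth_on_ln:
  fixes f :: "'a::real_normed_vector \<Rightarrow> real"
  assumes "open S" "smooth_on S f" "\<And>x. x \<in> S \<Longrightarrow> f x > 0"
  shows "smooth_on S (\<lambda>x. ln (f x))"
proof -
  have der: "((\<lambda>x. ln (f x)) has_derivative (\<lambda>v. dder v f x / f x)) (at x)" if "x \<in> S" for x
    using has_derivative_ln[OF assms(3)[OF that] has_derivative_dder[OF smooth_on_differentiable[OF assms(2) that]]]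
    by (simp add: divide_inverse)
  have "smooth_on S (\<lambda>x. dder v f x / f x)" for v
    using assms(3) by (intro smooth_on_divide smooth_on_dder assms(1,2)) force
  then have "smooth_on S (dder v (\<lambda>x. ln (f x)))" for v
    by (rule smooth_on_cong[OF assms(1), rotated]) (auto simp: dder_eq[OF der])
  then show ?thesis using der by (subst smooth_on_Suc_iff) (auto simp: differentiable_def)
qed

lemma smooth_on_sqrt:
  fixes f :: "'a::real_normed_vector \<Rightarrow> real"
  assumes "open S" "smooth_on S f" "\<And>x. x \<in> S \<Longrightarrow> f x > 0"
  shows "smooth_on S (\<lambda>x. sqrt (f x))"
  unfolding smooth_on_def
proof
  fix k
  show "Ck_on k S (\<lambda>x. sqrt (f x))"
  proof (induction k)
    case 0
    then show ?case using assms smooth_on_continuous_on[OF assms(2)] by (auto intro!: continuous_intros)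
  next
    case (Suc k)
    \<comment> \<open>The factor 1 / (2 sqrt f) is written as sqrt f / (2 f), so that the induction
      hypothesis about the square root itself applies.\<close>
    have der: "((\<lambda>x. sqrt (f x)) has_derivative (\<lambda>v. inverse (f x) * (1/2 * sqrt (f x)) * dder v f x)) (at x)"
      if "x \<in> S" for x
      using assms(3)[OF that]
      by (auto intro!: derivative_eq_intros has_derivative_dder smooth_on_differentiable[OF assms(2) that]
          simp: field_simps real_sqrt_mult_self)
    have "Ck_on k S (\<lambda>x. inverse (f x))" 
      using smooth_on_inverse[OF assms(1,2)] assms(3) by (force simp: smooth_on_def)
    then have "Ck_on k S (\<lambda>x. inverse (f x) * (1/2 * sqrt (f x)) * dder v f x)" for v
      using smooth_on_dder[OF assms(2)] 
      by (intro Ck_on_bilinear[OF bounded_bilinear_mult] assms(1) Suc Ck_on_const) (simp_all add: smooth_on_def)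
    then have "Ck_on k S (dder v (\<lambda>x. sqrt (f x)))" for v
      by (rule Ck_on_cong[OF assms(1), rotated]) (auto simp: dder_eq[OF der])
    with der show ?case by (auto simp: Ck_on_Suc_dder differentiable_def)
  qed
qed

text \<open>The difference in direction w is a function of the parameter along v. The mean value
  theorem applied to it gives a difference of \<open>dder v f\<close>, and a second application,
  along w, gives the mixed derivative.\<close>

lemma second_difference_mean_value:
  fixes f :: "'a::real_normed_vector \<Rightarrow> real"
  assumes "Ck_on 2 (ball x r) f" "t > 0" "t * (norm v + norm w) < r"
  shows "\<exists>p\<in>ball x r. f (x + t *\<^sub>R v + t *\<^sub>R w) - f (x + t *\<^sub>R v) - f (x + t *\<^sub>R w) + f x
           = t\<^sup>2 * dder w (dder v f) p"
proof -
  have df: "f differentiable (at y)" "dder v f differentiable (at y)" if "y \<in> ball x r" for y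
    using assms(1) that by (auto simp: numeral_2_eq_2 Ck_on_Suc_dder)
  have inb: "x + a *\<^sub>R v + b *\<^sub>R w \<in> ball x r" if "0 \<le> a" "a \<le> t" "0 \<le> b" "b \<le> t" for a b
  proof -
    have "norm (a *\<^sub>R v + b *\<^sub>R w) \<le> a * norm v + b * norm w"
      using norm_triangle_ineq[of "a *\<^sub>R v" "b *\<^sub>R w"] that by simp
    also have "\<dots> \<le> t * norm v + t * norm w"
      using that by (intro add_mono mult_right_mono) auto
    also have "\<dots> < r" using assms(3) by (simp add: algebra_simps)
    finally have "dist x (x + (a *\<^sub>R v + b *\<^sub>R w)) < r"
      by (metis add_diff_cancel_left' dist_commute dist_norm)
    then show ?thesis by (simp add: add.assoc)
  qed
  define \<phi> where "\<phi> s = f (x + s *\<^sub>R v + t *\<^sub>R w) - f (x + s *\<^sub>R v)" for s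
  have line: "((\<lambda>s. F (y + s *\<^sub>R u)) has_real_derivative dder u F (y + s *\<^sub>R u)) (at s)"
    if "F differentiable (at (y + s *\<^sub>R u))" for F :: "'a \<Rightarrow> real" and y u s
  proof -
    have "((\<lambda>s. F (y + s *\<^sub>R u)) has_derivative (\<lambda>h. dder (h *\<^sub>R u) F (y + s *\<^sub>R u))) (at s)"
      by (rule has_derivative_compose[of "\<lambda>s. y + s *\<^sub>R u" "\<lambda>h. h *\<^sub>R u", OF _ has_derivative_dder[OF that]])
        (auto intro!: derivative_eq_intros)
    moreover have "dder (h *\<^sub>R u) F (y + s *\<^sub>R u) = dder u F (y + s *\<^sub>R u) * h" for h
      using linear_cmul[OF linear_dder[OF that], of h u] by simp
    ultimately show ?thesis by (simp add: has_field_derivative_def)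
  qed
  have d\<phi>: "(\<phi> has_real_derivative dder v f (x + s *\<^sub>R v + t *\<^sub>R w) - dder v f (x + s *\<^sub>R v)) (at s)"
    if "0 \<le> s" "s \<le> t" for s
  proof -
    have e: "x + s *\<^sub>R v + t *\<^sub>R w = (x + t *\<^sub>R w) + s *\<^sub>R v" for s by simp
    show ?thesis
      unfolding \<phi>_def e using inb[of s t] inb[of s 0] that assms(2)
      by (intro DERIV_diff line df) (simp_all add: add_ac)
  qed
  obtain \<xi> where \<xi>: "0 < \<xi>" "\<xi> < t"
    "\<phi> t - \<phi> 0 = t * (dder v f (x + \<xi> *\<^sub>R v + t *\<^sub>R w) - dder v f (x + \<xi> *\<^sub>R v))"
    using MVT2[OF assms(2) d\<phi>] by auto
  obtain \<eta> where \<eta>: "0 < \<eta>" "\<eta> < t"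
    "dder v f (x + \<xi> *\<^sub>R v + t *\<^sub>R w) - dder v f (x + \<xi> *\<^sub>R v + 0 *\<^sub>R w)
       = (t - 0) * dder w (dder v f) (x + \<xi> *\<^sub>R v + \<eta> *\<^sub>R w)"
    using MVT2[OF assms(2), of "\<lambda>b. dder v f (x + \<xi> *\<^sub>R v + b *\<^sub>R w)"
       "\<lambda>b. dder w (dder v f) (x + \<xi> *\<^sub>R v + b *\<^sub>R w)"]
      line[OF df(2)] inb \<xi> by (metis less_le_not_le nle_le)
  show ?thesis
  proof (intro bexI)
    show "x + \<xi> *\<^sub>R v + \<eta> *\<^sub>R w \<in> ball x r" using inb \<xi> \<eta> by simp
    show "f (x + t *\<^sub>R v + t *\<^sub>R w) - f (x + t *\<^sub>R v) - f (x + t *\<^sub>R w) + f x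
           = t\<^sup>2 * dder w (dder v f) (x + \<xi> *\<^sub>R v + \<eta> *\<^sub>R w)"
      using \<xi>(3) \<eta>(3) by (simp add: \<phi>_def power2_eq_square)
  qed
qed

text \<open>The second difference is symmetric in v and w, so the two mixed derivatives take a
  common value at two points arbitrarily close to x. Continuity then excludes a gap at x.\<close>

lemma dder_commute_real:
  fixes f :: "'a::real_normed_vector \<Rightarrow> real"
  assumes "open S" "Ck_on 2 S f" "x \<in> S"
  shows "dder w (dder v f) x = dder v (dder w f) x"
proof (rule ccontr)
  let ?a = "dder w (dder v f)" and ?b = "dder v (dder w f)"
  assume ne: "?a x \<noteq> ?b x"
  define e where "e = \<bar>?a x - ?b x\<bar> / 2"
  have e: "e > 0" using ne by (simp add: e_def)
  have "continuous_on S ?a" "continuous_on S ?b"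
    using assms(2) by (auto simp: numeral_2_eq_2 Ck_on_Suc_dder)
  then have "continuous (at x) ?a" "continuous (at x) ?b"
    using assms continuous_on_eq_continuous_at by blast+
  then obtain d1 d2 where d: "d1 > 0" "\<And>y. dist y x < d1 \<Longrightarrow> dist (?a y) (?a x) < e"
      "d2 > 0" "\<And>y. dist y x < d2 \<Longrightarrow> dist (?b y) (?b x) < e"
    using e unfolding continuous_at_eps_delta by metis
  obtain r0 where r0: "r0 > 0" "ball x r0 \<subseteq> S" using assms by (meson open_contains_ball)
  define r where "r = min r0 (min d1 d2)"
  have r: "r > 0" using r0 d by (simp add: r_def)
  have C: "Ck_on 2 (ball x r) f" by (rule Ck_on_subset[OF assms(2)]) (use r0 r_def in auto)
  \<comment> \<open>The summand 1 keeps the denominator positive and puts the whole parallelogram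
    strictly inside the ball.\<close>
  define t where "t = r / (norm v + norm w + 1)"
  have pos: "norm v + norm w + 1 > 0" by (smt (verit) norm_ge_zero)
  have t: "t > 0" "t * (norm v + norm w) < r"
    using r pos by (auto simp: t_def field_simps)
  obtain p where p: "p \<in> ball x r" "f (x + t *\<^sub>R v + t *\<^sub>R w) - f (x + t *\<^sub>R v) - f (x + t *\<^sub>R w) + f x
           = t\<^sup>2 * ?a p" using second_difference_mean_value[OF C t] by auto
  obtain q where q: "q \<in> ball x r" "f (x + t *\<^sub>R w + t *\<^sub>R v) - f (x + t *\<^sub>R w) - f (x + t *\<^sub>R v) + f x
           = t\<^sup>2 * ?b q" using second_difference_mean_value[OF C t(1), of w v] t(2) by (auto simp: add_ac)
  have "x + t *\<^sub>R w + t *\<^sub>R v = x + t *\<^sub>R v + t *\<^sub>R w" by simp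
  then have "t\<^sup>2 * ?a p = t\<^sup>2 * ?b q" using p(2) q(2) by (simp only:)
  then have "?a p = ?b q" using t by simp
  moreover have "\<bar>?a p - ?a x\<bar> < e" "\<bar>?b q - ?b x\<bar> < e"
    using d(2)[of p] d(4)[of q] p(1) q(1) by (auto simp: r_def dist_real_def dist_commute)
  ultimately have "\<bar>?a x - ?b x\<bar> < 2 * e" by linarith
  then show False by (simp add: e_def)
qed

lemma dder_linear_compose:
  assumes "bounded_linear l" "f differentiable (at x)"
  shows "dder v (\<lambda>x. l (f x)) x = l (dder v f x)"
  using bounded_linear.has_derivative[OF assms(1) has_derivative_dder[OF assms(2)]]
  by (simp add: dder_eq)

lemma dder_commute:
  fixes f :: "'a::real_normed_vector \<Rightarrow> 'b::euclidean_space"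
  assumes "open S" "smooth_on S f" "x \<in> S"
  shows "dder w (dder v f) x = dder v (dder w f) x"
proof (rule euclidean_eqI)
  fix b :: 'b
  assume "b \<in> Basis"
  have sm: "smooth_on S (\<lambda>x. f x \<bullet> b)"
    by (rule smooth_on_linear_compose[OF bounded_linear_inner_left assms(1,2)])
  have *: "dder w (dder v (\<lambda>x. f x \<bullet> b)) x = dder w (dder v f) x \<bullet> b" for v w
  proof -
    have "dder w (dder v (\<lambda>x. f x \<bullet> b)) x = dder w (\<lambda>x. dder v f x \<bullet> b) x"
      by (rule dder_cong_open[OF assms(1,3)])
        (rule dder_linear_compose[OF bounded_linear_inner_left smooth_on_differentiable[OF assms(2)]])
    also have "\<dots> = dder w (dder v f) x \<bullet> b"
      by (rule dder_linear_compose[OF bounded_linear_inner_left smooth_on_differentiable[OF smooth_on_dder[OF assms(2)] assms(3)]])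
    finally show ?thesis .
  qed
  have "Ck_on 2 S (\<lambda>x. f x \<bullet> b)" using sm by (simp add: smooth_on_def)
  from dder_commute_real[OF assms(1) this assms(3), of w v]
  show "dder w (dder v f) x \<bullet> b = dder v (dder w f) x \<bullet> b" by (simp add: *)
qed

lemma dder_const [simp]: "dder v (\<lambda>x. c) x = 0"
  by (simp add: dder_def)

lemma dder_add:
  "f differentiable (at x) \<Longrightarrow> g differentiable (at x) \<Longrightarrow> dder v (\<lambda>x. f x + g x) x = dder v f x + dder v g x"
  by (rule dder_eq[OF has_derivative_add[OF has_derivative_dder has_derivative_dder]])

lemma dder_diff:
  "f differentiable (at x) \<Longrightarrow> g differentiable (at x) \<Longrightarrow> dder v (\<lambda>x. f x - g x) x = dder v f x - dder v g x"
  by (rule dder_eq[OF has_derivative_diff[OF has_derivative_dder has_derivative_dder]])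

lemma dder_uminus:
  "f differentiable (at x) \<Longrightarrow> dder v (\<lambda>x. - f x) x = - dder v f x"
  by (rule dder_eq[OF has_derivative_minus[OF has_derivative_dder]])

lemma dder_bilinear:
  "bounded_bilinear B \<Longrightarrow> f differentiable (at x) \<Longrightarrow> g differentiable (at x) \<Longrightarrow>
   dder v (\<lambda>x. B (f x) (g x)) x = B (f x) (dder v g x) + B (dder v f x) (g x)"
  by (rule dder_eq[OF bounded_bilinear.FDERIV[OF _ has_derivative_dder has_derivative_dder]])

lemma dder_mult:
  fixes f g :: "'a::real_normed_vector \<Rightarrow> 'b::real_normed_algebra"
  shows "f differentiable (at x) \<Longrightarrow> g differentiable (at x) \<Longrightarrow>
   dder v (\<lambda>x. f x * g x) x = f x * dder v g x + dder v f x * g x"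
  by (rule dder_bilinear[OF bounded_bilinear_mult])

lemma dder_sum:
  "(\<And>i. i \<in> I \<Longrightarrow> f i differentiable (at x)) \<Longrightarrow> dder v (\<lambda>x. \<Sum>i\<in>I. f i x) x = (\<Sum>i\<in>I. dder v (f i) x)"
  by (rule dder_eq[OF has_derivative_sum[OF has_derivative_dder]])

lemma dder_inverse:
  fixes f :: "'a::real_normed_vector \<Rightarrow> 'b::real_normed_field"
  assumes "f differentiable (at x)" "f x \<noteq> 0"
  shows "dder v (\<lambda>x. inverse (f x)) x = - dder v f x / (f x)\<^sup>2"
  using dder_eq[OF Deriv.has_derivative_inverse[OF assms(2) has_derivative_dder[OF assms(1)]], of v]
  by (simp add: field_simps power2_eq_square)

lemma dder_divide:
  fixes f :: "'a::real_normed_vector \<Rightarrow> 'b::real_normed_field"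
  assumes "f differentiable (at x)" "g differentiable (at x)" "g x \<noteq> 0"
  shows "dder v (\<lambda>x. f x / g x) x = (dder v f x * g x - f x * dder v g x) / (g x)\<^sup>2"
  using dder_eq[OF has_derivative_divide'[OF has_derivative_dder[OF assms(1)] has_derivative_dder[OF assms(2)] assms(3)], of v]
  by (simp add: power2_eq_square)

lemma dder_vec_nth:
  "f differentiable (at x) \<Longrightarrow> dder v (\<lambda>x. f x $ i) x = dder v f x $ i"
  by (rule dder_linear_compose[OF bounded_linear_vec_nth])

lemma smooth_on_det:
  fixes M :: "'a::real_normed_vector \<Rightarrow> real^'n^'n"
  assumes "open S" "\<And>i j. smooth_on S (\<lambda>x. M x $ i $ j)"
  shows "smooth_on S (\<lambda>x. det (M x))"
  unfolding det_def
  by (intro smooth_on_sum smooth_on_mult smooth_on_prod smooth_on_const assms)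

lemma matrix_inv_mult:
  fixes M :: "'a::semiring_1^'n^'m"
  assumes "invertible M"
  shows "M ** matrix_inv M = mat 1" "matrix_inv M ** M = mat 1"
proof -
  have "M ** matrix_inv M = mat 1 \<and> matrix_inv M ** M = mat 1"
    unfolding matrix_inv_def by (rule someI_ex) (use assms invertible_def in blast)
  then show "M ** matrix_inv M = mat 1" "matrix_inv M ** M = mat 1" by auto
qed

text \<open>Cramer's rule turns each entry of the inverse into a quotient of polynomials in the
  entries, which makes the inverse of a smooth matrix function smooth.\<close>

lemma matrix_inv_cramer:
  fixes M :: "real^'n^'n"
  assumes "det M \<noteq> 0"
  shows "matrix_inv M $ k $ l = det (\<chi> i j. if j = k then axis l 1 $ i else M $ i $ j) / det M"
proof -
  have inv: "M ** matrix_inv M = mat 1"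
    using assms by (simp add: invertible_det_nz matrix_inv_mult(1))
  then have "M *v (matrix_inv M *v axis l 1) = axis l 1"
    by (simp add: matrix_vector_mul_assoc)
  then have "matrix_inv M *v axis l 1 = (\<chi> k. det (\<chi> i j. if j = k then axis l 1 $ i else M $ i $ j) / det M)"
    using cramer[OF assms] by blast
  moreover have "(matrix_inv M *v axis l 1) $ k = matrix_inv M $ k $ l"
    by (simp add: matrix_vector_mult_basis column_def)
  ultimately show ?thesis by simp
qed

lemma smooth_on_matrix_inv:
  fixes M :: "'a::real_normed_vector \<Rightarrow> real^'n^'n"
  assumes "open S" "\<And>i j. smooth_on S (\<lambda>x. M x $ i $ j)" "\<And>x. x \<in> S \<Longrightarrow> det (M x) \<noteq> 0"
  shows "smooth_on S (\<lambda>x. matrix_inv (M x) $ k $ l)"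
proof -
  have "smooth_on S (\<lambda>x. if j = k then axis l 1 $ i else M x $ i $ j)" for i j
    by (cases "j = k") (simp_all add: smooth_on_const assms)
  then have "smooth_on S (\<lambda>x. det (\<chi> i j. if j = k then axis l 1 $ i else M x $ i $ j) / det (M x))"
    by (intro smooth_on_divide smooth_on_det assms) auto
  then show ?thesis
    by (rule smooth_on_cong[OF assms(1), rotated]) (simp add: matrix_inv_cramer assms(3))
qed

lemma smooth_on_Re: "open S \<Longrightarrow> smooth_on S f \<Longrightarrow> smooth_on S (\<lambda>x. Re (f x))"
  by (rule smooth_on_linear_compose[OF bounded_linear_Re])

lemma smooth_on_Im: "open S \<Longrightarrow> smooth_on S f \<Longrightarrow> smooth_on S (\<lambda>x. Im (f x))"
  by (rule smooth_on_linear_compose[OF bounded_linear_Im])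

lemma smooth_on_of_real: "open S \<Longrightarrow> smooth_on S f \<Longrightarrow> smooth_on S (\<lambda>x. complex_of_real (f x))"
  by (rule smooth_on_linear_compose[OF bounded_linear_of_real])

section \<open>Smooth local inverses in the plane\<close>

lemma linear_complex_expand:
  fixes A :: "complex \<Rightarrow> 'b::real_vector"
  assumes "linear A"
  shows "A v = Re v *\<^sub>R A 1 + Im v *\<^sub>R A \<i>"
proof -
  have "v = Re v *\<^sub>R 1 + Im v *\<^sub>R \<i>" by (simp add: complex_eq_iff)
  then show ?thesis using assms by (metis linear_add linear_cmul)
qed

text \<open>\<open>d\<close> is the determinant of \<open>A\<close> in the real basis 1, i, and the
  formula is Cramer's rule. An explicit inverse is needed in order to see that the derivative of a
  local inverse depends smoothly on the point.\<close>

lemma bij_linear_complex: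
  fixes A :: "complex \<Rightarrow> complex"
  assumes "linear A" "bij A"
  defines "d \<equiv> Re (A 1) * Im (A \<i>) - Im (A 1) * Re (A \<i>)"
  shows "d \<noteq> 0"
    and "inv A v = Complex ((Im (A \<i>) * Re v - Re (A \<i>) * Im v) / d) ((Re (A 1) * Im v - Im (A 1) * Re v) / d)"
proof -
  note e = linear_complex_expand[OF assms(1)]
  show d: "d \<noteq> 0"
  proof
    assume d: "d = 0"
    \<comment> \<open>These are, up to sign, the columns of the adjugate, so \<open>A\<close> sends
      them to multiples of \<open>d\<close>. Injectivity makes them vanish, which kills
      \<open>A 1\<close>.\<close>
    have "A (Complex (Im (A \<i>)) (- Im (A 1))) = 0" "A (Complex (Re (A \<i>)) (- Re (A 1))) = 0"
      using d by (subst e; simp add: complex_eq_iff d_def algebra_simps)+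
    moreover have "A 0 = 0" using assms(1) linear_0 by blast
    ultimately have "Complex (Im (A \<i>)) (- Im (A 1)) = 0" "Complex (Re (A \<i>)) (- Re (A 1)) = 0"
      using bij_is_inj[OF assms(2)] by (metis injD)+
    then have "A 1 = 0" by (simp add: complex_eq_iff)
    then show False using bij_is_inj[OF assms(2)] \<open>A 0 = 0\<close> by (metis injD zero_neq_one)
  qed
  let ?w = "Complex ((Im (A \<i>) * Re v - Re (A \<i>) * Im v) / d) ((Re (A 1) * Im v - Im (A 1) * Re v) / d)"
  have "d * Re v = (Im (A \<i>) * Re v - Re (A \<i>) * Im v) * Re (A 1) + (Re (A 1) * Im v - Im (A 1) * Re v) * Re (A \<i>)"
    "d * Im v = (Im (A \<i>) * Re v - Re (A \<i>) * Im v) * Im (A 1) + (Re (A 1) * Im v - Im (A 1) * Re v) * Im (A \<i>)"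
    by (simp_all add: d_def algebra_simps)
  then have "Re v = ((Im (A \<i>) * Re v - Re (A \<i>) * Im v) * Re (A 1) + (Re (A 1) * Im v - Im (A 1) * Re v) * Re (A \<i>)) / d"
    "Im v = ((Im (A \<i>) * Re v - Re (A \<i>) * Im v) * Im (A 1) + (Re (A 1) * Im v - Im (A 1) * Re v) * Im (A \<i>)) / d"
    using d by (metis nonzero_mult_div_cancel_left)+
  then have "A ?w = v"
    by (subst e) (simp add: complex_eq_iff add_divide_distrib[symmetric])
  then show "inv A v = ?w" using bij_is_inj[OF assms(2)] by (metis inv_f_f)
qed

text \<open>The inverse function theorem yields a differentiable inverse \<open>g\<close> whose
  derivative at \<open>y\<close> is the inverse of the derivative of \<open>f\<close> at
  \<open>g y\<close>. By Cramer's rule this is \<open>N v (g y)\<close> with \<open>N v\<close>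
  smooth, so C^k of \<open>g\<close> passes to its derivative and the order rises by one.\<close>

lemma smooth_local_inverse:
  fixes f :: "complex \<Rightarrow> complex"
  assumes "open U" "smooth_on U f" "x0 \<in> U" "inj (\<lambda>v. dder v f x0)"
  obtains U' V g where "open U'" "U' \<subseteq> U" "x0 \<in> U'" "open V" "f x0 \<in> V" "homeomorphism U' V f g"
    "smooth_on V g"
proof -
  define f' where "f' x = Blinfun (\<lambda>v. dder v f x)" for x
  have df: "f differentiable (at x)" if "x \<in> U" for x
    using smooth_on_differentiable assms that by blast
  have f': "blinfun_apply (f' x) = (\<lambda>v. dder v f x)" if "x \<in> U" for x
    unfolding f'_def using linear_dder[OF df[OF that]] linear_conv_bounded_linear
    by (intro bounded_linear_Blinfun_apply) blast
  have 1: "(f has_derivative blinfun_apply (f' x)) (at x)" if "x \<in> U" for x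
    using has_derivative_dder[OF df[OF that]] f'[OF that] by simp
  have "continuous_on U (\<lambda>x. dder i f x)" for i
    using smooth_on_continuous_on[OF smooth_on_dder[OF assms(2)]] .
  then have 2: "continuous_on U f'"
    by (intro continuous_on_blinfun_componentwise) (simp add: f' cong: continuous_on_cong)
  obtain ig where ig: "linear ig" "ig \<circ> (\<lambda>v. dder v f x0) = id"
    using linear_injective_left_inverse[OF linear_dder[OF df[OF assms(3)]] assms(4)] by blast
  have 3: "Blinfun ig o\<^sub>L f' x0 = id_blinfun"
    using ig by (intro blinfun_eqI)
      (simp add: f'[OF assms(3)] bounded_linear_Blinfun_apply linear_conv_bounded_linear[symmetric] fun_eq_iff)
  obtain U' V g g' where *: "open U'" "U' \<subseteq> U" "x0 \<in> U'" "open V" "f x0 \<in> V" "homeomorphism U' V f g"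
    and g': "\<And>y. y \<in> V \<Longrightarrow> (g has_derivative (g' y)) (at y)"
      "\<And>y. y \<in> V \<Longrightarrow> g' y = inv (blinfun_apply (f'(g y)))"
      "\<And>y. y \<in> V \<Longrightarrow> bij (blinfun_apply (f'(g y)))"
    using inverse_function_theorem[OF assms(1) 1 2 assms(3) 3] by metis
  have gU: "g y \<in> U" if "y \<in> V" for y
    using *(2,6) that unfolding homeomorphism_def by blast
  define d where "d x = Re (dder 1 f x) * Im (dder \<i> f x) - Im (dder 1 f x) * Re (dder \<i> f x)" for x
  define N where "N v x = Complex ((Im (dder \<i> f x) * Re v - Re (dder \<i> f x) * Im v) / d x)
      ((Re (dder 1 f x) * Im v - Im (dder 1 f x) * Re v) / d x)" for v x
  define T where "T = U \<inter> d -` (- {0})"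
  have smd: "smooth_on U d"
    unfolding d_def using assms(1,2)
    by (intro smooth_on_diff smooth_on_mult smooth_on_Re smooth_on_Im smooth_on_dder)
  have oT: "open T"
    unfolding T_def using smooth_on_continuous_on[OF smd] assms(1)
    by (intro continuous_open_preimage) auto
  have smN: "smooth_on T (N v)" for v
  proof -
    have D: "smooth_on T (dder b f)" "smooth_on T d" for b
      using smooth_on_subset[of U _ T] smooth_on_dder[OF assms(2)] smd by (auto simp: T_def)
    have "smooth_on T (\<lambda>x. ((Im (dder \<i> f x) * Re v - Re (dder \<i> f x) * Im v) / d x) *\<^sub>R 1 + 
      ((Re (dder 1 f x) * Im v - Im (dder 1 f x) * Re v) / d x) *\<^sub>R \<i>)"
      by (intro smooth_on_add smooth_on_bilinear[OF bounded_bilinear_scaleR] smooth_on_divide smooth_on_diff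
          smooth_on_mult smooth_on_const smooth_on_Re smooth_on_Im D oT) (auto simp: T_def)
    then show ?thesis by (rule smooth_on_cong[OF oT, rotated]) (simp add: N_def complex_eq_iff)
  qed
  have bl: "linear (\<lambda>v. dder v f (g y))" "bij (\<lambda>v. dder v f (g y))" if "y \<in> V" for y
    using linear_dder[OF df[OF gU[OF that]]] g'(3)[OF that] f'[OF gU[OF that]] by auto
  have gT: "g ` V \<subseteq> T"
    using gU bij_linear_complex(1)[OF bl] by (auto simp: T_def d_def)
  have dg: "(g has_derivative (\<lambda>v. N v (g y))) (at y)" if "y \<in> V" for y
  proof -
    have "g' y = (\<lambda>v. N v (g y))"
      using g'(2)[OF that] f'[OF gU[OF that]] bij_linear_complex(2)[OF bl[OF that]]
      by (auto simp: N_def d_def fun_eq_iff)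
    then show ?thesis using g'(1)[OF that] by simp
  qed
  have "Ck_on k V g" for k
  proof (induction k)
    case 0
    then show ?case using *(6) by (simp add: homeomorphism_def)
  next
    case (Suc k)
    have "Ck_on k V (\<lambda>y. N v (g y))" for v
      using Ck_on_compose[OF *(4) gT _ Suc, of "N v"] smN[of v] by (auto simp: smooth_on_def)
    then have "Ck_on k V (dder v g)" for v
      by (rule Ck_on_cong[OF *(4), rotated]) (simp add: dder_eq[OF dg])
    then show ?case using dg by (auto simp: Ck_on_Suc_dder differentiable_def)
  qed
  then show ?thesis using that[OF *] by (simp add: smooth_on_def)
qed

section \<open>Naturality of the Ricci tensor\<close>

lemma pd_eq_dder: "pd i f u = dder (axis i 1) f u"
  by (simp add: pd_def dder_def)

text \<open>Symmetry and nondegeneracy are what the Levi-Civita formulas use. The same predicate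
  serves the chart components of the given metric and the block metric.\<close>

definition metric_on :: "(real^4) set \<Rightarrow> (real^4 \<Rightarrow> real^4^4) \<Rightarrow> bool" where
  "metric_on S G \<longleftrightarrow> open S \<and> smooth_on S G \<and>
     (\<forall>u\<in>S. (\<forall>i j. G u $ i $ j = G u $ j $ i) \<and> det (G u) \<noteq> 0)"

lemma metric_on_entry:
  "metric_on S G \<Longrightarrow> smooth_on S (\<lambda>u. G u $ i $ j)"
  unfolding metric_on_def by (intro smooth_on_vec_nth) auto

lemma metric_on_pd_smooth:
  "metric_on S G \<Longrightarrow> smooth_on S (pd k (\<lambda>u. G u $ i $ j))"
  using smooth_on_dder[OF metric_on_entry] by (simp add: pd_eq_dder[abs_def])

lemma metric_on_pd_sym:
  assumes "metric_on S G" "u \<in> S"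
  shows "pd k (\<lambda>u. G u $ i $ j) u = pd k (\<lambda>u. G u $ j $ i) u"
  unfolding pd_eq_dder using assms by (intro dder_cong_open[of S]) (auto simp: metric_on_def)

lemma smooth_on_christoffel:
  assumes "metric_on S G"
  shows "smooth_on S (christoffel G k i j)"
proof -
  have "open S" using assms by (simp add: metric_on_def)
  then have "smooth_on S (\<lambda>u. (\<Sum>l\<in>UNIV. matrix_inv (G u) $ k $ l *
        (pd i (\<lambda>x. G x $ l $ j) u + pd j (\<lambda>x. G x $ i $ l) u - pd l (\<lambda>x. G x $ i $ j) u)) / 2)"
    using assms metric_on_pd_smooth[OF assms]
    by (intro smooth_on_divide smooth_on_sum smooth_on_mult smooth_on_diff smooth_on_add smooth_on_const
        smooth_on_matrix_inv metric_on_entry) (auto simp: metric_on_def)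
  then show ?thesis by (simp add: christoffel_def[abs_def])
qed

lemma smooth_on_ricci:
  assumes "metric_on S G"
  shows "smooth_on S (ricci G i j)"
proof -
  have "open S" using assms by (simp add: metric_on_def)
  moreover have "smooth_on S (pd l (christoffel G k i j))" for l k i j
    using smooth_on_dder[OF smooth_on_christoffel[OF assms]] by (simp add: pd_eq_dder[abs_def])
  ultimately show ?thesis
    unfolding ricci_def[abs_def]
    by (intro smooth_on_add smooth_on_sum smooth_on_diff smooth_on_mult smooth_on_christoffel[OF assms])
qed

lemma christoffel_sym:
  assumes "metric_on S G" "u \<in> S"
  shows "christoffel G k i j u = christoffel G k j i u"
  unfolding christoffel_def
  using metric_on_pd_sym[OF assms] by (simp add: add.commute)

lemma matrix_inv_sum:
  fixes M :: "real^'n^'n"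
  assumes "det M \<noteq> 0"
  shows "(\<Sum>k\<in>UNIV. M $ i $ k * matrix_inv M $ k $ l) = (if i = l then 1 else 0)"
    and "(\<Sum>k\<in>UNIV. matrix_inv M $ i $ k * M $ k $ l) = (if i = l then 1 else 0)"
proof -
  have "(M ** matrix_inv M) $ i $ l = mat 1 $ i $ l" "(matrix_inv M ** M) $ i $ l = mat 1 $ i $ l"
    using assms by (simp_all add: matrix_inv_mult invertible_det_nz)
  then show "(\<Sum>k\<in>UNIV. M $ i $ k * matrix_inv M $ k $ l) = (if i = l then 1 else 0)"
    "(\<Sum>k\<in>UNIV. matrix_inv M $ i $ k * M $ k $ l) = (if i = l then 1 else 0)"
    by (simp_all add: matrix_matrix_mult_def mat_def)
qed

text \<open>Contracting with the metric cancels the inverse matrix in the definition. Every later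
  property of the symbols is read off from this lowered form.\<close>

lemma christoffel_lower:
  assumes "metric_on S G" "u \<in> S"
  shows "(\<Sum>l\<in>UNIV. G u $ m $ l * christoffel G l i j u) =
    (pd i (\<lambda>x. G x $ m $ j) u + pd j (\<lambda>x. G x $ i $ m) u - pd m (\<lambda>x. G x $ i $ j) u) / 2"
proof -
  define F where "F n = pd i (\<lambda>x. G x $ n $ j) u + pd j (\<lambda>x. G x $ i $ n) u - pd n (\<lambda>x. G x $ i $ j) u" for n
  have d: "det (G u) \<noteq> 0" using assms by (auto simp: metric_on_def)
  have "(\<Sum>l\<in>UNIV. G u $ m $ l * christoffel G l i j u)
      = (\<Sum>l\<in>UNIV. \<Sum>n\<in>UNIV. G u $ m $ l * matrix_inv (G u) $ l $ n * F n) / 2"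
    by (simp add: christoffel_def F_def sum_distrib_left sum_divide_distrib mult.assoc)
  also have "\<dots> = (\<Sum>n\<in>UNIV. \<Sum>l\<in>UNIV. G u $ m $ l * matrix_inv (G u) $ l $ n * F n) / 2"
    by (subst sum.swap) simp
  also have "\<dots> = (\<Sum>n\<in>UNIV. (if m = n then 1 else 0) * F n) / 2"
    by (simp add: matrix_inv_sum(1)[OF d] sum_distrib_right[symmetric])
  also have "\<dots> = F m / 2" by (simp add: if_distrib[of "\<lambda>a. a * _"] cong: if_cong)
  finally show ?thesis by (simp add: F_def)
qed

lemma christoffel_compatible:
  assumes "metric_on S G" "u \<in> S"
  shows "pd k (\<lambda>u. G u $ i $ j) u =
    (\<Sum>l\<in>UNIV. G u $ l $ j * christoffel G l k i u + G u $ i $ l * christoffel G l k j u)"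
proof -
  have sym: "G u $ l $ j = G u $ j $ l" for l j using assms by (auto simp: metric_on_def)
  show ?thesis
    unfolding sum.distrib sym[of _ j] christoffel_lower[OF assms]
    using metric_on_pd_sym[OF assms, of k j i] metric_on_pd_sym[OF assms, of i j k]
      metric_on_pd_sym[OF assms, of j k i] metric_on_pd_sym[OF assms, of j i k]
    by (simp add: field_simps)
qed

text \<open>The fundamental lemma of Riemannian geometry: the difference of two torsion-free
  compatible connections, with its index lowered, is symmetric in one pair of indices and
  antisymmetric in another, hence zero. It allows symbols to be guessed and then verified.\<close>

lemma christoffel_unique:
  assumes "metric_on S G" "u \<in> S"
    and symC: "\<And>l i j. C l i j = C l j i"
    and compat: "\<And>k i j. pd k (\<lambda>u. G u $ i $ j) u =
      (\<Sum>l\<in>UNIV. G u $ l $ j * C l k i + G u $ i $ l * C l k j)"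
  shows "christoffel G l i j u = C l i j"
proof -
  define D where "D l i j = C l i j - christoffel G l i j u" for l i j
  define T where "T j k i = (\<Sum>l\<in>UNIV. G u $ j $ l * D l k i)" for j k i
  have sym: "G u $ l $ j = G u $ j $ l" for l j using assms by (auto simp: metric_on_def)
  have d: "det (G u) \<noteq> 0" using assms by (auto simp: metric_on_def)
  have Dsym: "D l i j = D l j i" for l i j
    using symC christoffel_sym[OF assms(1,2)] by (simp add: D_def)
  have anti: "T j k i + T i k j = 0" for i j k
    using compat[of k i j] christoffel_compatible[OF assms(1,2), of k i j]
    by (simp add: T_def D_def sym[of _ j] sum.distrib algebra_simps sum_subtractf)
  have Tsym: "T j k i = T j i k" for i j k by (simp add: T_def Dsym)
  \<comment> \<open>\<open>T\<close> is antisymmetric in its outer indices and symmetric in the last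
    two. Going through the permutations of i, j, k brings \<open>T j k i\<close> back with the
    opposite sign.\<close>
  have T0: "T j k i = 0" for i j k
    using anti[of j k i] anti[of i j k] anti[of k i j] Tsym[of i k j] Tsym[of k j i] Tsym[of j i k] by simp
  have "D l i j = (\<Sum>m\<in>UNIV. (if l = m then 1 else 0) * D m i j)"
    by (simp add: if_distrib[of "\<lambda>a. a * _"] cong: if_cong)
  also have "\<dots> = (\<Sum>m\<in>UNIV. \<Sum>n\<in>UNIV. matrix_inv (G u) $ l $ n * (G u $ n $ m * D m i j))"
    by (simp add: matrix_inv_sum(2)[OF d, symmetric] sum_distrib_right mult.assoc)
  also have "\<dots> = (\<Sum>n\<in>UNIV. matrix_inv (G u) $ l $ n * T n i j)"
    by (subst sum.swap) (simp add: T_def sum_distrib_left)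
  finally show ?thesis by (simp add: T0 D_def)
qed

section \<open>Index-free form of the connection and of the curvature\<close>

definition chr :: "(real^4 \<Rightarrow> real^4^4) \<Rightarrow> 4 \<Rightarrow> 4 \<Rightarrow> real^4 \<Rightarrow> real^4" where
  "chr G i j u = (\<chi> k. christoffel G k i j u)"

definition Gam :: "(real^4 \<Rightarrow> real^4^4) \<Rightarrow> real^4 \<Rightarrow> real^4 \<Rightarrow> real^4 \<Rightarrow> real^4" where
  "Gam G u v w = (\<Sum>i\<in>UNIV. \<Sum>j\<in>UNIV. (v $ i * w $ j) *\<^sub>R chr G i j u)"

text \<open>Only the coefficients are differentiated, in direction \<open>x\<close>; the arguments
  \<open>v\<close> and \<open>w\<close> are held constant.\<close>

definition DGam :: "(real^4 \<Rightarrow> real^4^4) \<Rightarrow> real^4 \<Rightarrow> real^4 \<Rightarrow> real^4 \<Rightarrow> real^4 \<Rightarrow> real^4" where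
  "DGam G u x v w = (\<Sum>i\<in>UNIV. \<Sum>j\<in>UNIV. (v $ i * w $ j) *\<^sub>R dder x (chr G i j) u)"

text \<open>The curvature operator \<open>R(x, y) z\<close>, whose trace over \<open>x\<close> is the Ricci form of \<open>z\<close> and \<open>y\<close>.\<close>

definition riem :: "(real^4 \<Rightarrow> real^4^4) \<Rightarrow> real^4 \<Rightarrow> real^4 \<Rightarrow> real^4 \<Rightarrow> real^4 \<Rightarrow> real^4" where
  "riem G u x y z = DGam G u x z y - DGam G u y z x + Gam G u x (Gam G u z y) - Gam G u y (Gam G u z x)"

definition Gform :: "(real^4 \<Rightarrow> real^4^4) \<Rightarrow> real^4 \<Rightarrow> real^4 \<Rightarrow> real^4 \<Rightarrow> real" where
  "Gform G u v w = (\<Sum>i\<in>UNIV. \<Sum>j\<in>UNIV. G u $ i $ j * v $ i * w $ j)"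

lemma bilinear_Gam: "bilinear (Gam G u)"
  unfolding bilinear_def Gam_def
  by (auto intro!: linearI simp: algebra_simps sum.distrib scaleR_sum_right)

lemma bilinear_DGam: "bilinear (DGam G u x)"
  unfolding bilinear_def DGam_def
  by (auto intro!: linearI simp: algebra_simps sum.distrib scaleR_sum_right)

lemma bilinear_Gform: "bilinear (Gform G u)"
  unfolding bilinear_def Gform_def
  by (auto intro!: linearI simp: algebra_simps sum.distrib sum_distrib_left)

lemma smooth_on_chr:
  assumes "metric_on S G"
  shows "smooth_on S (chr G i j)"
  unfolding chr_def[abs_def]
  by (rule smooth_on_vec_lambda) (use assms smooth_on_christoffel in \<open>auto simp: metric_on_def\<close>)

lemma linear_DGam:
  assumes "metric_on S G" "u \<in> S"
  shows "linear (\<lambda>x. DGam G u x v w)"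
proof -
  have L: "linear (\<lambda>x. dder x (chr G i j) u)" for i j
    by (rule linear_dder[OF smooth_on_differentiable[OF smooth_on_chr[OF assms(1)] assms(2)]])
  show ?thesis
    unfolding DGam_def
    by (intro linear_compose_sum ballI linear_compose_scale_right L)
qed

lemma Gam_sym:
  assumes "metric_on S G" "u \<in> S"
  shows "Gam G u v w = Gam G u w v"
proof -
  have "chr G i j u = chr G j i u" for i j
    using christoffel_sym[OF assms] by (simp add: chr_def)
  then show ?thesis
    unfolding Gam_def by (subst sum.swap) (simp add: mult.commute)
qed

lemma sum_axis:
  fixes f :: "'n::finite \<Rightarrow> real" and g :: "'n \<Rightarrow> 'b::real_vector"
  shows "(\<Sum>a\<in>UNIV. axis i 1 $ a * f a) = f i" "(\<Sum>a\<in>UNIV. f a * axis i 1 $ a) = f i"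
    "(\<Sum>a\<in>UNIV. axis i 1 $ a *\<^sub>R g a) = g i"
  by (simp_all add: axis_def if_distrib[of "\<lambda>a. a * _"] if_distrib[of "\<lambda>a. _ * a"]
      if_distrib[of "\<lambda>a. a *\<^sub>R _"] cong: if_cong)

lemma Gam_nested: "Gam G u v w = (\<Sum>i\<in>UNIV. v $ i *\<^sub>R (\<Sum>j\<in>UNIV. w $ j *\<^sub>R chr G i j u))"
  by (simp add: Gam_def scaleR_sum_right)

lemma DGam_nested: "DGam G u x v w = (\<Sum>i\<in>UNIV. v $ i *\<^sub>R (\<Sum>j\<in>UNIV. w $ j *\<^sub>R dder x (chr G i j) u))"
  by (simp add: DGam_def scaleR_sum_right)

lemma Gform_nested: "Gform G u v w = (\<Sum>i\<in>UNIV. v $ i * (\<Sum>j\<in>UNIV. G u $ i $ j * w $ j))"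
  by (simp add: Gform_def sum_distrib_left mult_ac)

lemma Gam_axis: "Gam G u (axis i 1) (axis j 1) = chr G i j u"
  by (simp add: Gam_nested sum_axis)

lemma DGam_axis: "DGam G u x (axis i 1) (axis j 1) = dder x (chr G i j) u"
  by (simp add: DGam_nested sum_axis)

lemma vec_expand_axis:
  fixes v :: "real^'n"
  shows "v = (\<Sum>i\<in>UNIV. v $ i *\<^sub>R axis i 1)"
  by (simp add: vec_eq_iff axis_def if_distrib[of "\<lambda>a. _ * a"] cong: if_cong)

lemma linear_expand_axis:
  fixes v :: "real^'n"
  assumes "linear L"
  shows "L v = (\<Sum>i\<in>UNIV. v $ i *\<^sub>R L (axis i 1))"
  by (subst vec_expand_axis[of v]) (simp add: linear_sum[OF assms] linear_cmul[OF assms])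

text \<open>Metric compatibility is extended from coordinate directions to arbitrary vectors by
  linearity in \<open>x\<close>, \<open>v\<close> and \<open>w\<close>. The arguments needed later
  are columns of a Jacobian.\<close>

lemma Gform_dder:
  assumes "metric_on S G" "u \<in> S"
  shows "(\<Sum>a\<in>UNIV. \<Sum>b\<in>UNIV. dder x (\<lambda>u. G u $ a $ b) u * v $ a * w $ b)
     = Gform G u (Gam G u x v) w + Gform G u v (Gam G u x w)"
proof -
  have e: "dder x (\<lambda>u. G u $ a $ b) u = Gform G u (Gam G u x (axis a 1)) (axis b 1) + Gform G u (axis a 1) (Gam G u x (axis b 1))" for a b
  proof -
    have d: "dder (axis k 1) (\<lambda>u. G u $ a $ b) u = Gform G u (Gam G u (axis k 1) (axis a 1)) (axis b 1) + Gform G u (axis a 1) (Gam G u (axis k 1) (axis b 1))" for k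
      unfolding pd_eq_dder[symmetric] christoffel_compatible[OF assms]
      by (simp add: Gam_axis Gform_nested chr_def sum_axis sum.distrib mult.commute)
    let ?L = "\<lambda>x. Gform G u (Gam G u x (axis a 1)) (axis b 1) + Gform G u (axis a 1) (Gam G u x (axis b 1))"
    have L: "linear ?L"
      by (intro linear_compose_add) (auto intro!: linearI simp: bilinear_ladd[OF bilinear_Gam] bilinear_ladd[OF bilinear_Gform]
        bilinear_radd[OF bilinear_Gform] bilinear_lmul[OF bilinear_Gam] bilinear_lmul[OF bilinear_Gform] bilinear_rmul[OF bilinear_Gform])
    show ?thesis
      using linear_expand_axis[OF L, of x] linear_expand_axis[OF linear_dder[OF smooth_on_differentiable[OF metric_on_entry[OF assms(1)] assms(2)]], of x a b]
      by (simp add: d)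
  qed
  have "Gform G u (Gam G u x v) w + Gform G u v (Gam G u x w)
    = (\<Sum>a\<in>UNIV. \<Sum>b\<in>UNIV. (v $ a * w $ b) * (Gform G u (Gam G u x (axis a 1)) (axis b 1) + Gform G u (axis a 1) (Gam G u x (axis b 1))))"
  proof -
    have 1: "linear (\<lambda>v. Gform G u (Gam G u x v) w + Gform G u v (Gam G u x w))" for w
      by (intro linear_compose_add) (auto intro!: linearI simp: bilinear_radd[OF bilinear_Gam] bilinear_ladd[OF bilinear_Gform]
        bilinear_rmul[OF bilinear_Gam] bilinear_lmul[OF bilinear_Gform])
    have 2: "linear (\<lambda>w. Gform G u (Gam G u x v) w + Gform G u v (Gam G u x w))" for v
      by (intro linear_compose_add) (auto intro!: linearI simp: bilinear_radd[OF bilinear_Gam] bilinear_radd[OF bilinear_Gform]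
        bilinear_rmul[OF bilinear_Gam] bilinear_rmul[OF bilinear_Gform])
    show ?thesis
      by (subst linear_expand_axis[OF 1], subst linear_expand_axis[OF 2]) (simp add: sum_distrib_left mult.assoc)
  qed
  then show ?thesis by (simp add: e mult_ac)
qed

lemma ricci_riem:
  assumes "metric_on S G" "u \<in> S"
  shows "ricci G a b u = (\<Sum>c\<in>UNIV. riem G u (axis c 1) (axis b 1) (axis a 1) $ c)"
proof -
  have dchr: "dder x (chr G i j) u $ k = dder x (christoffel G k i j) u" for x i j k
    using dder_vec_nth[OF smooth_on_differentiable[OF smooth_on_chr[OF assms(1)] assms(2)], of x i j k]
    by (simp add: chr_def)
  have GG: "Gam G u (axis i 1) v $ k = (\<Sum>l\<in>UNIV. christoffel G k i l u * v $ l)" for i v k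
    by (simp add: Gam_nested sum_axis chr_def mult.commute)
  show ?thesis
    unfolding ricci_def riem_def DGam_axis Gam_axis
    by (simp add: dchr GG chr_def pd_eq_dder sum.distrib sum_subtractf)
qed

section \<open>Behaviour of connection and curvature under pullback\<close>

context
  fixes S Y :: "(real^4) set" and G H :: "real^4 \<Rightarrow> real^4^4" and \<Phi> :: "real^4 \<Rightarrow> real^4"
  assumes G: "metric_on S G" and H: "metric_on Y H" and \<Phi>: "smooth_on Y \<Phi>" "\<Phi> ` Y \<subseteq> S"
    and pull: "\<And>y i j. y \<in> Y \<Longrightarrow>
      H y $ i $ j = Gform G (\<Phi> y) (dder (axis i 1) \<Phi> y) (dder (axis j 1) \<Phi> y)"
begin

abbreviation (input) J :: "4 \<Rightarrow> real^4 \<Rightarrow> real^4" where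
  "J i \<equiv> dder (axis i 1) \<Phi>"

abbreviation (input) d :: "4 \<Rightarrow> (real^4 \<Rightarrow> 'b::real_normed_vector) \<Rightarrow> real^4 \<Rightarrow> 'b" where
  "d i \<equiv> dder (axis i 1)"

definition JM :: "real^4 \<Rightarrow> real^4^4" where
  "JM y = (\<chi> a i. J i y $ a)"

lemma open_Y: "open Y" and open_S: "open S"
  using H G by (auto simp: metric_on_def)

lemma Phi_in: "y \<in> Y \<Longrightarrow> \<Phi> y \<in> S"
  using \<Phi> by auto

lemma J_smooth: "smooth_on Y (J i)"
  by (rule smooth_on_dder[OF \<Phi>(1)])

lemmas J_diff = smooth_on_differentiable[OF J_smooth]
lemmas Phi_diff = smooth_on_differentiable[OF \<Phi>(1)]

lemma dJ_sym: "y \<in> Y \<Longrightarrow> d k (J i) y = d i (J k) y"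
  by (rule dder_commute[OF open_Y \<Phi>(1)])

lemma ddJ_sym: "y \<in> Y \<Longrightarrow> d k (d i (J j)) y = d j (d i (J k)) y"
proof -
  assume y: "y \<in> Y"
  have "d k (d i (J j)) y = d k (d j (J i)) y"
    by (rule dder_cong_open[OF open_Y y dJ_sym])
  also have "\<dots> = d j (d k (J i)) y" by (rule dder_commute[OF open_Y J_smooth y])
  also have "\<dots> = d j (d i (J k)) y" by (rule dder_cong_open[OF open_Y y dJ_sym])
  finally show ?thesis .
qed

text \<open>Since H = J^T G J, nondegeneracy of the pulled-back metric already forces the Jacobian
  to be invertible. Hence \<open>\<Phi>\<close> need not be known in advance to be a local
  diffeomorphism.\<close>

lemma det_JM:
  assumes "y \<in> Y"
  shows "det (JM y) \<noteq> 0"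
proof -
  have "H y = transpose (JM y) ** (G (\<Phi> y) ** JM y)"
    using pull[OF assms]
    by (simp add: vec_eq_iff matrix_matrix_mult_def transpose_def JM_def Gform_nested)
  then have "det (H y) = det (JM y) * (det (G (\<Phi> y)) * det (JM y))"
    by (simp add: det_mul)
  then show ?thesis using H assms by (auto simp: metric_on_def)
qed

lemma JM_inv_expand:
  assumes "y \<in> Y"
  shows "(\<Sum>l\<in>UNIV. (matrix_inv (JM y) *v w) $ l *\<^sub>R J l y) = w"
proof -
  have "JM y *v (matrix_inv (JM y) *v w) = w"
    using det_JM[OF assms] by (simp add: matrix_vector_mul_assoc matrix_inv_mult invertible_det_nz)
  then show ?thesis
    by (simp add: matrix_vector_mult_def JM_def vec_eq_iff mult.commute)
qed

lemma JM_inv_J: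
  assumes "y \<in> Y"
  shows "(matrix_inv (JM y) *v (\<Sum>l\<in>UNIV. c l *\<^sub>R J l y)) $ k = c k"
proof -
  have "(\<Sum>l\<in>UNIV. c l *\<^sub>R J l y) = JM y *v (\<chi> l. c l)"
    by (simp add: matrix_vector_mult_def JM_def vec_eq_iff mult.commute)
  then show ?thesis
    using det_JM[OF assms] by (simp add: matrix_vector_mul_assoc matrix_inv_mult invertible_det_nz)
qed

text \<open>The derivative of the coefficients of \<open>G\<close> along \<open>J k\<close> is
  replaced by connection terms. What remains groups into the covariant derivative of
  \<open>J i\<close>, and of \<open>J j\<close>, along \<open>J k\<close>.\<close>

lemma H_dder:
  assumes "y \<in> Y"
  shows "d k (\<lambda>y. H y $ i $ j) y =
    Gform G (\<Phi> y) (Gam G (\<Phi> y) (J k y) (J i y) + d k (J i) y) (J j y) +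
    Gform G (\<Phi> y) (J i y) (Gam G (\<Phi> y) (J k y) (J j y) + d k (J j) y)"
proof -
  have GP: "(\<lambda>y. G (\<Phi> y) $ a $ b) differentiable (at y)"
    and dGP: "d k (\<lambda>y. G (\<Phi> y) $ a $ b) y = dder (J k y) (\<lambda>u. G u $ a $ b) (\<Phi> y)" for a b
  proof -
    have sm: "(\<lambda>u. G u $ a $ b) differentiable (at (\<Phi> y))"
      by (rule smooth_on_differentiable[OF metric_on_entry[OF G] Phi_in[OF assms]])
    show "d k (\<lambda>y. G (\<Phi> y) $ a $ b) y = dder (J k y) (\<lambda>u. G u $ a $ b) (\<Phi> y)"
      using dder_compose[OF Phi_diff[OF assms] sm] .
    show "(\<lambda>y. G (\<Phi> y) $ a $ b) differentiable (at y)"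
      using differentiable_chain_at[OF Phi_diff[OF assms] sm] by (simp add: o_def)
  qed
  have Jd: "(\<lambda>y. J i y $ a) differentiable (at y)" "d k (\<lambda>y. J i y $ a) y = d k (J i) y $ a" for i a
    using smooth_on_differentiable[OF smooth_on_vec_nth[OF open_Y J_smooth] assms] dder_vec_nth[OF J_diff[OF assms]] by auto
  have "d k (\<lambda>y. H y $ i $ j) y = d k (\<lambda>y. \<Sum>a\<in>UNIV. \<Sum>b\<in>UNIV. G (\<Phi> y) $ a $ b * J i y $ a * J j y $ b) y"
    by (rule dder_cong_open[OF open_Y assms]) (simp add: pull Gform_def)
  also have "\<dots> = (\<Sum>a\<in>UNIV. \<Sum>b\<in>UNIV.
      (dder (J k y) (\<lambda>u. G u $ a $ b) (\<Phi> y)) * J i y $ a * J j y $ b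
      + G (\<Phi> y) $ a $ b * d k (J i) y $ a * J j y $ b + G (\<Phi> y) $ a $ b * J i y $ a * d k (J j) y $ b)"
    by (simp add: dder_sum dder_mult GP Jd dGP differentiable_mult differentiable_sum algebra_simps)
  also have "\<dots> = Gform G (\<Phi> y) (Gam G (\<Phi> y) (J k y) (J i y)) (J j y) + Gform G (\<Phi> y) (J i y) (Gam G (\<Phi> y) (J k y) (J j y))
      + Gform G (\<Phi> y) (d k (J i) y) (J j y) + Gform G (\<Phi> y) (J i y) (d k (J j) y)"
    unfolding Gform_dder[OF G Phi_in[OF assms], symmetric] by (simp add: Gform_def sum.distrib)
  finally show ?thesis
    by (simp add: bilinear_ladd[OF bilinear_Gform] bilinear_radd[OF bilinear_Gform])
qed

text \<open>The transformation law of Christoffel symbols. The right-hand side, expanded in the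
  frame \<open>J\<close>, has coefficients \<open>C\<close> that are symmetric, because second
  derivatives commute, and compatible with \<open>H\<close> by \<open>H_dder\<close>; uniqueness
  identifies them with the symbols of \<open>H\<close>.\<close>

lemma christoffel_pullback:
  assumes "y \<in> Y"
  shows "(\<Sum>l\<in>UNIV. christoffel H l i j y *\<^sub>R J l y) = Gam G (\<Phi> y) (J i y) (J j y) + d i (J j) y"
proof -
  define W where "W k i = Gam G (\<Phi> y) (J k y) (J i y) + d k (J i) y" for k i
  define C where "C l k i = (matrix_inv (JM y) *v W k i) $ l" for l k i
  have WJ: "W k i = (\<Sum>l\<in>UNIV. C l k i *\<^sub>R J l y)" for k i
    unfolding C_def JM_inv_expand[OF assms] ..
  have "christoffel H l i j y = C l i j" for l i j
  proof (rule christoffel_unique[OF H assms])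
    show "C l i j = C l j i" for l i j
      unfolding C_def W_def by (simp only: Gam_sym[OF G Phi_in[OF assms], of "J i y"] dJ_sym[OF assms, of i])
    fix k i j
    have "(\<Sum>l\<in>UNIV. H y $ l $ j * C l k i) = Gform G (\<Phi> y) (W k i) (J j y)"
    proof -
      have L: "linear (\<lambda>v. Gform G (\<Phi> y) v (J j y))" using bilinear_Gform by (auto simp: bilinear_def)
      show ?thesis
        unfolding WJ linear_sum[OF L] linear_cmul[OF L] by (simp add: pull[OF assms] mult.commute)
    qed
    moreover have "(\<Sum>l\<in>UNIV. H y $ i $ l * C l k j) = Gform G (\<Phi> y) (J i y) (W k j)"
    proof -
      have L: "linear (Gform G (\<Phi> y) (J i y))" using bilinear_Gform by (auto simp: bilinear_def)
      show ?thesis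
        unfolding WJ linear_sum[OF L] linear_cmul[OF L] by (simp add: pull[OF assms] mult.commute)
    qed
    ultimately show "pd k (\<lambda>u. H u $ i $ j) y = (\<Sum>l\<in>UNIV. H y $ l $ j * C l k i + H y $ i $ l * C l k j)"
      unfolding pd_eq_dder H_dder[OF assms] by (simp add: sum.distrib W_def)
  qed
  then show ?thesis using WJ[of i j] by (simp add: W_def)
qed

lemma dJ_eq:
  "y \<in> Y \<Longrightarrow> d k (J l) y = (\<Sum>m\<in>UNIV. christoffel H m k l y *\<^sub>R J m y) - Gam G (\<Phi> y) (J k y) (J l y)"
  by (simp add: christoffel_pullback)

text \<open>The transformation law is differentiated in direction \<open>k\<close>, and derivatives
  of the frame on the left are eliminated by \<open>dJ_eq\<close>. The parenthesised group and the
  third derivative of \<open>\<Phi>\<close> on the right are symmetric in \<open>k\<close> and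
  \<open>j\<close>; they are kept together so that they cancel in the curvature.\<close>

lemma dder_christoffel_pullback:
  assumes y: "y \<in> Y"
  shows "(\<Sum>m\<in>UNIV. (d k (christoffel H m i j) y + (\<Sum>l\<in>UNIV. christoffel H m k l y * christoffel H l i j y)) *\<^sub>R J m y)
    = DGam G (\<Phi> y) (J k y) (J i y) (J j y) + Gam G (\<Phi> y) (J k y) (Gam G (\<Phi> y) (J i y) (J j y))
      + (Gam G (\<Phi> y) (J k y) (d i (J j) y) + Gam G (\<Phi> y) (d k (J i) y) (J j y) + Gam G (\<Phi> y) (J i y) (d k (J j) y))
      + d k (d i (J j)) y"
proof -
  have CP: "(\<lambda>y. chr G a b (\<Phi> y)) differentiable (at y)"
    and dCP: "d k (\<lambda>y. chr G a b (\<Phi> y)) y = dder (J k y) (chr G a b) (\<Phi> y)" for a b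
  proof -
    have sm: "chr G a b differentiable (at (\<Phi> y))"
      by (rule smooth_on_differentiable[OF smooth_on_chr[OF G] Phi_in[OF y]])
    show "d k (\<lambda>y. chr G a b (\<Phi> y)) y = dder (J k y) (chr G a b) (\<Phi> y)"
      using dder_compose[OF Phi_diff[OF y] sm] .
    show "(\<lambda>y. chr G a b (\<Phi> y)) differentiable (at y)"
      using differentiable_chain_at[OF Phi_diff[OF y] sm] by (simp add: o_def)
  qed
  have Jd: "(\<lambda>y. J i y $ a) differentiable (at y)" "d k (\<lambda>y. J i y $ a) y = d k (J i) y $ a" for i a
    using smooth_on_differentiable[OF smooth_on_vec_nth[OF open_Y J_smooth] y] dder_vec_nth[OF J_diff[OF y]] by auto
  have Cd: "christoffel H m i j differentiable (at y)" for m i j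
    by (rule smooth_on_differentiable[OF smooth_on_christoffel[OF H] y])
  have dsc: "(\<lambda>y. f y *\<^sub>R g y) differentiable (at y)" "d k (\<lambda>y. f y *\<^sub>R g y) y = f y *\<^sub>R d k g y + d k f y *\<^sub>R g y"
    if "f differentiable (at y)" "g differentiable (at y)" for f :: "real^4 \<Rightarrow> real" and g :: "real^4 \<Rightarrow> real^4"
    using that by (auto intro!: differentiable_scaleR dder_bilinear[OF bounded_bilinear_scaleR])
  have GamP: "(\<lambda>y. Gam G (\<Phi> y) (J i y) (J j y)) differentiable (at y)" 
    unfolding Gam_def by (intro differentiable_sum ballI dsc differentiable_mult Jd CP finite)
  have dGam: "d k (\<lambda>y. Gam G (\<Phi> y) (J i y) (J j y)) y = Gam G (\<Phi> y) (d k (J i) y) (J j y) + Gam G (\<Phi> y) (J i y) (d k (J j) y)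
     + DGam G (\<Phi> y) (J k y) (J i y) (J j y)"
  proof -
    have "d k (\<lambda>y. Gam G (\<Phi> y) (J i y) (J j y)) y = (\<Sum>a\<in>UNIV. \<Sum>b\<in>UNIV. d k (\<lambda>y. (J i y $ a * J j y $ b) *\<^sub>R chr G a b (\<Phi> y)) y)"
      unfolding Gam_def
      by (simp add: dder_sum differentiable_sum dsc(1) differentiable_mult Jd(1) CP)
    also have "\<dots> = Gam G (\<Phi> y) (d k (J i) y) (J j y) + Gam G (\<Phi> y) (J i y) (d k (J j) y)
       + DGam G (\<Phi> y) (J k y) (J i y) (J j y)"
      by (simp add: dsc CP Jd differentiable_mult dder_mult dCP Gam_def DGam_def sum.distrib algebra_simps)
    finally show ?thesis .
  qed
  have "d k (\<lambda>y. \<Sum>l\<in>UNIV. christoffel H l i j y *\<^sub>R J l y) y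
      = d k (\<lambda>y. Gam G (\<Phi> y) (J i y) (J j y) + d i (J j) y) y"
    by (rule dder_cong_open[OF open_Y y christoffel_pullback])
  also have "d k (\<lambda>y. \<Sum>l\<in>UNIV. christoffel H l i j y *\<^sub>R J l y) y
      = (\<Sum>l\<in>UNIV. christoffel H l i j y *\<^sub>R d k (J l) y) + (\<Sum>l\<in>UNIV. d k (christoffel H l i j) y *\<^sub>R J l y)"
    by (subst dder_sum) (simp_all add: dsc Cd J_diff[OF y] sum.distrib)
  also have "(\<Sum>l\<in>UNIV. christoffel H l i j y *\<^sub>R d k (J l) y) =
     (\<Sum>m\<in>UNIV. (\<Sum>l\<in>UNIV. christoffel H m k l y * christoffel H l i j y) *\<^sub>R J m y)
     - Gam G (\<Phi> y) (J k y) (\<Sum>l\<in>UNIV. christoffel H l i j y *\<^sub>R J l y)"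
  proof -
    have L: "linear (Gam G (\<Phi> y) (J k y))" using bilinear_Gam by (auto simp: bilinear_def)
    have "(\<Sum>l\<in>UNIV. christoffel H l i j y *\<^sub>R d k (J l) y) =
      (\<Sum>l\<in>UNIV. \<Sum>m\<in>UNIV. (christoffel H m k l y * christoffel H l i j y) *\<^sub>R J m y)
      - (\<Sum>l\<in>UNIV. christoffel H l i j y *\<^sub>R Gam G (\<Phi> y) (J k y) (J l y))"
      by (simp only: dJ_eq[OF y] scaleR_diff_right scaleR_sum_right sum_subtractf scaleR_scaleR mult.commute)
    then show ?thesis
      by (subst (asm) sum.swap) (simp add: linear_sum[OF L] linear_cmul[OF L] scaleR_sum_left)
  qed
  also have "d k (\<lambda>y. Gam G (\<Phi> y) (J i y) (J j y) + d i (J j) y) y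
     = d k (\<lambda>y. Gam G (\<Phi> y) (J i y) (J j y)) y + d k (d i (J j)) y"
    by (intro dder_add GamP smooth_on_differentiable[OF smooth_on_dder[OF J_smooth] y])
  finally show ?thesis
    unfolding dGam christoffel_pullback[OF y] bilinear_radd[OF bilinear_Gam]
    by (simp add: scaleR_add_left sum.distrib algebra_simps)
qed

text \<open>Curvature is the part of the preceding formula that is antisymmetric in \<open>k\<close>
  and \<open>j\<close>. All derivatives of the Jacobian drop out, which is the tensoriality of the
  curvature.\<close>

lemma riem_pullback:
  assumes y: "y \<in> Y"
  shows "(\<Sum>m\<in>UNIV. (riem H y (axis k 1) (axis j 1) (axis i 1) $ m) *\<^sub>R J m y) = riem G (\<Phi> y) (J k y) (J j y) (J i y)"
proof -
  have dchr: "dder x (chr H i j) y $ k = dder x (christoffel H k i j) y" for x i j k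
    using dder_vec_nth[OF smooth_on_differentiable[OF smooth_on_chr[OF H] y], of x i j k]
    by (simp add: chr_def)
  have GG: "Gam H y (axis i 1) v $ k = (\<Sum>l\<in>UNIV. christoffel H k i l y * v $ l)" for i v k
    by (simp add: Gam_nested sum_axis chr_def mult.commute)
  have "riem H y (axis k 1) (axis j 1) (axis i 1) $ m =
     (d k (christoffel H m i j) y + (\<Sum>l\<in>UNIV. christoffel H m k l y * christoffel H l i j y))
     - (d j (christoffel H m i k) y + (\<Sum>l\<in>UNIV. christoffel H m j l y * christoffel H l i k y))" for m
    unfolding riem_def DGam_axis Gam_axis by (simp add: dchr GG chr_def)
  then show ?thesis
    by (simp only: scaleR_diff_left sum_subtractf dder_christoffel_pullback[OF y])
       (simp add: riem_def dJ_sym[OF y, of k i] dJ_sym[OF y, of j i] dJ_sym[OF y, of k j] ddJ_sym[OF y, of k i j]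
         Gam_sym[OF G Phi_in[OF y], of _ "J j y"] Gam_sym[OF G Phi_in[OF y], of _ "J k y"])
qed

lemma linear_riem1: "u \<in> S \<Longrightarrow> linear (\<lambda>x. riem G u x y z)"
  unfolding riem_def
  by (intro linear_compose_sub linear_compose_add linear_DGam[OF G])
    (auto intro!: linearI simp: bilinear_ladd[OF bilinear_Gam] bilinear_radd[OF bilinear_Gam]
      bilinear_lmul[OF bilinear_Gam] bilinear_rmul[OF bilinear_Gam]
      bilinear_radd[OF bilinear_DGam] bilinear_rmul[OF bilinear_DGam])

lemma linear_riem2: "u \<in> S \<Longrightarrow> linear (\<lambda>y. riem G u x y z)"
  unfolding riem_def
  by (intro linear_compose_sub linear_compose_add linear_DGam[OF G])
    (auto intro!: linearI simp: bilinear_ladd[OF bilinear_Gam] bilinear_radd[OF bilinear_Gam]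
      bilinear_lmul[OF bilinear_Gam] bilinear_rmul[OF bilinear_Gam]
      bilinear_radd[OF bilinear_DGam] bilinear_rmul[OF bilinear_DGam])

lemma linear_riem3: "linear (\<lambda>z. riem G u x y z)"
  unfolding riem_def
  by (intro linear_compose_sub linear_compose_add)
    (auto intro!: linearI simp: bilinear_ladd[OF bilinear_Gam] bilinear_radd[OF bilinear_Gam]
      bilinear_lmul[OF bilinear_Gam] bilinear_rmul[OF bilinear_Gam]
      bilinear_ladd[OF bilinear_DGam] bilinear_lmul[OF bilinear_DGam])

text \<open>The trace taken in the frame \<open>J\<close> equals the trace in the standard basis,
  because the matrix of the frame cancels against its inverse. The two free arguments are then
  expanded by linearity.\<close>

lemma ricci_pullback:
  assumes y: "y \<in> Y"
  shows "ricci H i j y = (\<Sum>a\<in>UNIV. \<Sum>b\<in>UNIV. J i y $ a * J j y $ b * ricci G a b (\<Phi> y))"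
proof -
  let ?R = "riem G (\<Phi> y)" and ?I = "matrix_inv (JM y)"
  have u: "\<Phi> y \<in> S" using y by (rule Phi_in)
  have "ricci H i j y = (\<Sum>k\<in>UNIV. (?I *v ?R (J k y) (J j y) (J i y)) $ k)"
    unfolding ricci_riem[OF H y] riem_pullback[OF y, symmetric] JM_inv_J[OF y] ..
  also have "\<dots> = (\<Sum>k\<in>UNIV. \<Sum>c\<in>UNIV. \<Sum>e\<in>UNIV. ?I $ k $ e * (J k y $ c * ?R (axis c 1) (J j y) (J i y) $ e))"
    by (rule sum.cong[OF refl], subst linear_expand_axis[OF linear_riem1[OF u]], subst sum.swap)
       (simp add: matrix_vector_mult_def sum_distrib_left)
  also have "\<dots> = (\<Sum>c\<in>UNIV. \<Sum>e\<in>UNIV. (\<Sum>k\<in>UNIV. JM y $ c $ k * ?I $ k $ e) * ?R (axis c 1) (J j y) (J i y) $ e)"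
  proof -
    have JMc: "J k y $ c = JM y $ c $ k" for c k by (simp add: JM_def)
    show ?thesis
      unfolding sum_distrib_right
      by (rule trans[OF sum.swap], rule sum.cong[OF refl], rule trans[OF sum.swap])
        (simp add: JMc mult_ac)
  qed
  also have "\<dots> = (\<Sum>c\<in>UNIV. ?R (axis c 1) (J j y) (J i y) $ c)"
    unfolding matrix_inv_sum(1)[OF det_JM[OF y]]
    by (simp add: if_distrib[of "\<lambda>a. a * _"] cong: if_cong)
  also have "\<dots> = (\<Sum>c\<in>UNIV. \<Sum>a\<in>UNIV. \<Sum>b\<in>UNIV. J i y $ a * J j y $ b * ?R (axis c 1) (axis b 1) (axis a 1) $ c)"
    by (subst linear_expand_axis[OF linear_riem3], subst linear_expand_axis[OF linear_riem2[OF u]])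
       (simp add: scaleR_sum_right mult.assoc)
  also have "\<dots> = (\<Sum>a\<in>UNIV. \<Sum>b\<in>UNIV. J i y $ a * J j y $ b * ricci G a b (\<Phi> y))"
    by (subst sum.swap, rule sum.cong[OF refl], subst sum.swap)
       (simp add: ricci_riem[OF G u] sum_distrib_left)
  finally show ?thesis .
qed

text \<open>The defect \<open>E\<close> of the Einstein equation pulls back to J^T E J, which
  vanishes by assumption. Cancelling the invertible Jacobian on both sides gives E = 0.\<close>

lemma einstein_of_pullback:
  assumes y: "y \<in> Y" and ein: "\<And>i j. ricci H i j y = lam * H y $ i $ j"
  shows "ricci G a b (\<Phi> y) = lam * G (\<Phi> y) $ a $ b"
proof -
  define E where "E = (\<chi> a b. ricci G a b (\<Phi> y) - lam * G (\<Phi> y) $ a $ b)"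
  have "(transpose (JM y) ** (E ** JM y)) $ i $ j = 0" for i j
  proof -
    have "(transpose (JM y) ** (E ** JM y)) $ i $ j = (\<Sum>a\<in>UNIV. \<Sum>b\<in>UNIV. J i y $ a * J j y $ b * E $ a $ b)"
      by (simp add: matrix_matrix_mult_def transpose_def JM_def sum_distrib_left mult_ac)
    also have "\<dots> = ricci H i j y - lam * H y $ i $ j"
      unfolding ricci_pullback[OF y] pull[OF y] Gform_def E_def
      by (simp add: sum_subtractf sum_distrib_left algebra_simps)
    finally show ?thesis using ein by simp
  qed
  then have "transpose (JM y) ** (E ** JM y) = 0" by (simp add: vec_eq_iff)
  then have "matrix_inv (transpose (JM y)) ** (transpose (JM y) ** (E ** JM y)) ** matrix_inv (JM y) = 0"
    by (simp add: vec_eq_iff matrix_matrix_mult_def)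
  then have "(matrix_inv (transpose (JM y)) ** transpose (JM y)) ** E ** (JM y ** matrix_inv (JM y)) = 0"
    by (simp only: matrix_mul_assoc)
  then have "E = 0"
    using det_JM[OF y] by (simp add: matrix_inv_mult invertible_det_nz)
  then show ?thesis by (simp add: E_def vec_eq_iff)
qed

end

section \<open>Ricci curvature of a block metric\<close>

lemma vector_4:
  "(vector [x, y, z, w] :: 'a::zero^4) $ 1 = x" "(vector [x, y, z, w] :: 'a^4) $ 2 = y"
  "(vector [x, y, z, w] :: 'a^4) $ 3 = z" "(vector [x, y, z, w] :: 'a^4) $ 4 = w"
  unfolding vector_def by simp_all

text \<open>Coordinates 1 and 2 are those of the orbit space, coordinates 3 and 4 run along the
  orbits. Functions that factor through \<open>plane\<close> are the torus-invariant ones.\<close>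

definition plane :: "real^4 \<Rightarrow> complex" where
  "plane y = Complex (y $ 1) (y $ 2)"

lemma bounded_linear_plane: "bounded_linear plane"
proof -
  have "plane = (\<lambda>y. (y $ 1) *\<^sub>R 1 + (y $ 2) *\<^sub>R \<i>)"
    by (auto simp: plane_def complex_eq_iff)
  moreover have "bounded_linear (\<lambda>y::real^4. (y $ 1) *\<^sub>R (1::complex) + (y $ 2) *\<^sub>R \<i>)"
    by (intro bounded_linear_add bounded_linear_scaleR_const bounded_linear_vec_nth)
  ultimately show ?thesis by simp
qed

lemma plane_axis [simp]: "plane (axis 1 1) = 1" "plane (axis 2 1) = \<i>" "plane (axis 3 1) = 0" "plane (axis 4 1) = 0"
  by (simp_all add: plane_def axis_def complex_eq_iff)

lemma pd_plane:
  assumes "F differentiable (at (plane y))"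
  shows "pd k (\<lambda>y. F (plane y)) y = dder (plane (axis k 1)) F (plane y)"
proof -
  have "dder (axis k 1) plane y = plane (axis k 1)"
    by (rule dder_eq[OF bounded_linear_imp_has_derivative[OF bounded_linear_plane]])
  then show ?thesis
    unfolding pd_eq_dder
    using dder_compose[OF bounded_linear_imp_differentiable[OF bounded_linear_plane] assms] by metis
qed

definition block_metric :: "(complex \<Rightarrow> real) \<Rightarrow> (complex \<Rightarrow> real^2^2) \<Rightarrow> real^4 \<Rightarrow> real^4^4" where
  "block_metric \<Omega> h y = (let w = plane y in
     vector [vector [(\<Omega> w)\<^sup>2, 0, 0, 0], vector [0, (\<Omega> w)\<^sup>2, 0, 0],
       vector [0, 0, h w $ 1 $ 1, h w $ 1 $ 2], vector [0, 0, h w $ 2 $ 1, h w $ 2 $ 2]])"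

lemma smooth_on_plane:
  assumes "open U" "smooth_on U f"
  shows "smooth_on (plane -` U) (\<lambda>y. f (plane y))"
proof (rule smooth_on_compose[OF _ _ assms(2)])
  show "open (plane -` U)"
    using linear_continuous_on[OF bounded_linear_plane] assms(1) by (metis continuous_on_open_vimage open_UNIV inf_top.left_neutral inf_commute)
  show "smooth_on (plane -` U) plane" by (rule smooth_on_bounded_linear[OF bounded_linear_plane])
qed auto

lemma dder_0 [simp]: "f differentiable (at x) \<Longrightarrow> dder 0 f x = 0"
  using linear_0[OF linear_dder] by blast

definition inv_conf :: "(complex \<Rightarrow> real) \<Rightarrow> complex \<Rightarrow> real" where
  "inv_conf \<Omega> w = inverse ((\<Omega> w)\<^sup>2)"

text \<open>The entries of \<open>h\<^sup>-\<^sup>1 dh(e) / 2\<close>.\<close>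

definition m11 :: "(complex \<Rightarrow> real^2^2) \<Rightarrow> complex \<Rightarrow> complex \<Rightarrow> real" where
  "m11 h e w = (h w $ 2 $ 2 * dder e (\<lambda>w. h w $ 1 $ 1) w - h w $ 1 $ 2 * dder e (\<lambda>w. h w $ 1 $ 2) w) / (2 * det (h w))"
definition m12 :: "(complex \<Rightarrow> real^2^2) \<Rightarrow> complex \<Rightarrow> complex \<Rightarrow> real" where
  "m12 h e w = (h w $ 2 $ 2 * dder e (\<lambda>w. h w $ 1 $ 2) w - h w $ 1 $ 2 * dder e (\<lambda>w. h w $ 2 $ 2) w) / (2 * det (h w))"
definition m21 :: "(complex \<Rightarrow> real^2^2) \<Rightarrow> complex \<Rightarrow> complex \<Rightarrow> real" where
  "m21 h e w = (h w $ 1 $ 1 * dder e (\<lambda>w. h w $ 1 $ 2) w - h w $ 1 $ 2 * dder e (\<lambda>w. h w $ 1 $ 1) w) / (2 * det (h w))"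
definition m22 :: "(complex \<Rightarrow> real^2^2) \<Rightarrow> complex \<Rightarrow> complex \<Rightarrow> real" where
  "m22 h e w = (h w $ 1 $ 1 * dder e (\<lambda>w. h w $ 2 $ 2) w - h w $ 1 $ 2 * dder e (\<lambda>w. h w $ 1 $ 2) w) / (2 * det (h w))"

lemma divide_combination:
  fixes d :: real
  assumes "d > 0" "x * a + y * b = d * c"
  shows "x * (a / (2 * d)) + y * (b / (2 * d)) = c / 2"
  using assms by (simp add: field_simps)

locale block_data =
  fixes U :: "complex set" and \<Omega> :: "complex \<Rightarrow> real" and h :: "complex \<Rightarrow> real^2^2"
  assumes U: "open U" and \<Omega>: "smooth_on U \<Omega>" "\<And>w. w \<in> U \<Longrightarrow> \<Omega> w > 0"
    and h: "smooth_on U h" "\<And>w. w \<in> U \<Longrightarrow> h w $ 2 $ 1 = h w $ 1 $ 2" "\<And>w. w \<in> U \<Longrightarrow> det (h w) > 0"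
begin

abbreviation (input) h11 where "h11 w \<equiv> h w $ 1 $ 1"
abbreviation (input) h12 where "h12 w \<equiv> h w $ 1 $ 2"
abbreviation (input) h22 where "h22 w \<equiv> h w $ 2 $ 2"
abbreviation (input) L where "L w \<equiv> ln (\<Omega> w)"
abbreviation (input) E where "E \<equiv> inv_conf \<Omega>"
abbreviation (input) D where "D w \<equiv> det (h w)"
text \<open>This is the logarithm of \<rho>, written without the square root.\<close>

abbreviation (input) N where "N w \<equiv> ln (det (h w)) / 2"
lemma D_eq: "w \<in> U \<Longrightarrow> D w = h11 w * h22 w - h12 w * h12 w"
  using h(2) by (simp add: det_2)

lemma h_smooth: "smooth_on U (\<lambda>w. h w $ i $ j)"
  by (intro smooth_on_vec_nth U h)

lemma D_smooth: "smooth_on U D"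
  by (intro smooth_on_det h_smooth U)

lemma L_smooth: "smooth_on U L"
  by (intro smooth_on_ln U \<Omega>)

lemma E_smooth: "smooth_on U E"
  unfolding inv_conf_def[abs_def] using \<Omega> by (intro smooth_on_inverse smooth_on_power U) force+

lemma N_smooth: "smooth_on U N"
  using h(3) by (intro smooth_on_divide smooth_on_ln D_smooth smooth_on_const U) auto

lemma m_smooth: "smooth_on U (m11 h e)" "smooth_on U (m12 h e)" "smooth_on U (m21 h e)" "smooth_on U (m22 h e)"
  unfolding m11_def[abs_def] m12_def[abs_def] m21_def[abs_def] m22_def[abs_def]
  using h(3) by (force intro!: smooth_on_divide smooth_on_diff smooth_on_mult h_smooth smooth_on_dder D_smooth smooth_on_const U)+

lemma dder_\<Omega>2: "w \<in> U \<Longrightarrow> dder e (\<lambda>w. (\<Omega> w)\<^sup>2) w = 2 * (\<Omega> w)\<^sup>2 * dder e L w"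
  and dder_E: "w \<in> U \<Longrightarrow> dder e E w = - 2 * E w * dder e L w"
proof -
  assume w: "w \<in> U"
  have d: "\<Omega> differentiable (at w)" by (rule smooth_on_differentiable[OF \<Omega>(1) w])
  have dL: "dder e L w = dder e \<Omega> w / \<Omega> w"
    using dder_eq[OF has_derivative_ln[OF \<Omega>(2)[OF w] has_derivative_dder[OF d]]] by (simp add: divide_inverse)
  show 1: "dder e (\<lambda>w. (\<Omega> w)\<^sup>2) w = 2 * (\<Omega> w)\<^sup>2 * dder e L w"
    using \<Omega>(2)[OF w] unfolding dL power2_eq_square dder_mult[OF d d] by simp
  show "dder e E w = - 2 * E w * dder e L w"
  proof -
    have *: "- (2 * W * x) / W\<^sup>2 = - 2 * inverse W * x" if "W \<noteq> 0" for W x :: real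
      using that by (simp add: power2_eq_square field_simps)
    have nz: "(\<Omega> w)\<^sup>2 \<noteq> 0" using \<Omega>(2)[OF w] by simp
    have "(\<lambda>w. (\<Omega> w)\<^sup>2) differentiable (at w)" using d by simp
    from dder_inverse[OF this nz, of e] show ?thesis
      unfolding inv_conf_def[abs_def] 1 *[OF nz] .
  qed
qed

text \<open>Jacobi's formula: the derivative of ln det h is the trace of h^-1 dh, and the matrix m
  carries the factor 1/2.\<close>

lemma dder_N: "w \<in> U \<Longrightarrow> dder e N w = m11 h e w + m22 h e w"
proof -
  assume w: "w \<in> U"
  have d: "(\<lambda>w. h w $ i $ j) differentiable (at w)" for i j by (rule smooth_on_differentiable[OF h_smooth w])
  have dD: "D differentiable (at w)" by (rule smooth_on_differentiable[OF D_smooth w])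
  have "dder e D w = dder e (\<lambda>w. h11 w * h22 w - h12 w * h12 w) w"
    by (rule dder_cong_open[OF U w D_eq])
  also have "\<dots> = h11 w * dder e h22 w + dder e h11 w * h22 w - 2 * h12 w * dder e h12 w"
    by (simp add: dder_diff dder_mult d)
  finally have e: "dder e D w = \<dots>" .
  have "((\<lambda>w. ln (det (h w)) / 2) has_derivative (\<lambda>v. dder v D w * inverse (D w) / 2)) (at w)"
    by (rule bounded_linear.has_derivative[OF bounded_linear_divide has_derivative_ln[OF h(3)[OF w] has_derivative_dder[OF dD]]])
  from dder_eq[OF this, of e] have "dder e N w = dder e D w / (2 * D w)"
    by (simp only: divide_inverse inverse_mult_distrib mult_ac)
  also have "\<dots> = m11 h e w + m22 h e w"
    unfolding e m11_def m22_def add_divide_distrib[symmetric] by (simp add: algebra_simps)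
  finally show ?thesis .
qed

text \<open>The product of \<open>h\<close> with the matrix m is dh / 2. In this form compatibility
  of the guessed connection with \<open>h\<close> is checked without dividing by det h.\<close>

lemma h_m:
  assumes w: "w \<in> U"
  shows "h11 w * m11 h e w + h12 w * m21 h e w = dder e h11 w / 2"
    "h11 w * m12 h e w + h12 w * m22 h e w = dder e h12 w / 2"
    "h12 w * m11 h e w + h22 w * m21 h e w = dder e h12 w / 2"
    "h12 w * m12 h e w + h22 w * m22 h e w = dder e h22 w / 2"
  unfolding m11_def m12_def m21_def m22_def
  by (rule divide_combination[OF h(3)[OF w]], subst D_eq[OF w], simp only: algebra_simps)+

text \<open>The first index is the upper one. With all indices in the base these are the symbols of
  a conformally flat metric with logarithmic factor \<open>L\<close>. An upper base index with two
  fibre indices gives -1/2 times the gradient of \<open>h\<close>, an upper fibre index with one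
  base and one fibre index gives h^-1 dh / 2, and the remaining blocks vanish.\<close>

definition block_christoffel :: "complex \<Rightarrow> real^4^4^4" where
  "block_christoffel w = vector [
    vector [vector [dder 1 L w, dder \<i> L w, 0, 0], vector [dder \<i> L w, - dder 1 L w, 0, 0],
      vector [0, 0, - (1/2) * (E w * dder 1 h11 w), - (1/2) * (E w * dder 1 h12 w)],
      vector [0, 0, - (1/2) * (E w * dder 1 h12 w), - (1/2) * (E w * dder 1 h22 w)]],
    vector [vector [- dder \<i> L w, dder 1 L w, 0, 0], vector [dder 1 L w, dder \<i> L w, 0, 0],
      vector [0, 0, - (1/2) * (E w * dder \<i> h11 w), - (1/2) * (E w * dder \<i> h12 w)],
      vector [0, 0, - (1/2) * (E w * dder \<i> h12 w), - (1/2) * (E w * dder \<i> h22 w)]],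
    vector [vector [0, 0, m11 h 1 w, m12 h 1 w], vector [0, 0, m11 h \<i> w, m12 h \<i> w],
      vector [m11 h 1 w, m11 h \<i> w, 0, 0], vector [m12 h 1 w, m12 h \<i> w, 0, 0]],
    vector [vector [0, 0, m21 h 1 w, m22 h 1 w], vector [0, 0, m21 h \<i> w, m22 h \<i> w],
      vector [m21 h 1 w, m21 h \<i> w, 0, 0], vector [m22 h 1 w, m22 h \<i> w, 0, 0]]]"

lemma metric_on_block: "metric_on (plane -` U) (block_metric \<Omega> h)"
proof -
  have o: "open (plane -` U)"
    using linear_continuous_on[OF bounded_linear_plane] U by (metis continuous_on_open_vimage open_UNIV inf_top.left_neutral inf_commute)
  have "\<forall>i j. smooth_on (plane -` U) (\<lambda>y. block_metric \<Omega> h y $ i $ j)"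
    using smooth_on_plane[OF U h_smooth] smooth_on_plane[OF U smooth_on_power[OF U \<Omega>(1)]]
    by (simp add: forall_4 vector_4 block_metric_def Let_def smooth_on_const)
  then have "smooth_on (plane -` U) (\<lambda>y. \<chi> i j. block_metric \<Omega> h y $ i $ j)"
    by (intro smooth_on_vec_lambda o) blast
  then have sm: "smooth_on (plane -` U) (block_metric \<Omega> h)" by simp
  have "invertible (block_metric \<Omega> h y)" if "plane y \<in> U" for y
  proof -
    let ?w = "plane y"
    \<comment> \<open>The blockwise inverse shows nondegeneracy without expanding a 4 x 4
      determinant.\<close>
    define B :: "real^4^4" where "B = vector [vector [inverse ((\<Omega> ?w)\<^sup>2), 0, 0, 0], vector [0, inverse ((\<Omega> ?w)\<^sup>2), 0, 0],
       vector [0, 0, h22 ?w / D ?w, - h12 ?w / D ?w], vector [0, 0, - h12 ?w / D ?w, h11 ?w / D ?w]]"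
    have "\<forall>i j. (block_metric \<Omega> h y ** B) $ i $ j = mat 1 $ i $ j"
      using \<Omega>(2)[OF that] h(2,3)[OF that] D_eq[OF that]
      by (simp add: forall_4 vector_4 matrix_matrix_mult_def sum_4 block_metric_def Let_def B_def mat_def field_simps)
    then have "block_metric \<Omega> h y ** B = mat 1" by (simp add: vec_eq_iff)
    then show ?thesis by (simp add: invertible_right_inverse) blast
  qed
  moreover have "\<forall>i j. block_metric \<Omega> h y $ i $ j = block_metric \<Omega> h y $ j $ i" if "plane y \<in> U" for y
    using h(2)[OF that] by (simp add: forall_4 vector_4 block_metric_def Let_def)
  ultimately show ?thesis
    using o sm by (auto simp: metric_on_def invertible_det_nz)
qed

text \<open>The table is verified rather than derived: it is symmetric in the lower indices and
  satisfies the compatibility equations, so \<open>christoffel_unique\<close> applies.\<close>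

lemma christoffel_block:
  assumes "plane y \<in> U"
  shows "christoffel (block_metric \<Omega> h) l i j y = block_christoffel (plane y) $ l $ i $ j"
proof (rule christoffel_unique[OF metric_on_block])
  show "y \<in> plane -` U" using assms by simp
  show "block_christoffel (plane y) $ l $ i $ j = block_christoffel (plane y) $ l $ j $ i" for l i j
  proof -
    have "\<forall>l i j. block_christoffel (plane y) $ l $ i $ j = block_christoffel (plane y) $ l $ j $ i"
      by (simp add: forall_4 vector_4 block_christoffel_def)
    then show ?thesis by blast
  qed
  let ?w = "plane y"
  have pdh: "pd k (\<lambda>y. h (plane y) $ i $ j) y = dder (plane (axis k 1)) (\<lambda>w. h w $ i $ j) ?w" for k i j
    by (rule pd_plane[OF smooth_on_differentiable[OF h_smooth assms]])
  have pdO: "pd k (\<lambda>y. (\<Omega> (plane y))\<^sup>2) y = dder (plane (axis k 1)) (\<lambda>w. (\<Omega> w)\<^sup>2) ?w" for k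
    by (rule pd_plane[OF smooth_on_differentiable[OF smooth_on_power[OF U \<Omega>(1)] assms]])
  have h21: "dder e (\<lambda>w. h w $ 2 $ 1) ?w = dder e h12 ?w" for e
    by (rule dder_cong_open[OF U assms h(2)])
  have pdc: "pd k (\<lambda>y. 0) y = 0" for k by (simp add: pd_eq_dder)
  have dd: "(\<lambda>w. h w $ i $ j) differentiable (at ?w)" "(\<lambda>w. (\<Omega> w)\<^sup>2) differentiable (at ?w)" for i j
    using smooth_on_differentiable[OF h_smooth assms] smooth_on_differentiable[OF smooth_on_power[OF U \<Omega>(1)] assms] by auto
  have dL: "L differentiable (at ?w)" by (rule smooth_on_differentiable[OF L_smooth assms])
  have OE: "(\<Omega> ?w)\<^sup>2 * (E ?w * x) = x" for x
    using \<Omega>(2)[OF assms] by (simp add: inv_conf_def)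
  have OE': "inv_conf \<Omega> ?w * (\<Omega> ?w)\<^sup>2 = 1"
    using \<Omega>(2)[OF assms] by (simp add: inv_conf_def)
  note hm = h_m[OF assms, of 1] h_m[OF assms, of \<i>]
  have "\<forall>k i j. pd k (\<lambda>u. block_metric \<Omega> h u $ i $ j) y =
          (\<Sum>l\<in>UNIV. block_metric \<Omega> h y $ l $ j * block_christoffel ?w $ l $ k $ i + block_metric \<Omega> h y $ i $ l * block_christoffel ?w $ l $ k $ j)"
    unfolding forall_4 sum_4 block_metric_def Let_def block_christoffel_def vector_4
    apply (simp add: pdh pdO pdc h21 dd dL h(2)[OF assms] dder_\<Omega>2[OF assms])
    apply (intro conjI; use hm in \<open>simp add: OE OE' algebra_simps\<close>)
    done
  then show "pd k (\<lambda>u. block_metric \<Omega> h u $ i $ j) y =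
          (\<Sum>l\<in>UNIV. block_metric \<Omega> h y $ l $ j * block_christoffel ?w $ l $ k $ i + block_metric \<Omega> h y $ i $ l * block_christoffel ?w $ l $ k $ j)" for k i j
    by blast
qed

lemma block_christoffel_smooth: "smooth_on U (\<lambda>w. block_christoffel w $ l $ i $ j)"
proof -
  have "\<forall>l i j. smooth_on U (\<lambda>w. block_christoffel w $ l $ i $ j)"
    unfolding block_christoffel_def forall_4 vector_4
    by (intro conjI smooth_on_dder smooth_on_uminus smooth_on_mult smooth_on_const U h_smooth L_smooth E_smooth m_smooth)
  then show ?thesis by blast
qed

text \<open>The symbols factor through \<open>plane\<close>, so a derivative in direction
  \<open>axis k 1\<close> becomes one in direction \<open>plane (axis k 1)\<close>, which is zero
  for the two fibre directions.\<close>

lemma ricci_block_expand: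
  assumes y: "plane y \<in> U"
  shows "ricci (block_metric \<Omega> h) i j y =
     (\<Sum>k\<in>UNIV. dder (plane (axis k 1)) (\<lambda>w. block_christoffel w $ k $ i $ j) (plane y)
        - dder (plane (axis j 1)) (\<lambda>w. block_christoffel w $ k $ i $ k) (plane y)) +
     (\<Sum>k\<in>UNIV. \<Sum>l\<in>UNIV. block_christoffel (plane y) $ k $ k $ l * block_christoffel (plane y) $ l $ i $ j
        - block_christoffel (plane y) $ k $ j $ l * block_christoffel (plane y) $ l $ i $ k)"
proof -
  have o: "open (plane -` U)"
    using metric_on_block by (simp add: metric_on_def)
  have "pd n (christoffel (block_metric \<Omega> h) l i j) y = dder (plane (axis n 1)) (\<lambda>w. block_christoffel w $ l $ i $ j) (plane y)" for n l i j
  proof -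
    have "pd n (christoffel (block_metric \<Omega> h) l i j) y = pd n (\<lambda>y. block_christoffel (plane y) $ l $ i $ j) y"
      unfolding pd_eq_dder
      by (rule dder_cong_open[OF o]) (use y christoffel_block in auto)
    also have "\<dots> = dder (plane (axis n 1)) (\<lambda>w. block_christoffel w $ l $ i $ j) (plane y)"
      by (rule pd_plane[OF smooth_on_differentiable[OF block_christoffel_smooth y]])
    finally show ?thesis .
  qed
  then show ?thesis
    unfolding ricci_def christoffel_block[OF y] by simp
qed

text \<open>The fibre equations \<open>e33\<close>, \<open>e34\<close>, \<open>e44\<close> are the
  Ricci components multiplied by -2 \<Omega>^2, which clears the factor \<open>E / 2\<close> of the
  symbols. The base equations \<open>e11\<close>, \<open>e22\<close>, \<open>e12\<close> are the
  components as they stand. The mixed components vanish identically.\<close>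

lemma einstein_block:
  fixes y :: "real^4" and lam :: real
  defines "w \<equiv> plane y"
  assumes y: "plane y \<in> U"
    and e33: "dder 1 (dder 1 h11) w + dder \<i> (dder \<i> h11) w + dder 1 N w * dder 1 h11 w + dder \<i> N w * dder \<i> h11 w
      - 2 * (dder 1 h11 w * m11 h 1 w + dder 1 h12 w * m21 h 1 w) - 2 * (dder \<i> h11 w * m11 h \<i> w + dder \<i> h12 w * m21 h \<i> w)
      = - 2 * lam * (\<Omega> w)\<^sup>2 * h11 w"
    and e34: "dder 1 (dder 1 h12) w + dder \<i> (dder \<i> h12) w + dder 1 N w * dder 1 h12 w + dder \<i> N w * dder \<i> h12 w
      - 2 * (dder 1 h11 w * m12 h 1 w + dder 1 h12 w * m22 h 1 w) - 2 * (dder \<i> h11 w * m12 h \<i> w + dder \<i> h12 w * m22 h \<i> w)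
      = - 2 * lam * (\<Omega> w)\<^sup>2 * h12 w"
    and e44: "dder 1 (dder 1 h22) w + dder \<i> (dder \<i> h22) w + dder 1 N w * dder 1 h22 w + dder \<i> N w * dder \<i> h22 w
      - 2 * (dder 1 h12 w * m12 h 1 w + dder 1 h22 w * m22 h 1 w) - 2 * (dder \<i> h12 w * m12 h \<i> w + dder \<i> h22 w * m22 h \<i> w)
      = - 2 * lam * (\<Omega> w)\<^sup>2 * h22 w"
    and e11: "- (dder 1 (dder 1 L) w + dder \<i> (dder \<i> L) w) - dder 1 (dder 1 N) w + dder 1 N w * dder 1 L w - dder \<i> N w * dder \<i> L w
      - ((m11 h 1 w)\<^sup>2 + 2 * m12 h 1 w * m21 h 1 w + (m22 h 1 w)\<^sup>2) = lam * (\<Omega> w)\<^sup>2"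
    and e22: "- (dder 1 (dder 1 L) w + dder \<i> (dder \<i> L) w) - dder \<i> (dder \<i> N) w - dder 1 N w * dder 1 L w + dder \<i> N w * dder \<i> L w
      - ((m11 h \<i> w)\<^sup>2 + 2 * m12 h \<i> w * m21 h \<i> w + (m22 h \<i> w)\<^sup>2) = lam * (\<Omega> w)\<^sup>2"
    and e12: "- dder 1 (dder \<i> N) w + dder 1 N w * dder \<i> L w + dder \<i> N w * dder 1 L w
      - (m11 h 1 w * m11 h \<i> w + m12 h 1 w * m21 h \<i> w + m21 h 1 w * m12 h \<i> w + m22 h 1 w * m22 h \<i> w) = 0"
  shows "ricci (block_metric \<Omega> h) i j y = lam * block_metric \<Omega> h y $ i $ j"
proof -
  have w: "w \<in> U" using y by (simp add: w_def)
  note df = smooth_on_differentiable[OF _ w]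
  have d: "dder e L differentiable (at w)" "dder e h11 differentiable (at w)" "dder e h12 differentiable (at w)"
    "dder e h22 differentiable (at w)" "m11 h e differentiable (at w)" "m12 h e differentiable (at w)"
    "m21 h e differentiable (at w)" "m22 h e differentiable (at w)" "E differentiable (at w)" for e
    by (intro df smooth_on_dder h_smooth L_smooth E_smooth m_smooth)+
  have dEf: "dder e (\<lambda>w. - (1/2) * (E w * f w)) w = - (1/2) * (E w * dder e f w - 2 * E w * dder e L w * f w)"
    if "f differentiable (at w)" for e and f :: "complex \<Rightarrow> real"
  proof -
    have "dder e (\<lambda>w. - (1/2) * (E w * f w)) w = - (1/2) * dder e (\<lambda>w. E w * f w) w"
      by (rule dder_linear_compose[OF bounded_linear_mult_right]) (use d(9) that in simp)
    then show ?thesis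
      using dder_mult[OF d(9) that, of e] by (simp only: dder_E[OF w]) (simp add: algebra_simps)
  qed
  \<comment> \<open>In the Ricci tensor the matrix m is differentiated only through its trace
    \<open>dder e' N\<close>. Eliminating \<open>m22\<close> makes the derivatives of
    \<open>m11\<close> cancel.\<close>
  have dm: "dder e (m22 h e') w = dder e (dder e' N) w - dder e (m11 h e') w" for e e'
  proof -
    have "dder e (dder e' N) w = dder e (\<lambda>w. m11 h e' w + m22 h e' w) w"
      by (rule dder_cong_open[OF U w dder_N])
    then show ?thesis by (simp add: dder_add d)
  qed
  note N = dder_N[OF w]
  have cL: "dder \<i> (dder 1 L) w = dder 1 (dder \<i> L) w" by (rule dder_commute[OF U L_smooth w])
  have cN: "dder \<i> (dder 1 N) w = dder 1 (dder \<i> N) w" by (rule dder_commute[OF U N_smooth w])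
  have dneg: "dder e (\<lambda>w. - dder e' L w) w = - dder e (dder e' L) w" for e e'
    by (rule dder_uminus[OF d(1)])
  have E\<Omega>: "E w * (\<Omega> w)\<^sup>2 = 1" using \<Omega>(2)[OF w] by (simp add: inv_conf_def)
  \<comment> \<open>The two sides are the off-diagonal entries of the symmetric matrix dh h^-1 dh /
    2, obtained here from m^T h m. They are needed because the components 34 and 43 come out in
    different forms.\<close>
  have sym: "dder e h11 w * m12 h e w + dder e h12 w * m22 h e w = dder e h12 w * m11 h e w + dder e h22 w * m21 h e w" for e
  proof -
    have "(h11 w * m11 h e w + h12 w * m21 h e w) * m12 h e w + (h12 w * m11 h e w + h22 w * m21 h e w) * m22 h e w
      = (h11 w * m12 h e w + h12 w * m22 h e w) * m11 h e w + (h12 w * m12 h e w + h22 w * m22 h e w) * m21 h e w"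
      by (simp add: algebra_simps)
    then show ?thesis unfolding h_m[OF w] by (simp add: field_simps)
  qed
  have symE: "E w * (dder e h11 w * m12 h e w) + E w * (dder e h12 w * m22 h e w) = E w * (dder e h12 w * m11 h e w) + E w * (dder e h22 w * m21 h e w)" for e
    using arg_cong[OF sym[of e], of "\<lambda>x. E w * x"] by (simp only: distrib_left)
  note R = ricci_block_expand[OF y, folded w_def]
  note S = R sum_4 block_christoffel_def vector_4 plane_axis dEf[OF d(2)] dEf[OF d(3)] dEf[OF d(4)]
  note simps = d dneg cL
  have scale: "- (1/2) * E w * (- 2 * lam * (\<Omega> w)\<^sup>2 * x) = lam * x" for x
    using E\<Omega> by (simp add: algebra_simps)
  have r11: "ricci (block_metric \<Omega> h) 1 1 y = lam * (\<Omega> w)\<^sup>2"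
    unfolding e11[symmetric] S
    by (simp add: simps dm cN N power2_eq_square algebra_simps)
  have r22: "ricci (block_metric \<Omega> h) 2 2 y = lam * (\<Omega> w)\<^sup>2"
    unfolding e22[symmetric] S
    by (simp add: simps dm cN N power2_eq_square algebra_simps)
  have r12: "ricci (block_metric \<Omega> h) 1 2 y = 0"
    by (rule trans[OF _ e12], unfold S) (simp add: simps dm cN N algebra_simps)
  have r21: "ricci (block_metric \<Omega> h) 2 1 y = 0"
    by (rule trans[OF _ e12], unfold S) (simp add: simps dm cN N algebra_simps)
  have r33: "ricci (block_metric \<Omega> h) 3 3 y = lam * h11 w"
    unfolding scale[symmetric] e33[symmetric] S
    by (simp add: simps dm cN N algebra_simps)
  have r34: "ricci (block_metric \<Omega> h) 3 4 y = lam * h12 w"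
    unfolding scale[symmetric] e34[symmetric] S using symE[of 1] symE[of \<i>]
    by (simp add: simps dm cN N algebra_simps)
  have r43: "ricci (block_metric \<Omega> h) 4 3 y = lam * h12 w"
    unfolding scale[symmetric] e34[symmetric] S using symE[of 1] symE[of \<i>]
    by (simp add: simps dm cN N algebra_simps)
  have r44: "ricci (block_metric \<Omega> h) 4 4 y = lam * h22 w"
    unfolding scale[symmetric] e44[symmetric] S
    by (simp add: simps dm cN N algebra_simps)
  have r0: "ricci (block_metric \<Omega> h) 1 3 y = 0" "ricci (block_metric \<Omega> h) 1 4 y = 0"
    "ricci (block_metric \<Omega> h) 2 3 y = 0" "ricci (block_metric \<Omega> h) 2 4 y = 0"
    "ricci (block_metric \<Omega> h) 3 1 y = 0" "ricci (block_metric \<Omega> h) 4 1 y = 0"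
    "ricci (block_metric \<Omega> h) 3 2 y = 0" "ricci (block_metric \<Omega> h) 4 2 y = 0"
    unfolding S by (simp_all add: simps)
  have "\<forall>i j. ricci (block_metric \<Omega> h) i j y = lam * block_metric \<Omega> h y $ i $ j"
    unfolding forall_4 by (simp add: r11 r22 r12 r21 r33 r34 r43 r44 r0 block_metric_def Let_def vector_4 w_def h(2)[OF y])
  then show ?thesis by blast
qed

end

section \<open>The reduced equations\<close>

lemma dz_dder: "dz f w = (dder 1 f w - \<i> * dder \<i> f w) / 2"
  and dzbar_dder: "dzbar f w = (dder 1 f w + \<i> * dder \<i> f w) / 2"
  by (simp_all add: dz_def dzbar_def dder_def)

lemma dz_cong_open:
  assumes "open S" "w \<in> S" "\<And>y. y \<in> S \<Longrightarrow> f y = g y"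
  shows "dz f w = dz g w" "dzbar f w = dzbar g w"
  unfolding dz_dder dzbar_dder
  by (simp_all only: dder_cong_open[OF assms, where v=1] dder_cong_open[OF assms, where v=\<i>])

lemma dz_add:
  assumes "f differentiable (at w)" "g differentiable (at w)"
  shows "dz (\<lambda>w. f w + g w) w = dz f w + dz g w" "dzbar (\<lambda>w. f w + g w) w = dzbar f w + dzbar g w"
  using assms by (simp_all add: dz_dder dzbar_dder dder_add field_simps)

lemma dz_diff:
  assumes "f differentiable (at w)" "g differentiable (at w)"
  shows "dz (\<lambda>w. f w - g w) w = dz f w - dz g w" "dzbar (\<lambda>w. f w - g w) w = dzbar f w - dzbar g w"
  using assms by (simp_all add: dz_dder dzbar_dder dder_diff field_simps)

lemma dz_mult:
  assumes "f differentiable (at w)" "g differentiable (at w)"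
  shows "dz (\<lambda>w. f w * g w) w = dz f w * g w + f w * dz g w"
    "dzbar (\<lambda>w. f w * g w) w = dzbar f w * g w + f w * dzbar g w"
  using assms by (simp_all add: dz_dder dzbar_dder dder_mult field_simps)

lemma dz_divide:
  assumes "f differentiable (at w)" "g differentiable (at w)" "g w \<noteq> 0"
  shows "dz (\<lambda>w. f w / g w) w = (dz f w * g w - f w * dz g w) / (g w)\<^sup>2"
    "dzbar (\<lambda>w. f w / g w) w = (dzbar f w * g w - f w * dzbar g w) / (g w)\<^sup>2"
  using assms by (simp_all add: dz_dder dzbar_dder dder_divide field_simps)

lemma dz_const [simp]: "dz (\<lambda>w. c) w = 0" "dzbar (\<lambda>w. c) w = 0"
  by (simp_all add: dz_dder dzbar_dder)

lemma smooth_on_dz: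
  assumes "open S" "smooth_on S f"
  shows "smooth_on S (dz f)" "smooth_on S (dzbar f)"
  unfolding dz_dder[abs_def] dzbar_dder[abs_def] divide_inverse
  by (intro smooth_on_mult smooth_on_diff smooth_on_add smooth_on_const smooth_on_dder assms)+

lemma dz_dzbar_commute:
  assumes "open S" "smooth_on S f" "w \<in> S"
  shows "dzbar (dz f) w = dz (dzbar f) w"
proof -
  have d: "dder e f differentiable (at w)" for e
    by (rule smooth_on_differentiable[OF smooth_on_dder[OF assms(2)] assms(3)])
  have d2: "dder e (\<lambda>w. (dder 1 f w + c * dder \<i> f w) / 2) w = (dder e (dder 1 f) w + c * dder e (dder \<i> f) w) / 2" for c e
    using dder_linear_compose[OF bounded_linear_divide, of "\<lambda>w. dder 1 f w + c * dder \<i> f w" w e 2] d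
    by (simp add: dder_add dder_mult)
  have 1: "dz f = (\<lambda>w. (dder 1 f w + (- \<i>) * dder \<i> f w) / 2)" "dzbar f = (\<lambda>w. (dder 1 f w + \<i> * dder \<i> f w) / 2)"
    by (simp_all add: dz_dder dzbar_dder fun_eq_iff)
  show ?thesis
    unfolding dz_dder[of "dzbar f"] dzbar_dder[of "dz f"]
    unfolding 1 d2 dder_commute[OF assms, of \<i> 1]
    by (simp add: field_simps)
qed

text \<open>When \<open>dzbar f w\<close> vanishes the derivative is multiplication by
  \<open>dz f w\<close>. This is how holomorphy is obtained from the Wirtinger equation.\<close>

lemma has_derivative_dz:
  assumes "f differentiable (at w)"
  shows "(f has_derivative (\<lambda>v. dz f w * v + dzbar f w * cnj v)) (at w)"
proof -
  have "dder v f w = dz f w * v + dzbar f w * cnj v" for v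
    by (subst linear_complex_expand[OF linear_dder[OF assms]])
      (simp add: dz_dder dzbar_dder complex_eq_iff field_simps)
  then show ?thesis using has_derivative_dder[OF assms] by simp
qed

text \<open>Cayley-Hamilton for the traceless matrices \<open>K\<^sup>-\<^sup>1 dK\<close>, in polarised form.\<close>

lemma trace_log_derivatives:
  fixes k11 :: "'a::field"
  assumes "k11 * k22 - k12 * k12 = 1" "k11 * c + k22 * a = 2 * k12 * b" "k11 * c' + k22 * a' = 2 * k12 * b'"
  shows "(k22 * a - k12 * b) * (k22 * a' - k12 * b') + (k22 * b - k12 * c) * (k11 * b' - k12 * a')
     + (k11 * b - k12 * a) * (k22 * b' - k12 * c') + (k11 * c - k12 * b) * (k11 * c' - k12 * b')
     = 2 * b * b' - a * c' - c * a'"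
  using assms by algebra

section \<open>The matrix K and its equation in entries\<close>

context block_data
begin

abbreviation (input) r where "r \<equiv> crho h"
abbreviation (input) l where "l \<equiv> clog \<Omega>"
abbreviation (input) k11 where "k11 \<equiv> \<lambda>w. Kmat h w $ 1 $ 1"
abbreviation (input) k12 where "k12 \<equiv> \<lambda>w. Kmat h w $ 1 $ 2"
abbreviation (input) k22 where "k22 \<equiv> \<lambda>w. Kmat h w $ 2 $ 2"

lemma rho_pos: "w \<in> U \<Longrightarrow> rho h w > 0"
  using h(3) by (simp add: rho_def)

lemma rho_smooth: "smooth_on U (rho h)"
  unfolding rho_def[abs_def] by (intro smooth_on_sqrt U D_smooth h(3))

lemma r_smooth: "smooth_on U r"
  unfolding crho_def[abs_def] by (intro smooth_on_of_real U rho_smooth)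

lemma r_nz: "w \<in> U \<Longrightarrow> r w \<noteq> 0"
  using rho_pos by (force simp: crho_def)

lemma l_smooth: "smooth_on U l"
  unfolding clog_def[abs_def] by (intro smooth_on_of_real U L_smooth)

lemma k_smooth: "smooth_on U (\<lambda>w. Kmat h w $ i $ j)"
  unfolding Kmat_def using rho_pos
  by simp (intro smooth_on_of_real smooth_on_divide h_smooth rho_smooth U; force)

lemma k21: "w \<in> U \<Longrightarrow> Kmat h w $ 2 $ 1 = k12 w"
  by (simp add: Kmat_def h(2))

lemma k_det: "w \<in> U \<Longrightarrow> k11 w * k22 w - k12 w * k12 w = 1"
proof -
  assume w: "w \<in> U"
  have "rho h w * rho h w = D w" using h(3)[OF w] by (simp add: rho_def)
  then have "h11 w / rho h w * (h22 w / rho h w) - h12 w / rho h w * (h12 w / rho h w) = D w / D w"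
    by (simp only: D_eq[OF w] diff_divide_distrib[symmetric] times_divide_times_eq)
  also have "\<dots> = 1" using h(3)[OF w] by simp
  finally have "h11 w / rho h w * (h22 w / rho h w) - h12 w / rho h w * (h12 w / rho h w) = 1" .
  from arg_cong[OF this, of complex_of_real] show ?thesis
    unfolding Kmat_def vec_lambda_beta of_real_mult of_real_diff of_real_1 .
qed

lemma K_inv:
  assumes w: "w \<in> U"
  shows "matrix_inv (Kmat h w) $ 1 $ 1 = k22 w" "matrix_inv (Kmat h w) $ 1 $ 2 = - k12 w"
    "matrix_inv (Kmat h w) $ 2 $ 1 = - k12 w" "matrix_inv (Kmat h w) $ 2 $ 2 = k11 w"
proof -
  define B :: "complex^2^2" where "B = vector [vector [k22 w, - k12 w], vector [- k12 w, k11 w]]"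
  have 1: "Kmat h w ** B = mat 1" "B ** Kmat h w = mat 1"
    using k_det[OF w] k21[OF w]
    by (simp_all add: vec_eq_iff forall_2 matrix_matrix_mult_def sum_2 B_def mat_def mult.commute)
  then have "invertible (Kmat h w)" unfolding invertible_def by blast
  from matrix_inv_mult(2)[OF this] 1 have "matrix_inv (Kmat h w) = B"
    by (metis matrix_mul_assoc matrix_mul_lid matrix_mul_rid)
  then show "matrix_inv (Kmat h w) $ 1 $ 1 = k22 w" "matrix_inv (Kmat h w) $ 1 $ 2 = - k12 w"
    "matrix_inv (Kmat h w) $ 2 $ 1 = - k12 w" "matrix_inv (Kmat h w) $ 2 $ 2 = k11 w"
    by (simp_all add: B_def)
qed

lemma dz_k21:
  assumes w: "w \<in> U"
  shows "dz (\<lambda>w. Kmat h w $ 2 $ 1) w = dz k12 w" "dzbar (\<lambda>w. Kmat h w $ 2 $ 1) w = dzbar k12 w"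
  using dz_cong_open[OF U w k21] by auto

lemma J_entries:
  assumes w: "w \<in> U"
  shows "Jz h w $ 1 $ 1 = k22 w * dz k11 w - k12 w * dz k12 w" "Jz h w $ 1 $ 2 = k22 w * dz k12 w - k12 w * dz k22 w"
    "Jz h w $ 2 $ 1 = k11 w * dz k12 w - k12 w * dz k11 w" "Jz h w $ 2 $ 2 = k11 w * dz k22 w - k12 w * dz k12 w"
    "Jzbar h w $ 1 $ 1 = k22 w * dzbar k11 w - k12 w * dzbar k12 w" "Jzbar h w $ 1 $ 2 = k22 w * dzbar k12 w - k12 w * dzbar k22 w"
    "Jzbar h w $ 2 $ 1 = k11 w * dzbar k12 w - k12 w * dzbar k11 w" "Jzbar h w $ 2 $ 2 = k11 w * dzbar k22 w - k12 w * dzbar k12 w"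
  by (simp_all add: Jz_def Jzbar_def matrix_matrix_mult_def sum_2 K_inv[OF w] mdz_def mdzbar_def dz_k21[OF w])

text \<open>Differentiating det K = 1 gives the tracelessness of K^-1 dK, the hypothesis of
  \<open>trace_log_derivatives\<close>.\<close>

lemma k_det_dz:
  assumes w: "w \<in> U"
  shows "k11 w * dz k22 w + k22 w * dz k11 w = 2 * k12 w * dz k12 w"
    "k11 w * dzbar k22 w + k22 w * dzbar k11 w = 2 * k12 w * dzbar k12 w"
proof -
  note d = smooth_on_differentiable[OF k_smooth w]
  have "dz (\<lambda>w. k11 w * k22 w - k12 w * k12 w) w = dz (\<lambda>w. 1) w"
    "dzbar (\<lambda>w. k11 w * k22 w - k12 w * k12 w) w = dzbar (\<lambda>w. 1) w"
    using dz_cong_open[OF U w k_det] by auto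
  then show "k11 w * dz k22 w + k22 w * dz k11 w = 2 * k12 w * dz k12 w"
    "k11 w * dzbar k22 w + k22 w * dzbar k11 w = 2 * k12 w * dzbar k12 w"
    by (simp_all add: dz_diff dz_mult d algebra_simps)
qed

text \<open>A traceless 2 x 2 matrix J satisfies J^2 = - det J, and det (K^-1 dK) = det dK because
  det K = 1. The first trace is thus -2 det dK, and the second is its polarisation; no inverse of K
  is left.\<close>

lemma trace_J:
  assumes w: "w \<in> U"
  shows "trace (Jz h w ** Jz h w) = 2 * (dz k12 w * dz k12 w - dz k11 w * dz k22 w)"
    "trace (Jz h w ** Jzbar h w) = 2 * dz k12 w * dzbar k12 w - dz k11 w * dzbar k22 w - dz k22 w * dzbar k11 w"
  using trace_log_derivatives[OF k_det[OF w] k_det_dz(1)[OF w] k_det_dz(1)[OF w]]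
    trace_log_derivatives[OF k_det[OF w] k_det_dz(1)[OF w] k_det_dz(2)[OF w]]
  by (simp_all add: trace_def sum_2 matrix_matrix_mult_def J_entries[OF w] algebra_simps)

text \<open>\<open>K_equation\<close> multiplied by \<open>K\<close>.\<close>

lemma K_equation_entries:
  assumes w: "w \<in> U" and "K_equation h w"
  defines "\<tau> \<equiv> trace (Jz h w ** Jzbar h w)"
  shows "dz r w * dzbar k11 w + dzbar r w * dz k11 w + 2 * r w * dz (dzbar k11) w = r w * \<tau> * k11 w"
    "dz r w * dzbar k12 w + dzbar r w * dz k12 w + 2 * r w * dz (dzbar k12) w = r w * \<tau> * k12 w"
    "dz r w * dzbar k22 w + dzbar r w * dz k22 w + 2 * r w * dz (dzbar k22) w = r w * \<tau> * k22 w"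
proof -
  note df = smooth_on_differentiable[OF _ w]
  have d: "(\<lambda>w. Kmat h w $ i $ j) differentiable (at w)" "dz (\<lambda>w. Kmat h w $ i $ j) differentiable (at w)"
    "dzbar (\<lambda>w. Kmat h w $ i $ j) differentiable (at w)" "r differentiable (at w)" for i j
    by (intro df smooth_on_dz k_smooth r_smooth U)+
  have scale: "rho h w *\<^sub>R c = r w * c" for w c
    by (simp add: crho_def scaleR_conv_of_real)
  have E0: "dz (\<lambda>\<zeta>. r \<zeta> * Jzbar h \<zeta> $ i $ j) w + dzbar (\<lambda>\<zeta>. r \<zeta> * Jz h \<zeta> $ i $ j) w = 0" for i j
    using assms(2) unfolding K_equation_def mdz_def mdzbar_def
    by (simp add: vec_eq_iff scale)
  have *: "dz (\<lambda>\<zeta>. r \<zeta> * f \<zeta>) w + dzbar (\<lambda>\<zeta>. r \<zeta> * g \<zeta>) w = 0"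
    if "\<And>\<zeta>. \<zeta> \<in> U \<Longrightarrow> Jzbar h \<zeta> $ i $ j = f \<zeta>" "\<And>\<zeta>. \<zeta> \<in> U \<Longrightarrow> Jz h \<zeta> $ i $ j = g \<zeta>" for i j f g
    using dz_cong_open(1)[OF U w, of "\<lambda>\<zeta>. r \<zeta> * Jzbar h \<zeta> $ i $ j" "\<lambda>\<zeta>. r \<zeta> * f \<zeta>"]
      dz_cong_open(2)[OF U w, of "\<lambda>\<zeta>. r \<zeta> * Jz h \<zeta> $ i $ j" "\<lambda>\<zeta>. r \<zeta> * g \<zeta>"] that E0[of i j] by simp
  note c = dz_dzbar_commute[OF U k_smooth w]
  note e = *[of 1 1, OF J_entries(5,1)] *[of 1 2, OF J_entries(6,2)] *[of 2 1, OF J_entries(7,3)] *[of 2 2, OF J_entries(8,4)]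
  let ?X11 = "dz r w * dzbar k11 w + dzbar r w * dz k11 w + 2 * r w * dz (dzbar k11) w"
  let ?X12 = "dz r w * dzbar k12 w + dzbar r w * dz k12 w + 2 * r w * dz (dzbar k12) w"
  let ?X22 = "dz r w * dzbar k22 w + dzbar r w * dz k22 w + 2 * r w * dz (dzbar k22) w"
  \<comment> \<open>These are the entries of K^-1 X = r \<tau> 1. Differentiating K^-1 produces the
    anticommutator of \<open>Jz\<close> and \<open>Jzbar\<close>, which for traceless 2 x 2 matrices
    is the trace of their product times the identity.\<close>
  have E: "k22 w * ?X11 - k12 w * ?X12 = r w * \<tau>" "k22 w * ?X12 - k12 w * ?X22 = 0"
    "k11 w * ?X12 - k12 w * ?X11 = 0" "k11 w * ?X22 - k12 w * ?X12 = r w * \<tau>"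
    using e unfolding \<tau>_def trace_J[OF w]
    by (simp_all add: dz_mult dz_diff d c) (algebra+)
  show "?X11 = r w * \<tau> * k11 w" "?X12 = r w * \<tau> * k12 w" "?X22 = r w * \<tau> * k22 w"
    using E k_det[OF w] by algebra+
qed

end

text \<open>The dictionary between Wirtinger derivatives of a real function and its real gradient
  and Hessian. It splits the complex remaining equation into the two real equations that the base
  components of the Ricci tensor require.\<close>

lemma dz_of_real:
  assumes "open U" "smooth_on U f" "w \<in> U"
  shows "dz (\<lambda>w. complex_of_real (f w)) w = Complex (dder 1 f w / 2) (- dder \<i> f w / 2)"
    "dzbar (\<lambda>w. complex_of_real (f w)) w = Complex (dder 1 f w / 2) (dder \<i> f w / 2)"
    "dz (dzbar (\<lambda>w. complex_of_real (f w))) w = complex_of_real ((dder 1 (dder 1 f) w + dder \<i> (dder \<i> f) w) / 4)"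
    "dz (dz (\<lambda>w. complex_of_real (f w))) w
      = Complex ((dder 1 (dder 1 f) w - dder \<i> (dder \<i> f) w) / 4) (- dder 1 (dder \<i> f) w / 2)"
proof -
  have D: "dder e (\<lambda>w. complex_of_real (f w)) w = complex_of_real (dder e f w)" if "smooth_on U f" "w \<in> U" for f e w
    by (rule dder_linear_compose[OF bounded_linear_of_real smooth_on_differentiable[OF that]])
  have 1: "dz (\<lambda>w. complex_of_real (f w)) w = (1/2) * complex_of_real (dder 1 f w) - (\<i>/2) * complex_of_real (dder \<i> f w)"
    "dzbar (\<lambda>w. complex_of_real (f w)) w = (1/2) * complex_of_real (dder 1 f w) + (\<i>/2) * complex_of_real (dder \<i> f w)"
    if "smooth_on U f" "w \<in> U" for f w
    by (simp_all add: dz_dder dzbar_dder D[OF that] field_simps)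
  show "dz (\<lambda>w. complex_of_real (f w)) w = Complex (dder 1 f w / 2) (- dder \<i> f w / 2)"
    "dzbar (\<lambda>w. complex_of_real (f w)) w = Complex (dder 1 f w / 2) (dder \<i> f w / 2)"
    using 1[OF assms(2,3)] by (simp_all add: complex_eq_iff)
  have d: "(\<lambda>w. complex_of_real (dder e f w)) differentiable (at w)" for e
    by (rule smooth_on_differentiable[OF smooth_on_of_real[OF assms(1) smooth_on_dder[OF assms(2)]] assms(3)])
  note c = dder_commute[OF assms, of \<i> 1]
  have "dz (dzbar (\<lambda>w. complex_of_real (f w))) w =
     dz (\<lambda>w. (1/2) * complex_of_real (dder 1 f w) + (\<i>/2) * complex_of_real (dder \<i> f w)) w"
    by (rule dz_cong_open[OF assms(1,3)]) (simp add: 1 assms(2))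
  also have "\<dots> = (1/2) * dz (\<lambda>w. complex_of_real (dder 1 f w)) w + (\<i>/2) * dz (\<lambda>w. complex_of_real (dder \<i> f w)) w"
    by (simp only: dz_diff dz_add dz_mult dz_const differentiable_add differentiable_diff differentiable_mult differentiable_const d) simp
  finally show "dz (dzbar (\<lambda>w. complex_of_real (f w))) w = complex_of_real ((dder 1 (dder 1 f) w + dder \<i> (dder \<i> f) w) / 4)"
    using 1[OF smooth_on_dder[OF assms(2)] assms(3)] c by (simp add: complex_eq_iff)
  have "dz (dz (\<lambda>w. complex_of_real (f w))) w =
     dz (\<lambda>w. (1/2) * complex_of_real (dder 1 f w) - (\<i>/2) * complex_of_real (dder \<i> f w)) w"
    by (rule dz_cong_open[OF assms(1,3)]) (simp add: 1 assms(2))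
  also have "\<dots> = (1/2) * dz (\<lambda>w. complex_of_real (dder 1 f w)) w - (\<i>/2) * dz (\<lambda>w. complex_of_real (dder \<i> f w)) w"
    by (simp only: dz_diff dz_add dz_mult dz_const differentiable_add differentiable_diff differentiable_mult differentiable_const d) simp
  finally show "dz (dz (\<lambda>w. complex_of_real (f w))) w
      = Complex ((dder 1 (dder 1 f) w - dder \<i> (dder \<i> f) w) / 4) (- dder 1 (dder \<i> f) w / 2)"
    using 1[OF smooth_on_dder[OF assms(2)] assms(3)] c by (simp add: complex_eq_iff)
qed

section \<open>Holomorphy of \<rho> times the remaining expression\<close>

context block_data
begin

lemma remaining_eq:
  assumes w: "w \<in> U"
  shows "r w * remaining_lhs h \<Omega> w = 8 * (dz l w * dz r w) - 4 * dz (dz r) w + 2 * (dz r w * dz r w / r w)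
    - r w * (2 * (dz k12 w * dz k12 w - dz k11 w * dz k22 w))"
  unfolding remaining_lhs_def trace_J[OF w]
  using r_nz[OF w] by (simp add: field_simps power2_eq_square)

text \<open>All terms cancel in groups. The terms with \<open>lam\<close>, coming from
  \<open>rho_equation\<close> and its derivative, cancel among the summands with
  \<open>dz l\<close>, the third derivative of \<rho> and the quotient. The terms n^2 m from
  \<open>Omega_equation\<close> cancel against the quotient. The terms with \<tau> from
  \<open>Omega_equation\<close> cancel against the second derivatives of K, whose component along K
  drops out by the differentiated relation det K = 1.\<close>

lemma dzbar_remaining:
  assumes w: "w \<in> U"
    and rho: "\<And>w. w \<in> U \<Longrightarrow> rho_equation h \<Omega> lam w"
    and K: "K_equation h w" and Om: "Omega_equation h \<Omega> w"
  shows "dzbar (\<lambda>w. r w * remaining_lhs h \<Omega> w) w = 0"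
proof -
  note df = smooth_on_differentiable[OF _ w]
  define W where "W = (\<lambda>w. complex_of_real ((\<Omega> w)\<^sup>2))"
  have Wsm: "smooth_on U W"
    unfolding W_def by (intro smooth_on_of_real smooth_on_power U \<Omega>)
  have d: "(\<lambda>w. Kmat h w $ i $ j) differentiable (at w)" "dz (\<lambda>w. Kmat h w $ i $ j) differentiable (at w)"
    "r differentiable (at w)" "dz r differentiable (at w)" "dz (dz r) differentiable (at w)" "dz l differentiable (at w)"
    "W differentiable (at w)" for i j
    by (intro df smooth_on_dz k_smooth r_smooth l_smooth Wsm U)+
  have dW: "dz W w = 2 * W w * dz l w"
  proof -
    have O2: "smooth_on U (\<lambda>w. (\<Omega> w)\<^sup>2)" by (intro smooth_on_power U \<Omega>)
    show ?thesis
      unfolding W_def clog_def[abs_def] dz_of_real[OF U O2 w] dz_of_real[OF U L_smooth w]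
      by (simp add: dder_\<Omega>2[OF w] complex_eq_iff)
  qed
  define R where "R = r w"
  have R: "R \<noteq> 0" using r_nz[OF w] by (simp add: R_def)
  \<comment> \<open>Logarithmic derivatives of \<rho> remove all denominators, so that the final
    cancellation is a polynomial identity.\<close>
  define n m where "n = dz r w / R" and "m = dzbar r w / R"
  have n: "dz r w = n * R" and m: "dzbar r w = m * R" using R by (simp_all add: n_def m_def)
  define \<tau> where "\<tau> = trace (Jz h w ** Jzbar h w)"
  have rzb: "dzbar (dz r) w = - (1/2) * complex_of_real lam * r w * W w" if "w \<in> U" for w
    using rho[OF that] unfolding dz_dzbar_commute[OF U r_smooth that] rho_equation_def
    by (simp add: W_def crho_def)
  have rzzb: "dzbar (dz (dz r)) w = - (1/2) * complex_of_real lam * (n * R * W w + R * (2 * W w * dz l w))"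
  proof -
    have "dzbar (dz (dz r)) w = dz (dzbar (dz r)) w"
      by (rule dz_dzbar_commute[OF U smooth_on_dz(1)[OF U r_smooth] w])
    also have "\<dots> = dz (\<lambda>w. - (1/2) * complex_of_real lam * (r w * W w)) w"
      by (rule dz_cong_open[OF U w]) (simp add: rzb)
    also have "\<dots> = - (1/2) * complex_of_real lam * (n * R * W w + R * (2 * W w * dz l w))"
      using dz_mult(1)[of "\<lambda>_. - (1/2) * complex_of_real lam" w "\<lambda>w. r w * W w"] d
      by (simp add: dz_mult dW n R_def)
    finally show ?thesis .
  qed
  have lzb: "dzbar (dz l) w = 1/4 * (n * m) - 1/8 * \<tau>"
    using Om R unfolding dz_dzbar_commute[OF U l_smooth w] Omega_equation_def \<tau>_def[symmetric] R_def[symmetric] n m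
    by (simp add: power2_eq_square)
  have tau: "\<tau> = 2 * dz k12 w * dzbar k12 w - dz k11 w * dzbar k22 w - dz k22 w * dzbar k11 w"
    unfolding \<tau>_def trace_J[OF w] ..
  have cancel: "n * a + m * b + 2 * c = t" if "n * R * a + m * R * b + 2 * R * c = R * t" for a b c t
  proof -
    have "R * (n * a + m * b + 2 * c) = R * t" using that by (simp add: algebra_simps)
    then show ?thesis using R by simp
  qed
  have kzb: "n * dzbar k11 w + m * dz k11 w + 2 * dzbar (dz k11) w = \<tau> * k11 w"
    "n * dzbar k12 w + m * dz k12 w + 2 * dzbar (dz k12) w = \<tau> * k12 w"
    "n * dzbar k22 w + m * dz k22 w + 2 * dzbar (dz k22) w = \<tau> * k22 w"
    using K_equation_entries[OF w K] unfolding dz_dzbar_commute[OF U k_smooth w] \<tau>_def[symmetric] R_def[symmetric] n m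
    by (auto intro!: cancel simp: mult.assoc)
  have quo: "dzbar (\<lambda>w. dz r w * dz r w / r w) w = 2 * n * dzbar (dz r) w - n * n * m * R"
    using R by (simp add: dz_divide dz_mult d r_nz[OF w] n m R_def[symmetric] field_simps power2_eq_square)
  have q2: "(\<lambda>w. dz r w * dz r w / r w) differentiable (at w)"
    using d r_nz[OF w] by (intro differentiable_divide differentiable_mult)
  have "dzbar (\<lambda>w. r w * remaining_lhs h \<Omega> w) w = dzbar (\<lambda>w. 8 * (dz l w * dz r w) - 4 * dz (dz r) w + 2 * (dz r w * dz r w / r w)
    - r w * (2 * (dz k12 w * dz k12 w - dz k11 w * dz k22 w))) w"
    by (rule dz_cong_open[OF U w remaining_eq])
  also have "\<dots> = 8 * (dzbar (dz l) w * dz r w + dz l w * dzbar (dz r) w) - 4 * dzbar (dz (dz r)) w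
     + 2 * dzbar (\<lambda>w. dz r w * dz r w / r w) w - dzbar r w * (2 * (dz k12 w * dz k12 w - dz k11 w * dz k22 w))
     - r w * (2 * (2 * dz k12 w * dzbar (dz k12) w - dzbar (dz k11) w * dz k22 w - dz k11 w * dzbar (dz k22) w))"
    by (simp only: dz_diff dz_add dz_mult dz_const differentiable_add differentiable_diff differentiable_mult differentiable_const d q2) (simp add: algebra_simps)
  also have "\<dots> = 0"
    unfolding quo rzzb lzb rzb[OF w] n m R_def[symmetric]
    using kzb tau k_det_dz(1)[OF w] by algebra
  finally show ?thesis .
qed

lemma holomorphic_remaining:
  assumes "\<And>w. w \<in> U \<Longrightarrow> rho_equation h \<Omega> lam w" "\<And>w. w \<in> U \<Longrightarrow> K_equation h w"
    "\<And>w. w \<in> U \<Longrightarrow> Omega_equation h \<Omega> w"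
  shows "(\<lambda>w. r w * remaining_lhs h \<Omega> w) holomorphic_on U"
proof -
  let ?F = "\<lambda>w. r w * remaining_lhs h \<Omega> w"
  have "smooth_on U (\<lambda>w. 8 * (dz l w * dz r w) - 4 * dz (dz r) w + 2 * (dz r w * dz r w / r w)
    - r w * (2 * (dz k12 w * dz k12 w - dz k11 w * dz k22 w)))"
    using r_nz by (intro smooth_on_diff smooth_on_add smooth_on_mult smooth_on_divide smooth_on_const smooth_on_dz
        l_smooth r_smooth k_smooth U) auto
  then have sm: "smooth_on U ?F"
    by (rule smooth_on_cong[OF U, rotated]) (simp only: remaining_eq)
  have "(?F has_field_derivative dz ?F w) (at w)" if "w \<in> U" for w
    using has_derivative_dz[OF smooth_on_differentiable[OF sm that]] dzbar_remaining[OF that assms(1) assms(2)[OF that] assms(3)[OF that]]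
    by (simp add: has_field_derivative_def)
  then show ?thesis
    using U by (auto simp: holomorphic_on_open)
qed

end

text \<open>With h = \<rho> K the matrix h^-1 dh / 2 is (K^-1 dK + n) / 2, where n = d\<rho> /
  \<rho>. The left-hand side is the trace of the product of two such matrices; the cross terms
  vanish because K^-1 dK is traceless.\<close>

lemma quarter_trace_identity:
  fixes k11 :: real
  assumes "k11 * k22 - k12 * k12 = 1" "k11 * c + k22 * a = 2 * k12 * b" "k11 * c' + k22 * a' = 2 * k12 * b'"
  shows "(k22 * a - k12 * b + n) / 2 * ((k22 * a' - k12 * b' + n') / 2) + (k22 * b - k12 * c) / 2 * ((k11 * b' - k12 * a') / 2)
     + (k11 * b - k12 * a) / 2 * ((k22 * b' - k12 * c') / 2) + (k11 * c - k12 * b + n) / 2 * ((k11 * c' - k12 * b' + n') / 2)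
     = (2 * b * b' - a * c' - c * a') / 4 + n * n' / 2"
proof -
  have "(k22 * a - k12 * b + n) * (k22 * a' - k12 * b' + n') + (k22 * b - k12 * c) * (k11 * b' - k12 * a')
     + (k11 * b - k12 * a) * (k22 * b' - k12 * c') + (k11 * c - k12 * b + n) * (k11 * c' - k12 * b' + n')
     = 2 * b * b' - a * c' - c * a' + 2 * n * n'"
    using assms by algebra
  then show ?thesis by (simp add: field_simps)
qed

text \<open>The first diagonal entry of twice dh times m. For J = K^-1 dK the product is \<rho> K (J
  + n)^2, and Cayley-Hamilton replaces J^2 by the scalar b^2 - a c.\<close>

lemma contract_diagonal:
  fixes k11 :: real
  assumes "k11 * k22 - k12 * k12 = 1" "k11 * c + k22 * a = 2 * k12 * b"
  shows "2 * (\<rho> * (a + n * k11) * ((k22 * a - k12 * b + n) / 2) + \<rho> * (b + n * k12) * ((k11 * b - k12 * a) / 2))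
    = \<rho> * (2 * n * (a + n * k11) - (n\<^sup>2 + a * c - b\<^sup>2) * k11)"
proof -
  have "\<rho> * (a + n * k11) * (k22 * a - k12 * b + n) + \<rho> * (b + n * k12) * (k11 * b - k12 * a)
    = \<rho> * (2 * n * (a + n * k11) - (n\<^sup>2 + a * c - b\<^sup>2) * k11)"
    using assms by algebra
  moreover have "2 * (X * (Y / 2) + Z * (W / 2)) = X * Y + Z * W" for X Y Z W :: real
    by (simp add: field_simps)
  ultimately show ?thesis by simp
qed

lemma contract_off_diagonal:
  fixes k11 :: real
  assumes "k11 * k22 - k12 * k12 = 1" "k11 * c + k22 * a = 2 * k12 * b"
  shows "2 * (\<rho> * (a + n * k11) * ((k22 * b - k12 * c) / 2) + \<rho> * (b + n * k12) * ((k11 * c - k12 * b + n) / 2))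
    = \<rho> * (2 * n * (b + n * k12) - (n\<^sup>2 + a * c - b\<^sup>2) * k12)"
proof -
  have "\<rho> * (a + n * k11) * (k22 * b - k12 * c) + \<rho> * (b + n * k12) * (k11 * c - k12 * b + n)
    = \<rho> * (2 * n * (b + n * k12) - (n\<^sup>2 + a * c - b\<^sup>2) * k12)"
    using assms by algebra
  moreover have "2 * (X * (Y / 2) + Z * (W / 2)) = X * Y + Z * W" for X Y Z W :: real
    by (simp add: field_simps)
  ultimately show ?thesis by simp
qed

section \<open>From the four complex equations to the block Einstein equations\<close>

context block_data
begin

abbreviation (input) \<kappa> where "\<kappa> i j \<equiv> \<lambda>w. h w $ i $ j / rho h w"

lemma \<kappa>_smooth: "smooth_on U (\<kappa> i j)"
  using rho_pos by (intro smooth_on_divide h_smooth rho_smooth U) force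

lemma Kmat_\<kappa>: "(\<lambda>w. Kmat h w $ i $ j) = (\<lambda>w. complex_of_real (\<kappa> i j w))"
  by (simp add: Kmat_def fun_eq_iff)

lemma \<kappa>_det: "w \<in> U \<Longrightarrow> \<kappa> 1 1 w * \<kappa> 2 2 w - \<kappa> 1 2 w * \<kappa> 1 2 w = 1"
  using k_det[of w]
  unfolding Kmat_def vec_lambda_beta of_real_mult[symmetric] of_real_diff[symmetric] of_real_eq_1_iff .

lemma N_ln_rho: "w \<in> U \<Longrightarrow> N w = ln (rho h w)"
  using h(3)[of w] by (simp add: rho_def ln_sqrt)

text \<open>After the substitution h = \<rho> K the six real equations separate. The three fibre
  equations follow from the equations for \<rho> and K, the two diagonal base equations from those
  for \<rho> and \<Omega> together with the real part of the remaining equation, and the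
  off-diagonal base equation is its imaginary part.\<close>

lemma einstein_block_complex:
  fixes y :: "real^4"
  assumes y: "plane y \<in> U"
    and rho: "rho_equation h \<Omega> lam (plane y)" and K: "K_equation h (plane y)"
    and Om: "Omega_equation h \<Omega> (plane y)" and rem: "remaining_lhs h \<Omega> (plane y) = 0"
  shows "ricci (block_metric \<Omega> h) i j y = lam * block_metric \<Omega> h y $ i $ j"
proof -
  define w where "w = plane y"
  have w: "w \<in> U" using y by (simp add: w_def)
  note df = smooth_on_differentiable[OF _ w]
  define R where "R = rho h w"
  have R: "R > 0" using rho_pos[OF w] by (simp add: R_def)
  \<comment> \<open>Every derivative occurring below receives a real name, with derivatives of
    \<rho> measured relative to \<rho>. The geometric identities become real algebra in these
    quantities.\<close>
  define n where "n e = dder e (rho h) w / R" for e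
  define rr where "rr e = dder e (dder e (rho h)) w" for e
  define a where "a e = dder e (\<kappa> 1 1) w" for e
  define b where "b e = dder e (\<kappa> 1 2) w" for e
  define c where "c e = dder e (\<kappa> 2 2) w" for e
  define aa where "aa e = dder e (dder e (\<kappa> 1 1)) w" for e
  define bb where "bb e = dder e (dder e (\<kappa> 1 2)) w" for e
  define cc where "cc e = dder e (dder e (\<kappa> 2 2)) w" for e
  define x11 where "x11 = h w $ 1 $ 1 / R"
  define x12 where "x12 = h w $ 1 $ 2 / R"
  define x22 where "x22 = h w $ 2 $ 2 / R"
  define Le where "Le e = dder e L w" for e
  define LL where "LL e = dder e (dder e L) w" for e
  define rxy where "rxy = dder 1 (dder \<i> (rho h)) w"
  note defs = R_def[symmetric] rr_def[symmetric] a_def[symmetric] b_def[symmetric] c_def[symmetric]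
    aa_def[symmetric] bb_def[symmetric] cc_def[symmetric] x11_def[symmetric] x12_def[symmetric] x22_def[symmetric]
    Le_def[symmetric] LL_def[symmetric] rxy_def[symmetric]
  have re: "dder e (rho h) w = n e * R" for e using R by (simp add: n_def)
  have hk: "h w $ i $ j = rho h w * \<kappa> i j w" if "w \<in> U" for w i j
    using rho_pos[OF that] by simp
  have d1: "(\<kappa> i j) differentiable (at w)" "rho h differentiable (at w)" if "w \<in> U" for i j w
    using smooth_on_differentiable[OF \<kappa>_smooth that] smooth_on_differentiable[OF rho_smooth that] by auto
  have d2: "dder e (\<kappa> i j) differentiable (at w)" "dder e (rho h) differentiable (at w)" for i j e
    by (intro df smooth_on_dder \<kappa>_smooth rho_smooth)+
  have hd: "dder e (\<lambda>w. h w $ i $ j) w = rho h w * dder e (\<kappa> i j) w + dder e (rho h) w * \<kappa> i j w" if "w \<in> U" for e i j w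
  proof -
    have "dder e (\<lambda>w. h w $ i $ j) w = dder e (\<lambda>w. rho h w * \<kappa> i j w) w"
      by (rule dder_cong_open[OF U that hk])
    also have "\<dots> = rho h w * dder e (\<kappa> i j) w + dder e (rho h) w * \<kappa> i j w"
      by (rule dder_mult[OF d1(2)[OF that] d1(1)[OF that]])
    finally show ?thesis .
  qed
  have hdd: "dder e (dder e (\<lambda>w. h w $ i $ j)) w = R * dder e (dder e (\<kappa> i j)) w + 2 * (n e * R) * dder e (\<kappa> i j) w
      + rr e * \<kappa> i j w" for e i j
  proof -
    have "dder e (dder e (\<lambda>w. h w $ i $ j)) w = dder e (\<lambda>w. rho h w * dder e (\<kappa> i j) w + dder e (rho h) w * \<kappa> i j w) w"
      by (rule dder_cong_open[OF U w hd])
    also have "\<dots> = (rho h w * dder e (dder e (\<kappa> i j)) w + dder e (rho h) w * dder e (\<kappa> i j) w)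
       + (dder e (rho h) w * dder e (\<kappa> i j) w + dder e (dder e (rho h)) w * \<kappa> i j w)"
      by (simp only: dder_add dder_mult d1[OF w] d2 differentiable_mult)
    finally show ?thesis by (simp add: re rr_def R_def[symmetric])
  qed
  have det1: "x11 * x22 - x12 * x12 = 1"
    using \<kappa>_det[OF w] unfolding defs .
  have dK: "x11 * c e + x22 * a e = 2 * x12 * b e" for e
  proof -
    have "dder e (\<lambda>w. \<kappa> 1 1 w * \<kappa> 2 2 w - \<kappa> 1 2 w * \<kappa> 1 2 w) w = dder e (\<lambda>w. 1) w"
      by (rule dder_cong_open[OF U w \<kappa>_det])
    then have "\<kappa> 1 1 w * c e + a e * \<kappa> 2 2 w - (\<kappa> 1 2 w * b e + b e * \<kappa> 1 2 w) = 0"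
      unfolding a_def b_def c_def
      by (simp only: dder_diff dder_mult d1[OF w] differentiable_mult dder_const)
    then show ?thesis unfolding defs by (simp add: algebra_simps)
  qed
  have Dw: "D w = R * R"
    using h(3)[OF w] by (simp add: R_def rho_def)
  have H: "h w $ 1 $ 1 = R * x11" "h w $ 1 $ 2 = R * x12" "h w $ 2 $ 2 = R * x22"
    using R by (simp_all add: x11_def x12_def x22_def)
  have quo: "X / (2 * (R * R)) = Z / 2" if "X = R * R * Z" for X Z
    using that R by (simp add: field_simps)
  have m: "m11 h e w = (x22 * a e - x12 * b e + n e) / 2" "m12 h e w = (x22 * b e - x12 * c e) / 2"
    "m21 h e w = (x11 * b e - x12 * a e) / 2" "m22 h e w = (x11 * c e - x12 * b e + n e) / 2" for e
    unfolding m11_def m12_def m21_def m22_def hd[OF w] unfolding Dw re defs unfolding H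
    by (rule quo, (simp add: algebra_simps; fail | use det1 in algebra))+
  have Nd: "dder e N w = dder e (rho h) w / rho h w" if "w \<in> U" for e w
  proof -
    have "dder e N w = dder e (\<lambda>w. ln (rho h w)) w"
      by (rule dder_cong_open[OF U that N_ln_rho])
    also have "\<dots> = dder e (rho h) w / rho h w"
      using dder_eq[OF has_derivative_ln[OF rho_pos[OF that] has_derivative_dder[OF d1(2)[OF that]]]]
      by (simp add: divide_inverse)
    finally show ?thesis .
  qed
  have Ndd: "dder e (dder e' N) w = dder e (dder e' (rho h)) w / R - n e * n e'" for e e'
  proof -
    have "dder e (dder e' N) w = dder e (\<lambda>w. dder e' (rho h) w / rho h w) w"
      by (rule dder_cong_open[OF U w Nd])
    also have "\<dots> = (dder e (dder e' (rho h)) w * R - (n e' * R) * (n e * R)) / R\<^sup>2"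
      using R by (subst dder_divide) (simp_all add: d1[OF w] d2 re R_def)
    finally show ?thesis using R by (simp add: diff_divide_distrib power2_eq_square)
  qed
  have N1: "dder e N w = n e" for e using Nd[OF w] R by (simp add: n_def R_def)
  define \<tau> where "\<tau> = ((b 1)\<^sup>2 + (b \<i>)\<^sup>2 - a 1 * c 1 - a \<i> * c \<i>) / 2"
  have "(\<lambda>w. complex_of_real (rho h w)) = crho h" "(\<lambda>w. complex_of_real (ln (\<Omega> w))) = clog \<Omega>"
    by (simp_all add: crho_def clog_def fun_eq_iff)
  note cr = dz_of_real[OF U rho_smooth w, unfolded this(1)] and cl = dz_of_real[OF U L_smooth w, unfolded this(2)]
  note ck = dz_of_real[OF U \<kappa>_smooth w]
  have tau: "trace (Jz h w ** Jzbar h w) = complex_of_real \<tau>"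
    unfolding trace_J[OF w] Kmat_\<kappa> ck defs \<tau>_def
    by (simp add: complex_eq_iff power2_eq_square field_simps)
  have Rho: "rr 1 + rr \<i> = - 2 * lam * R * (\<Omega> w)\<^sup>2"
    using rho[folded w_def] unfolding rho_equation_def cr defs of_real_eq_iff by simp
  have halve: "X + Y = 2 * \<tau> * Z" if "R * (X / 2 + Y / 2) = R * (\<tau> * Z)" for X Y Z
    using that R by simp
  have cR: "crho h w = complex_of_real R" by (simp add: crho_def R_def)
  have Kw: "Kmat h w $ 1 $ 1 = complex_of_real x11" "Kmat h w $ 1 $ 2 = complex_of_real x12" "Kmat h w $ 2 $ 2 = complex_of_real x22"
    by (simp_all add: Kmat_def x11_def x12_def x22_def R_def)
  \<comment> \<open>Both sides are real: the first-order terms are a complex number plus its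
    conjugate, and the second-order term is a Laplacian. Real parts therefore lose nothing.\<close>
  note E = K_equation_entries[OF w K[folded w_def], unfolded tau Kw Kmat_\<kappa> cr ck cR, unfolded defs re, THEN arg_cong[where f=Re]]
  have Keq: "(n 1 * a 1 + n \<i> * a \<i>) + (aa 1 + aa \<i>) = 2 * \<tau> * x11"
    "(n 1 * b 1 + n \<i> * b \<i>) + (bb 1 + bb \<i>) = 2 * \<tau> * x12"
    "(n 1 * c 1 + n \<i> * c \<i>) + (cc 1 + cc \<i>) = 2 * \<tau> * x22"
    by (rule halve, use E(1) in \<open>simp add: field_simps\<close>, rule halve, use E(2) in \<open>simp add: field_simps\<close>,
          rule halve, use E(3) in \<open>simp add: field_simps\<close>)
  have Omr: "LL 1 + LL \<i> = ((n 1)\<^sup>2 + (n \<i>)\<^sup>2) / 4 - \<tau> / 2"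
  proof -
    have "complex_of_real ((LL 1 + LL \<i>) / 4) = 1/4 * (Complex (n 1 * R / 2) (- (n \<i> * R) / 2) * Complex (n 1 * R / 2) (n \<i> * R / 2) / (complex_of_real R)\<^sup>2) - 1/8 * complex_of_real \<tau>"
      using Om[folded w_def] unfolding Omega_equation_def tau cl cr cR re defs .
    also have "Complex (n 1 * R / 2) (- (n \<i> * R) / 2) * Complex (n 1 * R / 2) (n \<i> * R / 2) / (complex_of_real R)\<^sup>2
       = complex_of_real (((n 1)\<^sup>2 + (n \<i>)\<^sup>2) / 4)"
      using R by (simp add: complex_eq_iff field_simps power2_eq_square flip: of_real_mult)
    finally have "complex_of_real ((LL 1 + LL \<i>) / 4) = complex_of_real (1/4 * (((n 1)\<^sup>2 + (n \<i>)\<^sup>2) / 4) - 1/8 * \<tau>)"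
      by simp
    then show ?thesis unfolding of_real_eq_iff by simp
  qed
  have rem_re: "2 * (Le 1 * n 1 - Le \<i> * n \<i>) - (rr 1 - rr \<i>) / R + ((n 1)\<^sup>2 - (n \<i>)\<^sup>2) / 2
      - ((b 1)\<^sup>2 - (b \<i>)\<^sup>2 - a 1 * c 1 + a \<i> * c \<i>) / 2 = 0"
    and rem_im: "- 2 * (Le 1 * n \<i> + Le \<i> * n 1) + 2 * rxy / R - n 1 * n \<i>
      + (2 * b 1 * b \<i> - a 1 * c \<i> - c 1 * a \<i>) / 2 = 0"
  proof -
    have n2: "Complex (n 1 * R / 2) (- (n \<i> * R) / 2) = complex_of_real R * Complex (n 1 / 2) (- n \<i> / 2)"
      by (simp add: complex_eq_iff)
    have cR0: "complex_of_real R \<noteq> 0" using R by simp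
    have E1: "0 = 8 * (Complex (Le 1 / 2) (- Le \<i> / 2) * Complex (n 1 / 2) (- n \<i> / 2)) -
      4 * (Complex ((rr 1 - rr \<i>) / 4) (- rxy / 2) / complex_of_real R) +
      2 * (Complex (n 1 / 2) (- n \<i> / 2) * Complex (n 1 / 2) (- n \<i> / 2)) -
      2 * (Complex (b 1 / 2) (- b \<i> / 2) * Complex (b 1 / 2) (- b \<i> / 2) - Complex (a 1 / 2) (- a \<i> / 2) * Complex (c 1 / 2) (- c \<i> / 2))"
      using rem[folded w_def, symmetric] cR0
      unfolding remaining_lhs_def trace_J[OF w] Kmat_\<kappa> ck cl cr cR re defs n2
      by (simp add: power2_eq_square)
    have E2: "Complex ((rr 1 - rr \<i>) / 4) (- rxy / 2) / complex_of_real R = Complex ((rr 1 - rr \<i>) / R / 4) (- (rxy / R) / 2)"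
      by (simp add: complex_eq_iff)
    define X Y where "X = (rr 1 - rr \<i>) / R" and "Y = rxy / R"
    have E0: "0 = 8 * (Complex (Le 1 / 2) (- Le \<i> / 2) * Complex (n 1 / 2) (- n \<i> / 2)) -
      4 * Complex (X / 4) (- Y / 2) +
      2 * (Complex (n 1 / 2) (- n \<i> / 2) * Complex (n 1 / 2) (- n \<i> / 2)) -
      2 * (Complex (b 1 / 2) (- b \<i> / 2) * Complex (b 1 / 2) (- b \<i> / 2) - Complex (a 1 / 2) (- a \<i> / 2) * Complex (c 1 / 2) (- c \<i> / 2))"
      using E1 unfolding E2 X_def Y_def .
    note E = E0[THEN arg_cong[where f=Re]] E0[THEN arg_cong[where f=Im]]
    have Y: "2 * rxy / R = 2 * Y" by (simp add: Y_def)
    show "2 * (Le 1 * n 1 - Le \<i> * n \<i>) - (rr 1 - rr \<i>) / R + ((n 1)\<^sup>2 - (n \<i>)\<^sup>2) / 2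
      - ((b 1)\<^sup>2 - (b \<i>)\<^sup>2 - a 1 * c 1 + a \<i> * c \<i>) / 2 = 0"
      unfolding X_def[symmetric] using E(1) by (simp add: power2_eq_square field_simps)
    show "- 2 * (Le 1 * n \<i> + Le \<i> * n 1) + 2 * rxy / R - n 1 * n \<i>
      + (2 * b 1 * b \<i> - a 1 * c \<i> - c 1 * a \<i>) / 2 = 0"
      unfolding Y using E(2) by (simp add: power2_eq_square field_simps)
  qed
  have Rho': "rr 1 / R + rr \<i> / R = - 2 * lam * (\<Omega> w)\<^sup>2"
    using Rho R by (simp add: field_simps)
  have sq: "(m11 h e w)\<^sup>2 + 2 * m12 h e w * m21 h e w + (m22 h e w)\<^sup>2
      = ((b e)\<^sup>2 - a e * c e) / 2 + (n e)\<^sup>2 / 2" for e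
    using quarter_trace_identity[OF det1 dK[of e] dK[of e], of "n e" "n e"] unfolding m by (simp add: power2_eq_square field_simps)
  have cr12: "m11 h 1 w * m11 h \<i> w + m12 h 1 w * m21 h \<i> w + m21 h 1 w * m12 h \<i> w + m22 h 1 w * m22 h \<i> w
      = (2 * b 1 * b \<i> - a 1 * c \<i> - c 1 * a \<i>) / 4 + n 1 * n \<i> / 2"
    using quarter_trace_identity[OF det1 dK[of 1] dK[of \<i>], of "n 1" "n \<i>"] unfolding m .
  have P: "dder e (\<lambda>w. h w $ 1 $ 1) w = R * (a e + n e * x11)" "dder e (\<lambda>w. h w $ 1 $ 2) w = R * (b e + n e * x12)"
    "dder e (\<lambda>w. h w $ 2 $ 2) w = R * (c e + n e * x22)" for e
    unfolding hd[OF w] re defs by (simp_all add: algebra_simps)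
  have PP: "dder e (dder e (\<lambda>w. h w $ 1 $ 1)) w = R * (aa e + 2 * n e * a e) + rr e * x11"
    "dder e (dder e (\<lambda>w. h w $ 1 $ 2)) w = R * (bb e + 2 * n e * b e) + rr e * x12"
    "dder e (dder e (\<lambda>w. h w $ 2 $ 2)) w = R * (cc e + 2 * n e * c e) + rr e * x22" for e
    unfolding hdd defs by (simp_all add: algebra_simps)
  have dK': "x22 * a e + x11 * c e = 2 * x12 * b e" for e using dK by (simp add: add.commute)
  have det1': "x22 * x11 - x12 * x12 = 1" using det1 by (simp add: mult.commute)
  \<comment> \<open>One computation serves all three entries of K: \<open>x\<close> is the entry,
    \<open>k1\<close>, \<open>k2\<close> and \<open>kk1\<close>, \<open>kk2\<close> are its first
    and second derivatives. The premise removes the second derivatives, \<open>Rho\<close> those of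
    \<rho>, and the value of \<tau> absorbs the quadratic terms.\<close>
  have comb: "(R * (kk1 + 2 * n 1 * k1) + rr 1 * x) + (R * (kk2 + 2 * n \<i> * k2) + rr \<i> * x)
       + n 1 * (R * (k1 + n 1 * x)) + n \<i> * (R * (k2 + n \<i> * x))
       - R * (2 * n 1 * (k1 + n 1 * x) - ((n 1)\<^sup>2 + a 1 * c 1 - (b 1)\<^sup>2) * x)
       - R * (2 * n \<i> * (k2 + n \<i> * x) - ((n \<i>)\<^sup>2 + a \<i> * c \<i> - (b \<i>)\<^sup>2) * x) = - 2 * lam * (\<Omega> w)\<^sup>2 * (R * x)"
    if "n 1 * k1 + n \<i> * k2 + (kk1 + kk2) = 2 * \<tau> * x" for kk1 kk2 k1 k2 x
  proof -
    have "2 * \<tau> = (b 1)\<^sup>2 + (b \<i>)\<^sup>2 - a 1 * c 1 - a \<i> * c \<i>" by (simp add: \<tau>_def)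
    then show ?thesis using that Rho by algebra
  qed
  define X1 X2 where "X1 = rr 1 / R" and "X2 = rr \<i> / R"
  note X = X1_def[symmetric] X2_def[symmetric]
  note rem_re' = rem_re[unfolded diff_divide_distrib[of "rr 1"] X]
  show ?thesis
  proof (rule einstein_block[OF y, folded w_def], goal_cases)
    case 1
    show ?case unfolding P PP N1 m H contract_diagonal[OF det1 dK] by (rule comb[OF Keq(1)])
  next
    case 2
    show ?case unfolding P PP N1 m H contract_off_diagonal[OF det1 dK] by (rule comb[OF Keq(2)])
  next
    case 3
    \<comment> \<open>The entry 22 comes from the entry 11 by exchanging the two Killing
      fields.\<close>
    have c44: "2 * (R * (b e + n e * x12) * ((x22 * b e - x12 * c e) / 2) + R * (c e + n e * x22) * ((x11 * c e - x12 * b e + n e) / 2))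
      = R * (2 * n e * (c e + n e * x22) - ((n e)\<^sup>2 + a e * c e - (b e)\<^sup>2) * x22)" for e
      using contract_diagonal[OF det1' dK', of R e "n e"] by (simp add: algebra_simps)
    show ?case unfolding P PP N1 m H c44 by (rule comb[OF Keq(3)])
  next
    case 4
    show ?case
      unfolding sq Ndd N1 defs X using Rho'[unfolded X] Omr rem_re'
      by (simp add: \<tau>_def power2_eq_square field_simps)
  next
    case 5
    show ?case
      unfolding sq Ndd N1 defs X using Rho'[unfolded X] Omr rem_re'
      by (simp add: \<tau>_def power2_eq_square field_simps)
  next
    case 6
    show ?case unfolding cr12 Ndd N1 defs using rem_im by (simp add: field_simps)
  qed
qed

end

section \<open>Principal points of the torus action\<close>

lemma Ck_on_local:
  assumes "\<And>x. x \<in> S \<Longrightarrow> \<exists>T. open T \<and> x \<in> T \<and> Ck_on k T f"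
  shows "Ck_on k S f"
  using assms
proof (induction k arbitrary: f)
  case 0
  then show ?case
    by (auto intro!: continuous_at_imp_continuous_on) (metis continuous_on_eq_continuous_at)
next
  case (Suc k)
  then show ?case unfolding Ck_on_Suc_dder by meson
qed

lemma smooth_on_local:
  assumes "\<And>x. x \<in> S \<Longrightarrow> \<exists>T. open T \<and> x \<in> T \<and> smooth_on T f"
  shows "smooth_on S f"
  using assms Ck_on_local unfolding smooth_on_def by meson

text \<open>\<open>generator\<close> is defined by differentiating along curves; this links it to
  the directional derivatives used everywhere else.\<close>

lemma dder_eq_vector_derivative:
  fixes f :: "'a::real_normed_vector \<Rightarrow> 'b::real_normed_vector"
  assumes "f differentiable (at x)"
  shows "((\<lambda>s. f (x + s *\<^sub>R v)) has_vector_derivative dder v f x) (at 0)"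
    and "dder v f x = vector_derivative (\<lambda>s. f (x + s *\<^sub>R v)) (at 0)"
proof -
  have 1: "((\<lambda>s. x + s *\<^sub>R v) has_derivative (\<lambda>s. s *\<^sub>R v)) (at (0::real))"
    by (auto intro!: derivative_eq_intros)
  have 2: "(f has_derivative (\<lambda>v. dder v f x)) (at (x + 0 *\<^sub>R v))"
    using has_derivative_dder[OF assms] by simp
  have "((\<lambda>s. f (x + s *\<^sub>R v)) has_derivative (\<lambda>s. dder (s *\<^sub>R v) f x)) (at 0)"
    by (rule has_derivative_compose[OF 1 2])
  moreover have "dder (s *\<^sub>R v) f x = s *\<^sub>R dder v f x" for s
    using linear_cmul[OF linear_dder[OF assms]] .
  ultimately show 3: "((\<lambda>s. f (x + s *\<^sub>R v)) has_vector_derivative dder v f x) (at 0)"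
    by (simp add: has_vector_derivative_def)
  then show "dder v f x = vector_derivative (\<lambda>s. f (x + s *\<^sub>R v)) (at 0)"
    by (simp add: vector_derivative_at)
qed

lemma torus_exp_add: "torus_exp (v + w) = (fst (torus_exp v) * fst (torus_exp w), snd (torus_exp v) * snd (torus_exp w))"
  by (simp add: torus_exp_def cis_mult)

lemma torus_exp_0 [simp]: "torus_exp 0 = (1, 1)"
  by (simp add: torus_exp_def)

lemma torus_exp_in_torus [simp]: "torus_exp v \<in> torus"
  by (simp add: torus_exp_def torus_def)

lemma continuous_on_torus_exp: "continuous_on S torus_exp"
  unfolding torus_exp_def[abs_def] cis_conv_exp by (intro continuous_intros)

locale torus_einstein =
  fixes A :: "'m::{t2_space, second_countable_topology} chart set"
    and g :: "'m metric"
    and act :: "'m action"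
    and b :: "real^2^2"
    and z :: "'m \<Rightarrow> complex"
    and \<Omega> :: "complex \<Rightarrow> real"
    and h :: "complex \<Rightarrow> real^2^2"
    and lam :: real
  assumes atlas: "smooth_atlas A"
    and comp: "compact (UNIV :: 'm set)"
    and metric: "riemannian_metric A g"
    and action: "smooth_torus_action A act"
    and isometric: "\<forall>t\<in>torus. preserves_metric A g (act t)"
    and transitive: "orthogonally_transitive A g act"
    and polygonal: "polygonal_orbit_space A act"
    and det_gram: "\<forall>c\<in>A. \<forall>p\<in>fst c. det (gram g act b c p) = 0 \<longleftrightarrow> p \<notin> principal_points act"
    and isothermal: "isothermal_coordinates A g act z \<Omega>"
    and h_gram: "\<forall>c\<in>A. \<forall>p\<in>fst c \<inter> principal_points act. h (z p) = gram g act b c p"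
    and rho_eq: "\<forall>w\<in>z ` principal_points act. rho_equation h \<Omega> lam w"
    and K_eq: "\<forall>w\<in>z ` principal_points act. K_equation h w"
    and Omega_eq: "\<forall>w\<in>z ` principal_points act. Omega_equation h \<Omega> w"
    and boundary: "remaining_at_boundary act z h \<Omega>"
begin

abbreviation "P \<equiv> principal_points act"

lemma chart_at: obtains c where "c \<in> A" "p \<in> fst c"
  using atlas unfolding smooth_atlas_def by blast

lemma chart_homeomorphism:
  assumes "c \<in> A"
  shows "open (fst c)" "open (snd c ` fst c)" "homeomorphism (fst c) (snd c ` fst c) (snd c) (chart_inv c)"
  using atlas assms unfolding smooth_atlas_def by blast+

lemma chart_facts:
  assumes "c \<in> A"
  shows "open (fst c)" "open (snd c ` fst c)" "continuous_on (fst c) (snd c)" "continuous_on (snd c ` fst c) (chart_inv c)"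
    "\<And>p. p \<in> fst c \<Longrightarrow> chart_inv c (snd c p) = p"
    "\<And>u. u \<in> snd c ` fst c \<Longrightarrow> snd c (chart_inv c u) = u"
    "\<And>u. u \<in> snd c ` fst c \<Longrightarrow> chart_inv c u \<in> fst c"
  using chart_homeomorphism[OF assms] unfolding homeomorphism_def by blast+

lemma act_1: "act (1, 1) p = p"
  and act_mult: "s \<in> torus \<Longrightarrow> t \<in> torus \<Longrightarrow> act (fst s * fst t, snd s * snd t) p = act s (act t p)"
  using action unfolding smooth_torus_action_def by blast+

lemma act_exp_add: "act (torus_exp (v + w)) p = act (torus_exp v) (act (torus_exp w) p)"
  by (simp add: torus_exp_add act_mult)

lemma act_commute:
  assumes "s \<in> torus" "t \<in> torus"
  shows "act s (act t p) = act t (act s p)"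
  using act_mult[OF assms, of p] act_mult[OF assms(2,1), of p] by (simp add: mult.commute)

definition tinv :: "complex \<times> complex \<Rightarrow> complex \<times> complex" where
  "tinv t = (cnj (fst t), cnj (snd t))"

lemma tinv: "t \<in> torus \<Longrightarrow> tinv t \<in> torus" "t \<in> torus \<Longrightarrow> act (tinv t) (act t p) = p"
  "t \<in> torus \<Longrightarrow> act t (act (tinv t) p) = p"
proof -
  assume t: "t \<in> torus"
  then show t': "tinv t \<in> torus" by (auto simp: tinv_def torus_def)
  have "cnj x * x = 1" if "norm x = 1" for x :: complex
    using that by (simp add: complex_norm_square[symmetric] mult.commute)
  then have "cnj (fst t) * fst t = 1" "cnj (snd t) * snd t = 1"
    using t by (auto simp: torus_def)
  then show "act (tinv t) (act t p) = p"
    using act_mult[OF t' t, of p] act_1 by (simp add: tinv_def)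
  then show "act t (act (tinv t) p) = p"
    using act_commute[OF t t'] by simp
qed

lemma continuous_act_pair: "continuous_on (torus \<times> UNIV) (\<lambda>(t, p). act t p)"
  using action unfolding smooth_torus_action_def by blast

lemma continuous_act:
  assumes "continuous_on S f" "continuous_on S k" "f ` S \<subseteq> torus"
  shows "continuous_on S (\<lambda>x. act (f x) (k x))"
proof -
  have "continuous_on S (\<lambda>x. (f x, k x))" using assms by (intro continuous_intros)
  from continuous_on_compose2[OF continuous_act_pair this] assms show ?thesis by auto
qed

lemma orbit_act: "t \<in> torus \<Longrightarrow> orbit act (act t p) = orbit act p"
proof -
  assume t: "t \<in> torus"
  have sub: "orbit act (act t p) \<subseteq> orbit act p" if "t \<in> torus" for t p
  proof -
    have "act s (act t p) = act (fst s * fst t, snd s * snd t) p" if "s \<in> torus" for s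
      using act_mult[OF that \<open>t \<in> torus\<close>] by simp
    moreover have "(fst s * fst t, snd s * snd t) \<in> torus" if "s \<in> torus" for s
      using that \<open>t \<in> torus\<close> by (auto simp: torus_def norm_mult)
    ultimately show ?thesis unfolding orbit_def by auto
  qed
  show ?thesis using sub[OF t] sub[OF tinv(1)[OF t], of "act t p"] tinv(2)[OF t] by auto
qed

lemma principal_act: "t \<in> torus \<Longrightarrow> p \<in> P \<Longrightarrow> act t p \<in> P"
proof -
  assume t: "t \<in> torus" and p: "p \<in> P"
  have "isotropy act (act t p) \<subseteq> isotropy act p"
  proof
    fix s assume "s \<in> isotropy act (act t p)"
    then have s: "s \<in> torus" "act s (act t p) = act t p" by (auto simp: isotropy_def)
    then have "act t (act s p) = act t p" using act_commute[OF s(1) t] by simp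
    then have "act s p = p" using tinv(2)[OF t] by metis
    with s show "s \<in> isotropy act p" by (simp add: isotropy_def)
  qed
  with p show ?thesis unfolding principal_points_def by blast
qed

lemma orbit_mem: "p \<in> orbit act p"
  unfolding orbit_def using act_1[of p] torus_exp_in_torus[of 0] by (metis image_eqI torus_exp_0)

lemma orbit_eqE:
  assumes "orbit act p = orbit act q"
  obtains t where "t \<in> torus" "q = act t p"
  using orbit_mem[of q] that unfolding assms[symmetric] unfolding orbit_def by blast

text \<open>Only pairs are kept for which the moved point stays in the same chart, so that
  \<open>flow c\<close> is a smooth map between open subsets of vector spaces.\<close>

definition flow_dom :: "'m chart \<Rightarrow> ((real^2) \<times> (real^4)) set" where
  "flow_dom c = {(v, u). u \<in> snd c ` fst c \<and> act (torus_exp v) (chart_inv c u) \<in> fst c}"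

definition flow :: "'m chart \<Rightarrow> (real^2) \<times> (real^4) \<Rightarrow> real^4" where
  "flow c = (\<lambda>(v, u). snd c (act (torus_exp v) (chart_inv c u)))"

lemma flow_smooth: "c \<in> A \<Longrightarrow> smooth_on (flow_dom c) (flow c)"
  using action unfolding smooth_torus_action_def flow_dom_def flow_def by blast

lemma open_flow_dom:
  assumes c: "c \<in> A"
  shows "open (flow_dom c)"
proof -
  let ?S = "(UNIV :: (real^2) set) \<times> (snd c ` fst c)"
  have "open ?S" using chart_facts(2)[OF c] by (simp add: open_Times)
  moreover have "continuous_on ?S (\<lambda>x. act (torus_exp (fst x)) (chart_inv c (snd x)))"
    by (intro continuous_act continuous_on_compose2[OF continuous_on_torus_exp[of UNIV]]
        continuous_on_compose2[OF chart_facts(4)[OF c]] continuous_intros) auto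
  ultimately have "open (?S \<inter> (\<lambda>x. act (torus_exp (fst x)) (chart_inv c (snd x))) -` fst c)"
    using chart_facts(1)[OF c] continuous_open_preimage by blast
  moreover have "?S \<inter> (\<lambda>x. act (torus_exp (fst x)) (chart_inv c (snd x))) -` fst c = flow_dom c"
    by (auto simp: flow_dom_def)
  ultimately show ?thesis by simp
qed

lemma flow_dom_0: "c \<in> A \<Longrightarrow> u \<in> snd c ` fst c \<Longrightarrow> (0, u) \<in> flow_dom c"
  using chart_facts(7) by (simp add: flow_dom_def act_1)

lemma flow_diff: "c \<in> A \<Longrightarrow> x \<in> flow_dom c \<Longrightarrow> flow c differentiable (at x)"
  using flow_smooth smooth_on_differentiable by blast

text \<open>The generator is a partial derivative of the flow at the neutral element. Its linearity
  in \<open>v\<close> and its smooth dependence on the point follow from this.\<close>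

lemma has_generator:
  assumes c: "c \<in> A" and p: "p \<in> fst c"
  shows "((\<lambda>s. snd c (act (torus_exp (s *\<^sub>R v)) p)) has_vector_derivative generator act v c p) (at 0)"
    "generator act v c p = dder (v, 0) (flow c) (0, snd c p)"
proof -
  have "(0, snd c p) \<in> flow_dom c" using flow_dom_0[OF c] p by blast
  from dder_eq_vector_derivative[OF flow_diff[OF c this], of "(v, 0)"]
  have *: "((\<lambda>s. snd c (act (torus_exp (s *\<^sub>R v)) p)) has_vector_derivative dder (v, 0) (flow c) (0, snd c p)) (at 0)"
    using chart_facts(5)[OF c p] by (simp add: flow_def)
  then show 1: "generator act v c p = dder (v, 0) (flow c) (0, snd c p)"
    unfolding generator_def by (simp add: vector_derivative_at)
  with * show "((\<lambda>s. snd c (act (torus_exp (s *\<^sub>R v)) p)) has_vector_derivative generator act v c p) (at 0)"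
    by simp
qed

lemma linear_generator:
  assumes c: "c \<in> A" and p: "p \<in> fst c"
  shows "linear (\<lambda>v. generator act v c p)"
proof -
  have "(0, snd c p) \<in> flow_dom c" using flow_dom_0[OF c] p by blast
  have "linear (\<lambda>v::real^2. (v, 0::real^4))" by (auto intro!: linearI)
  from linear_compose[OF this linear_dder[OF flow_diff[OF c \<open>(0, snd c p) \<in> flow_dom c\<close>]]]
  show ?thesis
    unfolding has_generator(2)[OF c p] by (simp add: o_def)
qed

lemma generator_smooth:
  assumes c: "c \<in> A"
  shows "smooth_on (snd c ` fst c) (\<lambda>u. generator act v c (chart_inv c u))"
proof -
  have "smooth_on (snd c ` fst c) (\<lambda>u. dder (v, 0) (flow c) (0, u))"
    by (rule smooth_on_compose[OF chart_facts(2)[OF c] _ smooth_on_dder[OF flow_smooth[OF c]]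
          smooth_on_Pair[OF chart_facts(2)[OF c] smooth_on_const smooth_on_id]])
      (use flow_dom_0[OF c] in auto)
  then show ?thesis
    by (rule smooth_on_cong[OF chart_facts(2)[OF c], rotated])
      (use has_generator(2)[OF c] chart_facts(6,7)[OF c] in auto)
qed

lemma metric_smooth: "c \<in> A \<Longrightarrow> smooth_on (snd c ` fst c) (g c)"
  and ip_sym: "c \<in> A \<Longrightarrow> p \<in> fst c \<Longrightarrow> ip g c p v w = ip g c p w v"
  and ip_pos: "c \<in> A \<Longrightarrow> p \<in> fst c \<Longrightarrow> v \<noteq> 0 \<Longrightarrow> ip g c p v v > 0"
  using metric unfolding riemannian_metric_def by blast+

lemma ip_Gform: "ip g c p v w = Gform (g c) (snd c p) v w"
  by (simp add: ip_def Gform_def)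

lemma bilinear_ip: "bilinear (ip g c p)"
  using bilinear_Gform[of "g c" "snd c p"] by (simp add: ip_Gform[abs_def])

lemma gram_smooth:
  assumes c: "c \<in> A"
  shows "smooth_on (snd c ` fst c) (\<lambda>u. gram g act b c (chart_inv c u) $ i $ j)"
proof -
  note o = chart_facts(2)[OF c]
  have "smooth_on (snd c ` fst c) (\<lambda>u. \<Sum>k\<in>UNIV. \<Sum>l\<in>UNIV. g c u $ k $ l *
      generator act (b $ i) c (chart_inv c u) $ k * generator act (b $ j) c (chart_inv c u) $ l)"
    by (intro smooth_on_sum smooth_on_mult smooth_on_vec_nth o generator_smooth[OF c] metric_smooth[OF c])
  then show ?thesis
    by (rule smooth_on_cong[OF o, rotated]) (simp add: gram_def ip_def chart_facts(6)[OF c])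
qed

lemma continuous_det_gram:
  assumes c: "c \<in> A"
  shows "continuous_on (fst c) (\<lambda>p. det (gram g act b c p))"
proof -
  have "continuous_on (snd c ` fst c) (\<lambda>u. det (gram g act b c (chart_inv c u)))"
    by (rule smooth_on_continuous_on[OF smooth_on_det[OF chart_facts(2)[OF c] gram_smooth[OF c]]])
  from continuous_on_compose2[OF this chart_facts(3)[OF c] order_refl]
  show ?thesis by (rule continuous_on_eq) (simp add: chart_facts(5)[OF c])
qed

text \<open>In each chart the principal points are where a continuous function, the Gram
  determinant, does not vanish.\<close>

lemma open_P: "open P"
proof -
  have "P = (\<Union>c\<in>A. fst c \<inter> (\<lambda>p. det (gram g act b c p)) -` (- {0}))"
    using det_gram chart_at by (auto; metis)
  moreover have "open (fst c \<inter> (\<lambda>p. det (gram g act b c p)) -` (- {0}))" if "c \<in> A" for c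
    using continuous_open_preimage[OF continuous_det_gram[OF that] chart_facts(1)[OF that]] by blast
  ultimately show ?thesis by auto
qed

lemma gram_sym: "c \<in> A \<Longrightarrow> p \<in> fst c \<Longrightarrow> gram g act b c p $ i $ j = gram g act b c p $ j $ i"
  unfolding gram_def using ip_sym by simp

text \<open>By \<open>det_gram\<close> the determinant is nonzero at a principal point; the sign is
  the Cauchy-Schwarz inequality.\<close>

lemma det_gram_pos:
  assumes c: "c \<in> A" and p: "p \<in> fst c" "p \<in> P"
  shows "det (gram g act b c p) > 0"
proof -
  let ?X = "generator act (b $ 1) c p" and ?Y = "generator act (b $ 2) c p"
  let ?a = "ip g c p ?X ?X" and ?b = "ip g c p ?X ?Y" and ?d = "ip g c p ?Y ?Y"
  have det: "det (gram g act b c p) = ?a * ?d - ?b * ?b"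
    using ip_sym[OF c p(1), of ?Y ?X] by (simp add: det_2 gram_def)
  have nz: "?a * ?d - ?b * ?b \<noteq> 0" using det det_gram c p by auto
  have pos: "ip g c p v v \<ge> 0" for v
    using ip_pos[OF c p(1), of v] bilinear_lzero[OF bilinear_ip] by (cases "v = 0") (auto simp: less_imp_le)
  note bl = bilinear_ladd[OF bilinear_ip] bilinear_radd[OF bilinear_ip] bilinear_lmul[OF bilinear_ip] bilinear_rmul[OF bilinear_ip]
  \<comment> \<open>The vector is \<open>?d\<close> times the component of X orthogonal to Y; its
    squared length factors into \<open>?d\<close> and the determinant.\<close>
  have "ip g c p (?d *\<^sub>R ?X + (- ?b) *\<^sub>R ?Y) (?d *\<^sub>R ?X + (- ?b) *\<^sub>R ?Y) = ?d * (?a * ?d - ?b * ?b)"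
    unfolding bl using ip_sym[OF c p(1), of ?Y ?X] by (simp add: algebra_simps)
  then have 1: "?d * (?a * ?d - ?b * ?b) \<ge> 0" using pos by metis
  have "?d > 0"
  proof (cases "?Y = 0")
    case True
    then have "?b = 0" "?d = 0" using bilinear_rzero[OF bilinear_ip] by simp_all
    then show ?thesis using nz by simp
  next
    case False
    then show ?thesis using ip_pos[OF c p(1)] by simp
  qed
  with 1 nz show ?thesis unfolding det by (simp add: zero_le_mult_iff less_le)
qed

text \<open>The saturation of \<open>W\<close> is the union of its torus translates, each of them
  open.\<close>

lemma open_orbit_saturation:
  assumes "open W"
  shows "openin (orbit_space act) (orbit act ` W)"
  unfolding openin_orbit_space
proof
  have "orbit act -` orbit act ` W = (\<Union>t\<in>torus. act t -` W)"
  proof (intro equalityI subsetI)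
    fix p assume "p \<in> orbit act -` orbit act ` W"
    then obtain q where q: "q \<in> W" "orbit act p = orbit act q" by auto
    then obtain t where "t \<in> torus" "q = act t p" by (elim orbit_eqE)
    with q(1) show "p \<in> (\<Union>t\<in>torus. act t -` W)" by auto
  next
    fix p assume "p \<in> (\<Union>t\<in>torus. act t -` W)"
    then obtain t where t: "t \<in> torus" "act t p \<in> W" by auto
    show "p \<in> orbit act -` orbit act ` W"
      by (intro vimageI2 image_eqI[of _ _ "act t p"]) (simp_all add: t orbit_act)
  qed
  moreover have "open (act t -` W)" if "t \<in> torus" for t
  proof -
    have "continuous_on UNIV (act t)"
      using continuous_act[of UNIV "\<lambda>_. t" "\<lambda>p. p"] that by (auto intro: continuous_intros)
    then show ?thesis using assms by (simp add: open_vimage)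
  qed
  ultimately show "open (orbit act -` orbit act ` W)" by auto
qed auto

lemma quadrant_interior_approx:
  assumes "x \<in> quadrant" "openin (top_of_set quadrant) T" "x \<in> T"
  shows "\<exists>y\<in>T. y \<in> interior quadrant"
proof -
  obtain O' where O: "open O'" "T = quadrant \<inter> O'" using assms(2) by (auto simp: openin_open)
  then obtain e where e: "e > 0" "ball x e \<subseteq> O'" using assms(3) by (meson IntD2 open_contains_ball)
  \<comment> \<open>A diagonal shift makes both coordinates positive, and its norm is at most
    e/2.\<close>
  define y where "y = x + Complex (e/4) (e/4)"
  have "norm (Complex (e/4) (e/4)) \<le> \<bar>e/4\<bar> + \<bar>e/4\<bar>" using cmod_le[of "Complex (e/4) (e/4)"] by simp
  then have "y \<in> ball x e" using e(1) by (simp add: y_def dist_norm norm_minus_commute) 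
  moreover have pos: "Re y > 0" "Im y > 0" using assms(1) e(1) by (auto simp: quadrant_def y_def)
  moreover have "open {w. 0 < Re w \<and> 0 < Im w}"
    by (intro open_Collect_conj open_Collect_less continuous_intros)
  then have "{w. 0 < Re w \<and> 0 < Im w} \<subseteq> interior quadrant"
    by (intro interior_maximal) (auto simp: quadrant_def)
  ultimately show ?thesis using e O by (auto simp: quadrant_def intro!: bexI[of _ y])
qed

text \<open>A chart of the orbit space carries the orbits meeting \<open>W\<close> to a relatively
  open subset of the quadrant. Such a set meets the interior of the quadrant, whose points
  correspond to principal orbits.\<close>

lemma P_dense:
  assumes "open W" "W \<noteq> {}"
  shows "W \<inter> P \<noteq> {}"
proof -
  obtain p where p: "p \<in> W" using assms by auto
  obtain B :: "('m set set \<times> ('m set \<Rightarrow> complex)) set" where B: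
    "(\<Union>(V, \<psi>)\<in>B. V) = topspace (orbit_space act)"
    "\<forall>(V, \<psi>)\<in>B. openin (orbit_space act) V \<and> openin (top_of_set quadrant) (\<psi> ` V) \<and>
           homeomorphic_map (subtopology (orbit_space act) V) (top_of_set (\<psi> ` V)) \<psi> \<and>
           (\<forall>p. orbit act p \<in> V \<longrightarrow> (p \<in> P \<longleftrightarrow> \<psi> (orbit act p) \<in> interior quadrant))"
    using polygonal unfolding polygonal_orbit_space_def
    apply (elim conjE exE)
    subgoal for B by (rule that[of B]) (assumption, force)
    done
  have "orbit act p \<in> topspace (orbit_space act)"
    using openin_subset[OF open_orbit_saturation[OF open_UNIV]] by auto
  then obtain V \<psi> where V: "(V, \<psi>) \<in> B" "orbit act p \<in> V" unfolding B(1)[symmetric] by auto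
  with B(2) have V': "openin (orbit_space act) V" "openin (top_of_set quadrant) (\<psi> ` V)"
     "homeomorphic_map (subtopology (orbit_space act) V) (top_of_set (\<psi> ` V)) \<psi>"
     "\<And>p. orbit act p \<in> V \<Longrightarrow> (p \<in> P \<longleftrightarrow> \<psi> (orbit act p) \<in> interior quadrant)" by auto
  let ?T = "V \<inter> orbit act ` W"
  have "openin (subtopology (orbit_space act) V) ?T"
    using open_orbit_saturation[OF assms(1)] by (simp add: openin_subtopology_Int2)
  moreover have "open_map (subtopology (orbit_space act) V) (top_of_set (\<psi> ` V)) \<psi>"
    using V'(3) homeomorphic_imp_open_map by blast
  ultimately have "openin (top_of_set (\<psi> ` V)) (\<psi> ` ?T)" unfolding open_map_def by blast
  then have o: "openin (top_of_set quadrant) (\<psi> ` ?T)" using V'(2) openin_trans by blast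
  have "\<psi> (orbit act p) \<in> \<psi> ` ?T" using V(2) p by auto
  moreover from this have "\<psi> (orbit act p) \<in> quadrant" using o openin_subset by fastforce
  ultimately obtain y where "y \<in> \<psi> ` ?T" "y \<in> interior quadrant" using quadrant_interior_approx[OF _ o] by blast
  then obtain q where "q \<in> W" "orbit act q \<in> V" "\<psi> (orbit act q) \<in> interior quadrant" by auto
  then show ?thesis using V'(4) by auto
qed

end

section \<open>Local sections and the maximum principle\<close>

context torus_einstein
begin

abbreviation "U \<equiv> z ` P"

lemma isothermal_facts:
  shows "c \<in> A \<Longrightarrow> smooth_on (snd c ` (fst c \<inter> P)) (z \<circ> chart_inv c)"
    and open_U: "open U"
    and "p \<in> P \<Longrightarrow> q \<in> P \<Longrightarrow> z p = z q \<longleftrightarrow> orbit act p = orbit act q"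
    and Omega_smooth: "smooth_on U \<Omega>"
    and Omega_pos: "w \<in> U \<Longrightarrow> \<Omega> w > 0"
  using isothermal unfolding isothermal_coordinates_def smooth_fun_on_def by auto

lemma isothermal_ip:
  assumes "c \<in> A" "p \<in> fst c" "p \<in> P" "v \<in> horizontal g act c p" "v' \<in> horizontal g act c p"
  shows "ip g c p v v' = (\<Omega> (z p))\<^sup>2 * (dder v (z \<circ> chart_inv c) (snd c p) \<bullet> dder v' (z \<circ> chart_inv c) (snd c p))"
  using isothermal assms unfolding isothermal_coordinates_def by (simp add: Let_def dder_def)

lemma z_act: "t \<in> torus \<Longrightarrow> p \<in> P \<Longrightarrow> z (act t p) = z p"
  using isothermal_facts(3)[of "act t p" p] principal_act orbit_act by simp

lemma continuous_z: "continuous_on P z"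
proof (rule continuous_at_imp_continuous_on, rule ballI)
  fix p assume p: "p \<in> P"
  obtain c where c: "c \<in> A" "p \<in> fst c" by (rule chart_at)
  have "continuous_on (fst c \<inter> P) (\<lambda>p. (z \<circ> chart_inv c) (snd c p))"
    by (rule continuous_on_compose2[OF smooth_on_continuous_on[OF isothermal_facts(1)[OF c(1)]]])
      (auto intro: continuous_on_subset[OF chart_facts(3)[OF c(1)]])
  then have "continuous_on (fst c \<inter> P) z"
    by (rule continuous_on_eq) (simp add: chart_facts(5)[OF c(1)])
  then show "isCont z p"
    using c p open_P chart_facts(1)[OF c(1)] by (simp add: continuous_on_eq_continuous_at open_Int)
qed

text \<open>The horizontal space contains the Euclidean orthogonal complement, in R^4, of the two
  vectors that the metric matrix produces from the two generators.\<close>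

lemma dim_horizontal:
  assumes c: "c \<in> A" and p: "p \<in> fst c"
  shows "dim (horizontal g act c p) \<ge> 2"
proof -
  define Y where "Y i = g c (snd c p) *v generator act (axis i 1) c p" for i :: 2
  have ipY: "ip g c p v (generator act (axis i 1) c p) = v \<bullet> Y i" for v i
    by (simp add: ip_def Y_def inner_vec_def matrix_vector_mult_def sum_distrib_left mult_ac)
  have "{v \<in> UNIV. \<forall>x\<in>span (range Y). orthogonal x v} \<subseteq> horizontal g act c p"
  proof
    fix v assume v: "v \<in> {v \<in> UNIV. \<forall>x\<in>span (range Y). orthogonal x v}"
    have "ip g c p v (generator act a c p) = 0" for a
    proof -
      have L: "linear (ip g c p v)" using bilinear_ip by (auto simp: bilinear_def)
      have "v \<bullet> Y i = 0" for i using v span_base[of "Y i" "range Y"] by (auto simp: orthogonal_def inner_commute)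
      then show ?thesis
        by (subst linear_expand_axis[OF linear_generator[OF c p]])
          (simp add: linear_sum[OF L] linear_cmul[OF L] ipY)
    qed
    then show "v \<in> horizontal g act c p" by (simp add: horizontal_def)
  qed
  then have "dim {v \<in> UNIV. \<forall>x\<in>span (range Y). orthogonal x v} \<le> dim (horizontal g act c p)"
    by (rule dim_subset)
  moreover have "dim {v \<in> UNIV. \<forall>x\<in>span (range Y). orthogonal x v} + dim (span (range Y)) = dim (UNIV :: (real^4) set)"
    by (rule dim_subspace_orthogonal_to_vectors) auto
  moreover have "dim (span (range Y)) \<le> card (range Y)" by (intro span_card_ge_dim) (auto intro: span_base)
  moreover have "card (range Y) \<le> 2" using card_image_le[of "UNIV :: 2 set" Y] by simp
  ultimately show ?thesis by simp
qed

text \<open>If v is a nonzero kernel vector, then v and i v form a real basis of the plane, so the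
  range is spanned by the single vector \<open>D (\<i> * v)\<close>.\<close>

lemma linear_range_dim2_inj:
  fixes D :: "complex \<Rightarrow> real^4"
  assumes D: "linear D" and dim: "dim (range D) \<ge> 2"
  shows "inj D"
proof -
  have "v = 0" if v: "D v = 0" for v
  proof (rule ccontr)
    assume nz: "v \<noteq> 0"
    have "D u \<in> span {D (\<i> * v)}" for u
    proof -
      have "u = Re (u / v) *\<^sub>R v + Im (u / v) *\<^sub>R (\<i> * v)"
      proof -
        have "u = (u / v) * v" using nz by simp
        also have "u / v = of_real (Re (u / v)) + \<i> * of_real (Im (u / v))" by (rule complex_eq)
        finally show ?thesis by (simp add: scaleR_conv_of_real algebra_simps)
      qed
      then have "D u = Re (u / v) *\<^sub>R D v + Im (u / v) *\<^sub>R D (\<i> * v)"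
        using linear_add[OF D] linear_cmul[OF D] by metis
      then show ?thesis using v by (simp add: span_base span_scale)
    qed
    then have "range D \<subseteq> span {D (\<i> * v)}" by auto
    then have "dim (range D) \<le> card {D (\<i> * v)}" by (intro span_card_ge_dim) auto
    with dim show False by simp
  qed
  then show ?thesis using linear_injective_0[OF D] by blast
qed

text \<open>Orthogonal transitivity provides an integral surface through \<open>p\<close>, and
  \<open>z\<close> restricted to it is a local diffeomorphism. Reparametrising the surface by the
  local inverse gives a section of \<open>z\<close> whose tangent vectors are still
  horizontal.\<close>

lemma local_section:
  assumes c: "c \<in> A" and p: "p \<in> fst c" "p \<in> P"
  obtains V k where "open V" "z p \<in> V" "V \<subseteq> U" "k (z p) = p" "\<And>w. w \<in> V \<Longrightarrow> k w \<in> fst c"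
    "\<And>w. w \<in> V \<Longrightarrow> k w \<in> P" "\<And>w. w \<in> V \<Longrightarrow> z (k w) = w" "smooth_on V (\<lambda>w. snd c (k w))"
    "\<And>w e. w \<in> V \<Longrightarrow> dder e (\<lambda>w. snd c (k w)) w \<in> horizontal g act c (k w)"
proof -
  obtain W :: "complex set" and \<sigma> where W: "open W" "0 \<in> W" "\<sigma> 0 = p" "continuous_on W \<sigma>" "\<sigma> ` W \<subseteq> P"
    "\<forall>c\<in>A. smooth_on {w\<in>W. \<sigma> w \<in> fst c} (snd c \<circ> \<sigma>) \<and>
           (\<forall>w\<in>W. \<sigma> w \<in> fst c \<longrightarrow> range (frechet_derivative (snd c \<circ> \<sigma>) (at w)) = horizontal g act c (\<sigma> w))"
    using bspec[OF transitive[unfolded orthogonally_transitive_def] p(2)]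
    apply (elim exE conjE)
    subgoal for W \<sigma> by (rule that[of W \<sigma>])
    done
  define W' where "W' = {w\<in>W. \<sigma> w \<in> fst c}"
  have "W' = W \<inter> \<sigma> -` fst c" by (auto simp: W'_def)
  then have oW: "open W'" using continuous_open_preimage[OF W(4,1) chart_facts(1)[OF c]] by simp
  define s where "s = (\<lambda>w. snd c (\<sigma> w))"
  have s: "smooth_on W' s" "\<And>w. w \<in> W' \<Longrightarrow> range (\<lambda>v. dder v s w) = horizontal g act c (\<sigma> w)"
    using W(6) c unfolding W'_def s_def dder_def comp_def by auto
  have W0: "0 \<in> W'" using W p by (simp add: W'_def)
  define f where "f = (\<lambda>w. z (\<sigma> w))"
  have fs: "f w = (z \<circ> chart_inv c) (s w)" if "w \<in> W'" for w
    using that chart_facts(5)[OF c] by (simp add: f_def s_def W'_def)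
  have sW: "s ` W' \<subseteq> snd c ` (fst c \<inter> P)" using W(5) by (auto simp: s_def W'_def)
  have "smooth_on W' (\<lambda>w. (z \<circ> chart_inv c) (s w))"
    by (rule smooth_on_compose[OF oW sW isothermal_facts(1)[OF c] s(1)])
  then have f: "smooth_on W' f" by (rule smooth_on_cong[OF oW, rotated]) (simp add: fs)
  have sd: "s differentiable (at 0)" by (rule smooth_on_differentiable[OF s(1) W0])
  have "inj (\<lambda>v. dder v s 0)"
    by (rule linear_range_dim2_inj[OF linear_dder[OF sd]])
      (use s(2)[OF W0] W(3) dim_horizontal[OF c p(1)] in simp)
  have zd: "(z \<circ> chart_inv c) differentiable (at (s 0))"
    by (rule smooth_on_differentiable[OF isothermal_facts(1)[OF c]]) (use sW W0 in blast)
  \<comment> \<open>The differential of \<open>z\<close> preserves lengths of horizontal vectors up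
    to the factor \<Omega>, so it kills no nonzero tangent vector of the surface.\<close>
  have "inj (\<lambda>v. dder v f 0)"
  proof -
    have fd: "f differentiable (at 0)" by (rule smooth_on_differentiable[OF f W0])
    have "v = 0" if "dder v f 0 = 0" for v
    proof -
      have "dder v f 0 = dder v (\<lambda>w. (z \<circ> chart_inv c) (s w)) 0"
        by (rule dder_cong_open[OF oW W0 fs])
      also have "\<dots> = dder (dder v s 0) (z \<circ> chart_inv c) (s 0)" by (rule dder_compose[OF sd zd])
      finally have "dder (dder v s 0) (z \<circ> chart_inv c) (snd c p) = 0"
        using that W(3) by (simp add: s_def)
      moreover have "dder v s 0 \<in> horizontal g act c p" using s(2)[OF W0] W(3) by auto
      ultimately have "ip g c p (dder v s 0) (dder v s 0) = 0"
        using isothermal_ip[OF c p] by simp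
      then have "dder v s 0 = 0" using ip_pos[OF c p(1)] by force
      then show "v = 0"
        using \<open>inj (\<lambda>v. dder v s 0)\<close> linear_injective_0[OF linear_dder[OF sd]] by blast
    qed
    then show ?thesis using linear_injective_0[OF linear_dder[OF fd]] by blast
  qed
  from smooth_local_inverse[OF oW f W0 this]
  obtain U' V k where k: "open U'" "U' \<subseteq> W'" "0 \<in> U'" "open V" "f 0 \<in> V" "homeomorphism U' V f k" "smooth_on V k" .
  have kV: "k w \<in> W'" "f (k w) = w" if "w \<in> V" for w
    using k(2,6) that unfolding homeomorphism_def by auto
  have k0: "k (f 0) = 0" using k(3,6) unfolding homeomorphism_def by blast
  have kd: "k differentiable (at w)" "s differentiable (at (k w))" if "w \<in> V" for w
    using smooth_on_differentiable[OF k(7) that] smooth_on_differentiable[OF s(1) kV(1)[OF that]] .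
  show ?thesis
  proof (rule that[of V "\<lambda>w. \<sigma> (k w)"])
    show "open V" by fact
    show "z p \<in> V" using k(5) W(3) by (simp add: f_def)
    show "\<sigma> (k w) \<in> fst c" "\<sigma> (k w) \<in> P" "z (\<sigma> (k w)) = w" if "w \<in> V" for w
      using kV[OF that] W(5) by (auto simp: W'_def f_def)
    then show "V \<subseteq> U" by force
    show "\<sigma> (k (z p)) = p" using k0 W(3) by (simp add: f_def)
    show "smooth_on V (\<lambda>w. snd c (\<sigma> (k w)))"
      using smooth_on_compose[OF k(4) _ s(1) k(7)] kV by (auto simp: s_def)
    fix w e assume w: "w \<in> V"
    have "dder e (\<lambda>w. s (k w)) w = dder (dder e k w) s (k w)"
      by (rule dder_compose[OF kd[OF w]])
    also have "\<dots> \<in> horizontal g act c (\<sigma> (k w))" using s(2)[OF kV(1)[OF w]] by auto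
    finally show "dder e (\<lambda>w. snd c (\<sigma> (k w))) w \<in> horizontal g act c (\<sigma> (k w))" by (simp add: s_def)
  qed
qed

text \<open>Near each point of the image, \<open>h\<close> is the Gram matrix composed with a smooth
  section of \<open>z\<close>.\<close>

lemma h_smooth_on_principal: "smooth_on U h"
proof (rule smooth_on_local)
  fix w0 assume "w0 \<in> U"
  then obtain p where p: "p \<in> P" "w0 = z p" by auto
  obtain c where c: "c \<in> A" "p \<in> fst c" by (rule chart_at)
  obtain V k where V: "open V" "z p \<in> V" "V \<subseteq> U" "k (z p) = p" "\<And>w. w \<in> V \<Longrightarrow> k w \<in> fst c"
    "\<And>w. w \<in> V \<Longrightarrow> k w \<in> P" "\<And>w. w \<in> V \<Longrightarrow> z (k w) = w" "smooth_on V (\<lambda>w. snd c (k w))"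
    using local_section[OF c p(1)] by metis
  have "smooth_on V (\<lambda>w. gram g act b c (chart_inv c (snd c (k w))) $ i $ j)" for i j
    by (rule smooth_on_compose[OF V(1) _ gram_smooth[OF c(1)] V(8)]) (use V(5) in auto)
  then have "smooth_on V (\<lambda>w. \<chi> i j. gram g act b c (chart_inv c (snd c (k w))) $ i $ j)"
    by (intro smooth_on_vec_lambda V(1))
  then have "smooth_on V h"
  proof (rule smooth_on_cong[OF V(1), rotated])
    fix w assume w: "w \<in> V"
    have "gram g act b c (k w) = h (z (k w))" using h_gram c(1) V(5,6)[OF w] by simp
    then show "(\<chi> i j. gram g act b c (chart_inv c (snd c (k w))) $ i $ j) = h w"
      using V(5,7)[OF w] chart_facts(5)[OF c(1)] by simp
  qed
  then show "\<exists>T. open T \<and> w0 \<in> T \<and> smooth_on T h" using V p by auto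
qed

sublocale block_data U \<Omega> h
proof
  show "open U" "smooth_on U \<Omega>" "\<And>w. w \<in> U \<Longrightarrow> 0 < \<Omega> w" using open_U Omega_smooth Omega_pos by auto
  show "smooth_on U h" by (rule h_smooth_on_principal)
  fix w assume "w \<in> U"
  then obtain p where p: "p \<in> P" "w = z p" by auto
  obtain c where c: "c \<in> A" "p \<in> fst c" by (rule chart_at)
  have "h w = gram g act b c p" using h_gram c p by simp
  then show "h w $ 2 $ 1 = h w $ 1 $ 2" "0 < det (h w)"
    using gram_sym[OF c] det_gram_pos[OF c p(1)] by simp_all
qed

lemma remaining_zero:
  assumes "w \<in> U"
  shows "remaining_lhs h \<Omega> w = 0"
proof -
  define F where "F = (\<lambda>w. crho h w * remaining_lhs h \<Omega> w)"
  have hol: "F holomorphic_on U"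
    unfolding F_def by (rule holomorphic_remaining) (use rho_eq K_eq Omega_eq in auto)
  define f where "f q = (if q \<in> P then F (z q) else 0)" for q
  have cont: "isCont f p" for p
  proof (cases "p \<in> P")
    case True
    have "continuous_on P (\<lambda>q. F (z q))"
      using continuous_on_compose2[OF holomorphic_on_imp_continuous_on[OF hol] continuous_z] by blast
    then have "continuous_on P f" by (rule continuous_on_eq) (simp add: f_def)
    then show ?thesis using True open_P by (simp add: continuous_on_eq_continuous_at)
  next
    case False
    obtain c where c: "c \<in> A" "p \<in> fst c" by (rule chart_at)
    \<comment> \<open>In a chart, \<rho> along q is the square root of the Gram determinant, which
      is continuous at \<open>p\<close>. The product therefore inherits the limit 0 of the other
      factor.\<close>
    have "((\<lambda>q. sqrt (det (gram g act b c q))) \<longlongrightarrow> sqrt (det (gram g act b c p))) (at p)"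
      using continuous_det_gram[OF c(1)] chart_facts(1)[OF c(1)] c(2)
      by (intro tendsto_intros) (simp add: continuous_on_eq_continuous_at isCont_def)
    then have 1: "((\<lambda>q. sqrt (det (gram g act b c q))) \<longlongrightarrow> sqrt (det (gram g act b c p))) (at p within P)"
      by (rule tendsto_mono[rotated]) (simp add: at_le)
    have 2: "((\<lambda>q. remaining_lhs h \<Omega> (z q)) \<longlongrightarrow> 0) (at p within P)"
      using boundary False unfolding remaining_at_boundary_def by blast
    have "((\<lambda>q. complex_of_real (sqrt (det (gram g act b c q))) * remaining_lhs h \<Omega> (z q)) \<longlongrightarrow>
        complex_of_real (sqrt (det (gram g act b c p))) * 0) (at p within P)"
      by (intro tendsto_mult tendsto_of_real 1 2)
    moreover have "\<forall>\<^sub>F q in at p within P. complex_of_real (sqrt (det (gram g act b c q))) * remaining_lhs h \<Omega> (z q) = f q"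
      unfolding eventually_at_filter
      using eventually_nhds_in_open[OF chart_facts(1)[OF c(1)] c(2)]
      by eventually_elim (use h_gram c(1) in \<open>auto simp: f_def F_def crho_def rho_def\<close>)
    ultimately have fP: "(f \<longlongrightarrow> 0) (at p within P)" by (simp add: tendsto_cong)
    have "(f \<longlongrightarrow> 0) (at p within - P)"
      by (rule tendsto_eventually) (auto simp: eventually_at_filter f_def)
    with fP have "(f \<longlongrightarrow> 0) (at p)"
      by (metis Compl_partition Lim_Un_univ)
    then show ?thesis using False by (simp add: isCont_def f_def)
  qed
  then have "continuous_on UNIV (\<lambda>p. norm (f p))"
    by (auto intro!: continuous_at_imp_continuous_on continuous_norm)
  then obtain m where m: "\<And>p. norm (f p) \<le> norm (f m)"
    using continuous_attains_sup[OF comp] by blast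
  have fm: "f m = 0"
  proof (rule ccontr)
    assume nz: "f m \<noteq> 0"
    define T where "T = {p. norm (f p) = norm (f m)}"
    \<comment> \<open>Off \<open>P\<close> the extension is zero, so a nonzero maximal modulus is
      attained at principal points only.\<close>
    have TP: "T \<subseteq> P" using nz by (auto simp: T_def f_def)
    have "closed T"
      unfolding T_def using \<open>continuous_on UNIV (\<lambda>p. norm (f p))\<close>
      by (intro closed_Collect_eq continuous_on_const)
    then have "compact T" using comp by (metis compact_Int_closed inf_top.left_neutral)
    then have cz: "compact (z ` T)"
      using compact_continuous_image[OF continuous_on_subset[OF continuous_z TP]] by blast
    \<comment> \<open>On \<open>P\<close> the function \<open>f\<close> factors through
      \<open>z\<close>, so the image of \<open>T\<close> is a whole level set of the modulus of
      \<open>F\<close>.\<close>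
    have Tz: "z ` T = {w \<in> U. norm (F w) = norm (f m)}"
      using TP by (auto simp: T_def f_def image_iff split: if_splits)
    have oz: "open (z ` T)"
    proof (subst open_contains_ball, intro ballI)
      fix w assume "w \<in> z ` T"
      then have w: "w \<in> U" "norm (F w) = norm (f m)" using Tz by auto
      obtain e where e: "e > 0" "ball w e \<subseteq> U" using w open_U open_contains_ball by meson
      \<comment> \<open>Each value of \<open>F\<close> on \<open>U\<close> is a value of
        \<open>f\<close>, so the bound on the manifold makes w an interior maximum of the modulus of
        \<open>F\<close>.\<close>
      have le: "norm (F v) \<le> norm (F w)" if v: "v \<in> U" for v
      proof -
        obtain q where "q \<in> P" "v = z q" using v by auto
        then show ?thesis using m[of q] w(2) by (simp add: f_def)
      qed
      have "F constant_on ball w e"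
        by (rule maximum_modulus_principle[of F "ball w e" "ball w e" w])
          (use e le in \<open>auto intro: holomorphic_on_subset[OF hol]\<close>)
      then obtain a where a: "\<And>v. v \<in> ball w e \<Longrightarrow> F v = a" unfolding constant_on_def by blast
      have "ball w e \<subseteq> z ` T"
      proof
        fix v assume v: "v \<in> ball w e"
        have 1: "norm (F v) = norm (f m)" using a[OF v] a[of w] e(1) w(2) by simp
        have 2: "v \<in> U" by (rule subsetD[OF e(2) v])
        show "v \<in> z ` T" unfolding Tz by (rule CollectI) (rule conjI[OF 2 1])
      qed
      then show "\<exists>e>0. ball w e \<subseteq> z ` T" using e(1) by blast
    qed
    have "z ` T = {} \<or> z ` T = UNIV"
      using clopen[of "z ` T"] oz compact_imp_closed[OF cz] by simp
    moreover have "m \<in> T" by (simp add: T_def)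
    ultimately show False using cz not_compact_UNIV by auto
  qed
  from assms obtain p where p: "p \<in> P" "w = z p" by auto
  have "F w = 0" using m[of p] fm p by (simp add: f_def)
  then show ?thesis using r_nz[OF assms] by (simp add: F_def)
qed

end

section \<open>The Einstein equation\<close>

lemma metric_on_subset: "metric_on S G \<Longrightarrow> open T \<Longrightarrow> T \<subseteq> S \<Longrightarrow> metric_on T G"
  unfolding metric_on_def using smooth_on_subset by blast

lemma Gform_inner: "Gform G u v w = v \<bullet> (G u *v w)"
  by (simp add: Gform_nested inner_vec_def matrix_vector_mult_def)

context torus_einstein
begin

lemma metric_on_chart:
  assumes c: "c \<in> A"
  shows "metric_on (snd c ` fst c) (g c)"
  unfolding metric_on_def
proof (intro conjI ballI allI)
  show "open (snd c ` fst c)" by (rule chart_facts(2)[OF c])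
  show "smooth_on (snd c ` fst c) (g c)" by (rule metric_smooth[OF c])
  fix u assume "u \<in> snd c ` fst c"
  then obtain p where p: "p \<in> fst c" "u = snd c p" by auto
  show "g c u $ i $ j = g c u $ j $ i" for i j
    using ip_sym[OF c p(1), of "axis i 1" "axis j 1"]
    by (simp add: ip_Gform p(2) Gform_nested sum_axis)
  show "det (g c u) \<noteq> 0"
  proof
    assume "det (g c u) = 0"
    then have "\<not> invertible (g c u)" by (simp add: invertible_det_nz)
    then obtain v where v: "v \<noteq> 0" "g c u *v v = 0"
      using matrix_left_invertible_ker[of "g c u"] invertible_left_inverse[of "g c u"] by blast
    then have "ip g c p v v = 0" by (simp add: ip_Gform Gform_inner p(2))
    with ip_pos[OF c p(1) v(1)] show False by simp
  qed
qed

text \<open>By additivity of the exponential, varying the parameter around \<open>v\<close> amounts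
  to moving the already translated point, so the derivative is the generator there.\<close>

lemma dder_flow_torus:
  assumes c: "c \<in> A" and x: "x \<in> fst c" "act (torus_exp v) x \<in> fst c"
  shows "dder (a, 0) (flow c) (v, snd c x) = generator act a c (act (torus_exp v) x)"
proof -
  have "(v, snd c x) \<in> flow_dom c" using x chart_facts(5)[OF c] by (simp add: flow_dom_def)
  from dder_eq_vector_derivative(2)[OF flow_diff[OF c this], of "(a, 0)"]
  show ?thesis
    using chart_facts(5)[OF c x(1)]
    by (simp add: flow_def generator_def act_exp_add[symmetric] add.commute)
qed

text \<open>A fixed torus element, read in the chart, maps generators to generators because the
  torus is abelian, and preserves inner products because it acts by isometries. Together these keep
  translated horizontal vectors horizontal.\<close>

lemma translate_facts:
  assumes c: "c \<in> A" and x: "x \<in> fst c" "act (torus_exp v) x \<in> fst c"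
  shows "(\<lambda>u. flow c (v, u)) differentiable (at (snd c x))"
    "dder a (\<lambda>u. flow c (v, u)) (snd c x) = dder (0, a) (flow c) (v, snd c x)"
    "dder (generator act e c x) (\<lambda>u. flow c (v, u)) (snd c x) = generator act e c (act (torus_exp v) x)"
    "ip g c x a a' = ip g c (act (torus_exp v) x)
       (dder a (\<lambda>u. flow c (v, u)) (snd c x)) (dder a' (\<lambda>u. flow c (v, u)) (snd c x))"
proof -
  let ?\<theta> = "\<lambda>u. flow c (v, u)" and ?q = "act (torus_exp v) x"
  have "(v, snd c x) \<in> flow_dom c" using x chart_facts(5)[OF c] by (simp add: flow_dom_def)
  note fd = flow_diff[OF c this]
  have "((\<lambda>u. flow c (v, u)) has_derivative (\<lambda>a. dder (0, a) (flow c) (v, snd c x))) (at (snd c x))"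
  proof (rule has_derivative_compose[of "\<lambda>u. (v, u)" "\<lambda>a. (0, a)"])
    show "((\<lambda>u. (v, u)) has_derivative (\<lambda>a. (0, a))) (at (snd c x))"
      by (auto intro!: derivative_eq_intros)
    show "(flow c has_derivative (\<lambda>a. dder a (flow c) (v, snd c x))) (at (v, snd c x))"
      by (rule has_derivative_dder[OF fd])
  qed
  then show d: "?\<theta> differentiable (at (snd c x))"
    and "dder a ?\<theta> (snd c x) = dder (0, a) (flow c) (v, snd c x)"
    by (auto simp: dder_eq differentiable_def)
  have "preserves_metric A g (act (torus_exp v))" using isometric by simp
  moreover have "(snd c \<circ> act (torus_exp v) \<circ> chart_inv c) = ?\<theta>" by (auto simp: flow_def)
  ultimately show "ip g c x a a' = ip g c ?q (dder a ?\<theta> (snd c x)) (dder a' ?\<theta> (snd c x))"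
    using c x unfolding preserves_metric_def Let_def dder_def by metis
  define \<gamma> where "\<gamma> s = snd c (act (torus_exp (s *\<^sub>R e)) x)" for s
  have \<gamma>0: "\<gamma> 0 = snd c x" by (simp add: \<gamma>_def act_1)
  have "((\<lambda>s. ?\<theta> (\<gamma> s)) has_derivative (\<lambda>s. dder (s *\<^sub>R generator act e c x) ?\<theta> (snd c x))) (at 0)"
    using has_derivative_compose[of \<gamma> _ 0 UNIV ?\<theta>, OF has_generator(1)[OF c x(1), of e, folded \<gamma>_def, unfolded has_vector_derivative_def]
      has_derivative_dder[OF d, folded \<gamma>0]]
    unfolding \<gamma>0 .
  then have 1: "((\<lambda>s. ?\<theta> (\<gamma> s)) has_vector_derivative dder (generator act e c x) ?\<theta> (snd c x)) (at 0)"
    unfolding has_vector_derivative_def linear_cmul[OF linear_dder[OF d]] .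
  let ?T = "(\<lambda>s. act (torus_exp (s *\<^sub>R e)) x) -` fst c"
  have "continuous_on UNIV (\<lambda>s. act (torus_exp (s *\<^sub>R e)) x)"
    by (intro continuous_act continuous_on_compose2[OF continuous_on_torus_exp[of UNIV]] continuous_intros) auto
  then have oT: "open ?T" using chart_facts(1)[OF c] by (simp add: open_vimage)
  have "((\<lambda>s. snd c (act (torus_exp (s *\<^sub>R e)) ?q)) has_vector_derivative dder (generator act e c x) ?\<theta> (snd c x)) (at 0)"
  proof (rule has_vector_derivative_transform_within_open[OF 1 oT])
    show "0 \<in> ?T" using x by (simp add: act_1)
    fix s assume "s \<in> ?T"
    then show "?\<theta> (\<gamma> s) = snd c (act (torus_exp (s *\<^sub>R e)) ?q)"
      by (simp add: flow_def \<gamma>_def chart_facts(5)[OF c] act_commute[of "torus_exp v"])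
  qed
  then show "dder (generator act e c x) ?\<theta> (snd c x) = generator act e c ?q"
    unfolding generator_def by (simp add: vector_derivative_at)
qed

text \<open>The map \<Phi> is the section \<open>k\<close> over \<open>plane y\<close> moved by the
  exponential of \<open>lin y\<close>, and its pulled-back metric is the block metric. The Einstein
  equation is then transferred from the block metric by \<open>einstein_of_pullback\<close>.
  Invertibility of the Jacobian needs no separate check, since the block metric is
  nondegenerate.\<close>

lemma einstein_principal:
  assumes c: "c \<in> A" and p: "p \<in> fst c" "p \<in> P"
  shows "ricci (g c) i j (snd c p) = lam * g c (snd c p) $ i $ j"
proof -
  obtain V k where V: "open V" "z p \<in> V" "V \<subseteq> U" "k (z p) = p" "\<And>w. w \<in> V \<Longrightarrow> k w \<in> fst c"
    "\<And>w. w \<in> V \<Longrightarrow> k w \<in> P" "\<And>w. w \<in> V \<Longrightarrow> z (k w) = w" "smooth_on V (\<lambda>w. snd c (k w))"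
    "\<And>w e. w \<in> V \<Longrightarrow> dder e (\<lambda>w. snd c (k w)) w \<in> horizontal g act c (k w)"
    apply (rule local_section[OF c p])
    subgoal for V k by (rule that[of V k])
    done
  define s where "s = (\<lambda>w. snd c (k w))"
  define lin where "lin y = (y $ 3) *\<^sub>R b $ 1 + (y $ 4) *\<^sub>R b $ 2" for y :: "real^4"
  have blin: "bounded_linear lin"
    unfolding lin_def[abs_def] by (intro bounded_linear_add bounded_linear_scaleR_const bounded_linear_vec_nth)
  define m where "m y = (lin y, s (plane y))" for y
  have oV: "open (plane -` V)"
    using linear_continuous_on[OF bounded_linear_plane] V(1) by (simp add: open_vimage)
  have msm: "smooth_on (plane -` V) m"
    unfolding m_def[abs_def] s_def
    by (intro smooth_on_Pair oV smooth_on_bounded_linear blin smooth_on_plane V)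
  \<comment> \<open>The parameters are restricted so that the moved point remains in the chart
    \<open>c\<close>.\<close>
  define Y where "Y = plane -` V \<inter> m -` flow_dom c"
  have oY: "open Y"
    unfolding Y_def by (rule continuous_open_preimage[OF smooth_on_continuous_on[OF msm] oV open_flow_dom[OF c]])
  define \<Phi> where "\<Phi> y = flow c (m y)" for y
  have \<Phi>sm: "smooth_on Y \<Phi>"
    unfolding \<Phi>_def[abs_def]
    by (rule smooth_on_compose[OF oY _ flow_smooth[OF c] smooth_on_subset[OF msm]]) (auto simp: Y_def)
  define q where "q y = act (torus_exp (lin y)) (k (plane y))" for y
  have YV: "plane y \<in> V" if "y \<in> Y" for y using that by (simp add: Y_def)
  have cs: "chart_inv c (s w) = k w" if "w \<in> V" for w
    using chart_facts(5)[OF c V(5)[OF that]] by (simp add: s_def)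
  have q: "q y \<in> fst c" "q y \<in> P" "z (q y) = plane y" "\<Phi> y = snd c (q y)" if y: "y \<in> Y" for y
  proof -
    show "q y \<in> fst c" using y cs[OF YV[OF y]] by (auto simp: Y_def m_def flow_dom_def q_def)
    show "q y \<in> P" using V(6)[OF YV[OF y]] by (simp add: q_def principal_act)
    show "z (q y) = plane y" using V(6,7)[OF YV[OF y]] by (simp add: q_def z_act)
    show "\<Phi> y = snd c (q y)" using cs[OF YV[OF y]] by (simp add: \<Phi>_def m_def flow_def q_def)
  qed
  have d\<Phi>: "dder e \<Phi> y = dder (lin e, dder (plane e) s (plane y)) (flow c) (lin y, s (plane y))" if y: "y \<in> Y" for e y
  proof -
    have "s differentiable (at (plane y))"
      unfolding s_def by (rule smooth_on_differentiable[OF V(8) YV[OF y]])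
    then have "((\<lambda>y. s (plane y)) has_derivative (\<lambda>e. dder (plane e) s (plane y))) (at y)"
      by (intro has_derivative_compose[OF bounded_linear_imp_has_derivative[OF bounded_linear_plane]] has_derivative_dder)
    then have "(m has_derivative (\<lambda>e. (lin e, dder (plane e) s (plane y)))) (at y)"
      unfolding m_def[abs_def] by (intro has_derivative_Pair bounded_linear_imp_has_derivative[OF blin])
    moreover have "flow c differentiable (at (m y))" using y flow_diff[OF c] by (simp add: Y_def)
    ultimately have "(\<Phi> has_derivative (\<lambda>e. dder (lin e, dder (plane e) s (plane y)) (flow c) (m y))) (at y)"
      unfolding \<Phi>_def[abs_def] by (intro has_derivative_compose[OF _ has_derivative_dder])
    then show ?thesis by (simp add: dder_eq m_def)
  qed
  have lin_axis: "lin (axis 1 1) = 0" "lin (axis 2 1) = 0" "lin (axis 3 1) = b $ 1" "lin (axis 4 1) = b $ 2"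
    by (simp_all add: lin_def axis_def)
  have pull: "block_metric \<Omega> h y $ i $ j = Gform (g c) (\<Phi> y) (dder (axis i 1) \<Phi> y) (dder (axis j 1) \<Phi> y)"
    if y: "y \<in> Y" for y i j
  proof -
    let ?x = "k (plane y)" and ?w = "plane y" and ?v = "lin y"
    note w = YV[OF y]
    have sx: "s ?w = snd c ?x" by (simp add: s_def)
    have x: "?x \<in> fst c" "act (torus_exp ?v) ?x \<in> fst c" using V(5)[OF w] q(1)[OF y] by (simp_all add: q_def)
    have sdiff: "s differentiable (at ?w)" unfolding s_def by (rule smooth_on_differentiable[OF V(8) w])
    define X where "X e = dder (0, dder e s ?w) (flow c) (?v, s ?w)" for e
    define Z where "Z i = generator act (b $ i) c (q y)" for i
    have J: "dder (axis 1 1) \<Phi> y = X 1" "dder (axis 2 1) \<Phi> y = X \<i>" "dder (axis 3 1) \<Phi> y = Z 1" "dder (axis 4 1) \<Phi> y = Z 2"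
      using dder_flow_torus[OF c x]
      by (simp_all add: d\<Phi>[OF y] lin_axis X_def Z_def sx q_def sdiff)
    have Xt: "X e = dder (dder e s ?w) (\<lambda>u. flow c (?v, u)) (snd c ?x)" for e
      unfolding X_def sx translate_facts(2)[OF c x] ..
    \<comment> \<open>Translation carries the horizontal tangent of the section, and every
      generator, to the translated point without changing their inner product, which is
      zero.\<close>
    have Xh: "X e \<in> horizontal g act c (q y)" for e
      unfolding horizontal_def
    proof (intro CollectI allI)
      fix a
      have "ip g c (q y) (X e) (generator act a c (q y)) = ip g c ?x (dder e s ?w) (generator act a c ?x)"
        unfolding Xt translate_facts(4)[OF c x] translate_facts(3)[OF c x] q_def ..
      also have "\<dots> = 0" using V(9)[OF w, of e] by (simp add: s_def horizontal_def)
      finally show "ip g c (q y) (X e) (generator act a c (q y)) = 0" .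
    qed
    \<comment> \<open>Since \<open>z\<close> is invariant under the torus and \<open>k\<close> is a
      section of it, \<open>z\<close> composed with \<Phi> is \<open>plane\<close>. Its derivative
      turns the isothermal identity into the conformal block.\<close>
    have zX: "dder (dder (axis n 1) \<Phi> y) (z \<circ> chart_inv c) (snd c (q y)) = plane (axis n 1)" for n
    proof -
      have "(z \<circ> chart_inv c) differentiable (at (\<Phi> y))"
        by (rule smooth_on_differentiable[OF isothermal_facts(1)[OF c]]) (use q[OF y] in auto)
      then have "dder (dder (axis n 1) \<Phi> y) (z \<circ> chart_inv c) (\<Phi> y) = dder (axis n 1) (\<lambda>y. (z \<circ> chart_inv c) (\<Phi> y)) y"
        by (rule dder_compose[OF smooth_on_differentiable[OF \<Phi>sm y], symmetric])
      also have "\<dots> = dder (axis n 1) plane y"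
        by (rule dder_cong_open[OF oY y]) (use q chart_facts(5)[OF c] in simp)
      also have "\<dots> = plane (axis n 1)"
        by (rule dder_eq[OF bounded_linear_imp_has_derivative[OF bounded_linear_plane]])
      finally show ?thesis using q(4)[OF y] by simp
    qed
    note ipX = isothermal_ip[OF c q(1,2)[OF y] Xh Xh]
    have XX: "ip g c (q y) (X 1) (X 1) = (\<Omega> ?w)\<^sup>2" "ip g c (q y) (X \<i>) (X \<i>) = (\<Omega> ?w)\<^sup>2"
      "ip g c (q y) (X 1) (X \<i>) = 0" "ip g c (q y) (X \<i>) (X 1) = 0"
      unfolding ipX using zX[of 1] zX[of 2] by (simp_all add: J q(3)[OF y] inner_complex_def)
    have XZ: "ip g c (q y) (X e) (Z n) = 0" "ip g c (q y) (Z n) (X e) = 0" for e n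
      using Xh[of e] ip_sym[OF c q(1)[OF y], of "Z n" "X e"] by (simp_all add: horizontal_def Z_def)
    have ZZ: "ip g c (q y) (Z n) (Z n') = h ?w $ n $ n'" for n n'
    proof -
      have "h (z (q y)) = gram g act b c (q y)" using h_gram c q(1,2)[OF y] by simp
      then show ?thesis by (simp add: q(3)[OF y] gram_def Z_def)
    qed
    have "\<forall>i j. block_metric \<Omega> h y $ i $ j = ip g c (q y) (dder (axis i 1) \<Phi> y) (dder (axis j 1) \<Phi> y)"
      unfolding forall_4 J XX XZ ZZ by (simp add: block_metric_def Let_def vector_4)
    then show ?thesis unfolding ip_Gform q(4)[OF y] by blast
  qed
  have H: "metric_on Y (block_metric \<Omega> h)"
    by (rule metric_on_subset[OF metric_on_block oY]) (intro subsetI vimageI2 subsetD[OF V(3)] YV)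
  \<comment> \<open>The torus parameter is zero and the base point is \<open>z p\<close>, where the
    section passes through \<open>p\<close>; hence \<Phi> maps \<open>y0\<close> to
    \<open>snd c p\<close>.\<close>
  define y0 :: "real^4" where "y0 = vector [Re (z p), Im (z p), 0, 0]"
  have y0: "plane y0 = z p" "lin y0 = 0"
    by (simp_all add: y0_def plane_def lin_def vector_4)
  have yY: "y0 \<in> Y"
    using V(2,4) p flow_dom_0[OF c] by (simp add: Y_def y0 m_def s_def)
  have \<Phi>0: "\<Phi> y0 = snd c p"
    using q(4)[OF yY] by (simp add: q_def y0 V(4) act_1)
  have w0: "plane y0 \<in> U" using p(2) y0 by simp
  have ein: "ricci (block_metric \<Omega> h) i j y0 = lam * block_metric \<Omega> h y0 $ i $ j" for i j
    by (rule einstein_block_complex[OF w0]) (use w0 rho_eq K_eq Omega_eq remaining_zero in auto)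
  have sub: "\<Phi> ` Y \<subseteq> snd c ` fst c" using q(1,4) by auto
  have "ricci (g c) i j (\<Phi> y0) = lam * g c (\<Phi> y0) $ i $ j"
    by (rule einstein_of_pullback[OF metric_on_chart[OF c] H \<Phi>sm sub pull yY ein])
  then show ?thesis unfolding \<Phi>0 .
qed

lemma einstein: "einstein_metric A g lam"
  unfolding einstein_metric_def
proof (intro ballI allI)
  fix c u i j
  assume c: "c \<in> A" and u: "u \<in> snd c ` fst c"
  let ?S = "snd c ` fst c"
  define f where "f u = ricci (g c) i j u - lam * g c u $ i $ j" for u
  have G: "metric_on ?S (g c)" by (rule metric_on_chart[OF c])
  have "continuous_on ?S f"
    unfolding f_def
    by (intro continuous_intros smooth_on_continuous_on[OF smooth_on_ricci[OF G]] smooth_on_continuous_on[OF metric_on_entry[OF G]])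
  then have o: "open (?S \<inter> f -` (- {0}))"
    by (rule continuous_open_preimage) (use chart_facts(2)[OF c] in auto)
  have "f u = 0"
  proof (rule ccontr)
    assume "f u \<noteq> 0"
    let ?W = "fst c \<inter> snd c -` (?S \<inter> f -` (- {0}))"
    have "open ?W" by (rule continuous_open_preimage[OF chart_facts(3,1)[OF c] o])
    moreover have "?W \<noteq> {}" using u \<open>f u \<noteq> 0\<close> by auto
    ultimately obtain p where "p \<in> ?W" "p \<in> P" using P_dense by blast
    then show False using einstein_principal[OF c, of p i j] by (auto simp: f_def)
  qed
  then show "ricci (g c) i j u = lam * g c u $ i $ j" by (simp add: f_def)
qed

end

theorem theorem4p16:
  fixes A :: "'m::{t2_space, second_countable_topology} chart set"
    and g :: "'m metric"
    and act :: "'m action"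
    and b :: "real^2^2"
    and z :: "'m \<Rightarrow> complex"
    and \<Omega> :: "complex \<Rightarrow> real"
    and h :: "complex \<Rightarrow> real^2^2"
    and lam :: real
  assumes "smooth_atlas A"
    and "compact (UNIV :: 'm set)"
    and "simply_connected (UNIV :: 'm set)"
    and "riemannian_metric A g"
    and "smooth_torus_action A act"
    and "effective_action act"
    and "\<forall>t\<in>torus. preserves_metric A g (act t)"
    and "orthogonally_transitive A g act"
    and "polygonal_orbit_space A act"
    and "invertible b"
    and "\<forall>c\<in>A. \<forall>p\<in>fst c. det (gram g act b c p) = 0 \<longleftrightarrow> p \<notin> principal_points act"
    and "isothermal_coordinates A g act z \<Omega>"
    and "\<forall>c\<in>A. \<forall>p\<in>fst c \<inter> principal_points act. h (z p) = gram g act b c p"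
    and "\<forall>w\<in>z ` principal_points act. rho_equation h \<Omega> lam w"
    and "\<forall>w\<in>z ` principal_points act. K_equation h w"
    and "\<forall>w\<in>z ` principal_points act. Omega_equation h \<Omega> w"
    and "remaining_at_boundary act z h \<Omega>"
  shows "einstein_metric A g lam"
proof -
  interpret torus_einstein A g act b z \<Omega> h lam
    using assms by unfold_locales
  show ?thesis by (rule einstein)
qed

end
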